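(* Consider the dual risk model with proportional gains and FGM-dependent Erlang gains described in the context, with ruin probability $R(x)$ and Laplace transform $\rho(s)=\int_0^\infty e^{-sx}R(x)\,dx$. Put $$J(s;\theta)=\frac{\phi(s)-\theta h^{*}(s)}{1+a}\Big(\frac{\mu(1+a)}{\mu(1+a)-s}\Big)^{n}+\frac{2\theta h^{*}(s)}{1+a}\sum_{i=0}^{n-1}\binom{n-1+i}{i}\Big(\frac{\mu(1+a)}{2\mu(1+a)-s}\Big)^{n+i},$$ $$\begin{aligned}H(s;\theta)=\;&\frac{1-\phi(s)}{s}+\frac{(-1)^{n-1}(\phi(s)-\theta h^{*}(s))}{1+a}\sum_{l=0}^{n-1}\frac{\rho^{(l)}(\mu)}{l!}\Big(\frac{\mu(1+a)}{s-\mu(1+a)}\Big)^{n-l}\\&+2\theta h^{*}(s)\sum_{i=0}^{n-1}\binom{n-1+i}{i}\sum_{l=0}^{n-1+i}\frac{(-1)^{n+i-1}}{l!\,2^{l}(1+a)}\Big(\frac{\mu(1+a)}{s-2\mu(1+a)}\Big)^{n+i}\rho^{(l)}(2\mu),\end{aligned}$$ where $\rho^{(l)}$ denotes the $l$-th derivative of $\rho$. Then the Laplace transform of the ruin probability is given by $$\rho(s)=\sum_{k=0}^{\infty}\Big(\prod_{j=0}^{k-1}J\big(\tfrac{s}{(1+a)^{j}};\theta\big)\Big)H\big(\tfrac{s}{(1+a)^{k}};\theta\big),$$ an empty product being $1$, where the terms $\rho^{(l)}(\mu)$, $l=0,1,\dots,n-1$, and $\rho^{(l)}(2\mu)$, $l=0,1,\dots,2n-2$,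 are obtained as the solution of a system of $3n-1$ equations that is derived by differentiating this identity $l$ times with respect to $s$ and setting $s=\mu$ (for $l=0,\dots,n-1$) and $s=2\mu$ (for $l=0,\dots,2n-2$), respectively.
   Context: Model. The surplus $U(t)$ starts at $U(0)=x>0$ and decreases at unit rate between gain arrivals. Let $(B_i,C_i)$, $i\ge 1$, be i.i.d. random vectors distributed as $(B,C)$; $B_i$ are the gain interarrival times and $C_i$ the gain sizes. If the surplus just before the $i$-th gain is $u$, it jumps to $(1+a)u+C_i$, where $a>0$ is a constant. Ruin occurs when the surplus hits $0$: $\tau_x=\inf\{t\ge 0:U(t)=0\}$, and $R(x)=P(\tau_x<\infty\mid U(0)=x)$. $B$ has c.d.f. $F_B$, density $f_B$ and Laplace–Stieltjes transform $\phi(s)=E(e^{-sB})$. $C$ is Erlang distributed with $n\ge 1$ stages and rate $\mu>0$, i.e. with density $f_C(t)=\frac{\mu^n}{(n-1)!}t^{n-1}e^{-\mu t}$ and c.d.f. $F_C$. The components of $(B,C)$ are dependent through the Farlie–Gumbel–Morgenstern (FGM) copula $C_\theta(u,v)=uv+\theta uv(1-u)(1-v)$ with $\theta\in(-1,1)$, so that $(B,C)$ has joint density $$f_{B,C}(x,t)=f_B(x)f_C(t)\big[1+\theta(1-2F_B(x))(1-2F_C(t))\big].$$ Notation: $h(x)=f_B(x)(1-2F_B(x))$ and $h^{*}(s)=\int_0^\infty e^{-sx}h(x)\,dx$. The functions $J$ and $H$ have singularities at $s=\mu(1+a)$ and $s=2\mu(1+a)$; the resulting singularities of the series at $s=\mu(1+a)^{j+1}$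 and $s=2\mu(1+a)^{j+1}$, $j=0,1,\dots$, are removable.
   Formalization: The printed H is false for n≥2 (e.g. θ=0, n=2, μ=2) and is corrected: in the first sum ρ^(l)(μ) gets a factor μ^l; in the second sum 1/(l! 2^l) becomes μ^l/l! and the exponent n+i becomes n+i−l. For n=1 nothing changes. *)

theory Defs
  imports "HOL-Probability.Probability" "HOL-Complex_Analysis.Complex_Analysis"
begin

definition fgm_copula :: "real \<Rightarrow> real \<Rightarrow> real \<Rightarrow> real" where
  "fgm_copula \<theta> u v = u * v + \<theta> * u * v * (1 - u) * (1 - v)"

text \<open>
  Indices start at 0: \<^term>\<open>B 0\<close>, \<^term>\<open>C 0\<close> are the first interarrival time and the first gain.
  Identical distribution of the pairs follows from \<open>joint_cdf\<close>, since the marginals do not depend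
  on \<^term>\<open>i\<close>. \<^const>\<open>erlang_density\<close> counts stages from 0, hence the argument \<^term>\<open>n - 1\<close>.
\<close>

locale dual_risk_model = prob_space M
  for M :: "'w measure" and B C :: "nat \<Rightarrow> 'w \<Rightarrow> real" and f\<^sub>B :: "real \<Rightarrow> real"
    and n :: nat and \<mu> \<theta> a :: real +
  assumes stages: "1 \<le> n"
    and rate_pos: "0 < \<mu>"
    and dependence: "-1 < \<theta>" "\<theta> < 1"
    and proportion_pos: "0 < a"
    and density_nonneg: "\<And>t. 0 \<le> f\<^sub>B t"
    and density_support: "\<And>t. t < 0 \<Longrightarrow> f\<^sub>B t = 0"
    and interarrival: "\<And>i. distributed M lborel (B i) (\<lambda>t. ennreal (f\<^sub>B t))"
    and gain: "\<And>i. distributed M lborel (C i) (\<lambda>t. ennreal (erlang_density (n - 1) \<mu> t))"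
    and joint_cdf: "\<And>i u v. prob {\<omega> \<in> space M. B i \<omega> \<le> u \<and> C i \<omega> \<le> v} =
        fgm_copula \<theta> (cdf (distr M borel (B i)) u) (cdf (distr M borel (C i)) v)"
    and independent: "indep_vars (\<lambda>_. borel \<Otimes>\<^sub>M borel) (\<lambda>i \<omega>. (B i \<omega>, C i \<omega>)) UNIV"

text \<open>The next four functions are pathwise: \<open>b\<close> and \<open>c\<close> are realised interarrival times and gains.\<close>

definition gain_time :: "(nat \<Rightarrow> real) \<Rightarrow> nat \<Rightarrow> real" where
  "gain_time b i = (\<Sum>j<i. b j)"

primrec post_gain_level :: "real \<Rightarrow> real \<Rightarrow> (nat \<Rightarrow> real) \<Rightarrow> (nat \<Rightarrow> real) \<Rightarrow> nat \<Rightarrow> real" where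
  "post_gain_level a x b c 0 = x"
| "post_gain_level a x b c (Suc i) = (1 + a) * (post_gain_level a x b c i - b i) + c i"

text \<open>
  The path is not stopped at ruin, which does not affect the first time it is at \<open>0\<close>.
  If infinitely many gains occurred up to time \<open>t\<close> (a null event), \<^const>\<open>card\<close> would return \<open>0\<close>.
\<close>

definition surplus :: "real \<Rightarrow> real \<Rightarrow> (nat \<Rightarrow> real) \<Rightarrow> (nat \<Rightarrow> real) \<Rightarrow> real \<Rightarrow> real" where
  "surplus a x b c t =
     (let N = card {i. 1 \<le> i \<and> gain_time b i \<le> t}
      in post_gain_level a x b c N - (t - gain_time b N))"

definition ruin_time :: "real \<Rightarrow> real \<Rightarrow> (nat \<Rightarrow> real) \<Rightarrow> (nat \<Rightarrow> real) \<Rightarrow> ereal" where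
  "ruin_time a x b c = Inf (ereal ` {t. 0 \<le> t \<and> surplus a x b c t = 0})"

definition ruin_prob ::
    "'w measure \<Rightarrow> (nat \<Rightarrow> 'w \<Rightarrow> real) \<Rightarrow> (nat \<Rightarrow> 'w \<Rightarrow> real) \<Rightarrow> real \<Rightarrow> real \<Rightarrow> real" where
  "ruin_prob M B C a x =
     measure M {\<omega> \<in> space M. ruin_time a x (\<lambda>i. B i \<omega>) (\<lambda>i. C i \<omega>) < \<infinity>}"

definition laplace :: "(real \<Rightarrow> real) \<Rightarrow> complex \<Rightarrow> complex" where
  "laplace g s = (LINT x:{0..}|lborel. exp (- s * of_real x) * of_real (g x))"

definition laplace_stieltjes :: "'w measure \<Rightarrow> ('w \<Rightarrow> real) \<Rightarrow> complex \<Rightarrow> complex" where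
  "laplace_stieltjes M X s = (LINT \<omega>|M. exp (- s * of_real (X \<omega>)))"

definition J_fun :: "nat \<Rightarrow> real \<Rightarrow> real \<Rightarrow> real \<Rightarrow> (complex \<Rightarrow> complex) \<Rightarrow> (complex \<Rightarrow> complex) \<Rightarrow>
    complex \<Rightarrow> complex" where
  "J_fun n \<mu> a \<theta> \<phi> hs s =
     (\<phi> s - \<theta> * hs s) / (1 + a) * (\<mu> * (1 + a) / (\<mu> * (1 + a) - s)) ^ n
     + 2 * \<theta> * hs s / (1 + a) *
       (\<Sum>i = 0..n - 1. of_nat ((n - 1 + i) choose i) *
          (\<mu> * (1 + a) / (2 * \<mu> * (1 + a) - s)) ^ (n + i))"

text \<open>
  The sequences \<open>y\<close>, \<open>z\<close> stand for the derivatives \<open>\<rho>\<^sup>(\<^sup>l\<^sup>)(\<mu>)\<close>, \<open>\<rho>\<^sup>(\<^sup>l\<^sup>)(2\<mu>)\<close>. With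
  \<open>c = \<lambda> - s / (1 + a)\<close> and \<open>\<lambda> \<in> {\<mu>, 2\<mu>}\<close>, a gain density proportional to
  \<open>\<mu>\<^sup>m t\<^sup>m\<^sup>-\<^sup>1 e\<^sup>-\<^sup>\<lambda>\<^sup>t / (m-1)!\<close> contributes
  \<open>- (1 + a)\<^sup>-\<^sup>1 (\<mu> / c)\<^sup>m \<Sum>l<m. (- c)\<^sup>l \<rho>\<^sup>(\<^sup>l\<^sup>)(\<lambda>) / l!\<close> to \<open>H\<close>, and
  \<open>(\<mu> / c)\<^sup>m c\<^sup>l = \<mu>\<^sup>l (\<mu> / c)\<^sup>m\<^sup>-\<^sup>l\<close>. This is the origin of the factors \<open>\<mu>\<^sup>l\<close> and of the exponents
  \<open>n - l\<close> and \<open>n + i - l\<close>, without which the poles of \<open>H\<close> and \<open>J\<close> would not cancel.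
\<close>

definition H_fun :: "nat \<Rightarrow> real \<Rightarrow> real \<Rightarrow> real \<Rightarrow> (complex \<Rightarrow> complex) \<Rightarrow> (complex \<Rightarrow> complex) \<Rightarrow>
    (nat \<Rightarrow> complex) \<Rightarrow> (nat \<Rightarrow> complex) \<Rightarrow> complex \<Rightarrow> complex" where
  "H_fun n \<mu> a \<theta> \<phi> hs y z s =
     (1 - \<phi> s) / s
     + (-1) ^ (n - 1) * (\<phi> s - \<theta> * hs s) / (1 + a) *
       (\<Sum>l = 0..n - 1. \<mu> ^ l * y l / fact l *
          (\<mu> * (1 + a) / (s - \<mu> * (1 + a))) ^ (n - l))
     + 2 * \<theta> * hs s *
       (\<Sum>i = 0..n - 1. of_nat ((n - 1 + i) choose i) *
          (\<Sum>l = 0..n - 1 + i. (-1) ^ (n + i - 1) * \<mu> ^ l / (fact l * (1 + a)) *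
             (\<mu> * (1 + a) / (s - 2 * \<mu> * (1 + a))) ^ (n + i - l) * z l))"

definition series_term :: "nat \<Rightarrow> real \<Rightarrow> real \<Rightarrow> real \<Rightarrow> (complex \<Rightarrow> complex) \<Rightarrow> (complex \<Rightarrow> complex) \<Rightarrow>
    (nat \<Rightarrow> complex) \<Rightarrow> (nat \<Rightarrow> complex) \<Rightarrow> complex \<Rightarrow> nat \<Rightarrow> complex" where
  "series_term n \<mu> a \<theta> \<phi> hs y z s k =
     (\<Prod>j<k. J_fun n \<mu> a \<theta> \<phi> hs (s / (1 + a) ^ j)) * H_fun n \<mu> a \<theta> \<phi> hs y z (s / (1 + a) ^ k)"

definition singular_points :: "real \<Rightarrow> real \<Rightarrow> complex set" where
  "singular_points \<mu> a =
     range (\<lambda>j. of_real (\<mu> * (1 + a) ^ (j + 1))) \<union> range (\<lambda>j. of_real (2 * \<mu> * (1 + a) ^ (j + 1)))"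

text \<open>
  The \<open>n + (2 n - 1) = 3 n - 1\<close> equations for the unknowns \<open>y l\<close> (\<open>l \<le> n - 1\<close>) and \<open>z l\<close>
  (\<open>l \<le> 2 n - 2\<close>). \<^const>\<open>remove_sings\<close> matters only if \<open>(1 + a)\<^sup>j = 2\<close> for some \<open>j \<ge> 1\<close>, as
  then the evaluation point \<open>2 \<mu>\<close> is itself one of the removable singularities of the series.
\<close>

definition solves_system :: "nat \<Rightarrow> real \<Rightarrow> real \<Rightarrow> real \<Rightarrow> (complex \<Rightarrow> complex) \<Rightarrow>
    (complex \<Rightarrow> complex) \<Rightarrow> (nat \<Rightarrow> complex) \<Rightarrow> (nat \<Rightarrow> complex) \<Rightarrow> bool" where
  "solves_system n \<mu> a \<theta> \<phi> hs y z \<longleftrightarrow>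
     (let S = remove_sings (\<lambda>s. \<Sum>k. series_term n \<mu> a \<theta> \<phi> hs y z s k)
      in (\<forall>l \<le> n - 1. y l = (deriv ^^ l) S (of_real \<mu>)) \<and>
         (\<forall>l \<le> 2 * n - 2. z l = (deriv ^^ l) S (of_real (2 * \<mu>))))"

end

theory Submission
  imports Defs "HOL-Computational_Algebra.Polynomial"
begin

text \<open>
  Conditioning on the first gain gives the renewal equation \<open>R = P(B > x) + T R\<close> with
  \<open>T g x = E[g ((1 + a) (x - B) + C); B \<le> x]\<close>. The Laplace transform of \<open>T g\<close> at \<open>s\<close> is \<open>J(s)\<close> times that of \<open>g\<close>
  at \<open>s / (1 + a)\<close>, plus terms with the derivatives at \<open>\<mu>\<close> and \<open>2\<mu>\<close>; iterating this yields the series. Its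
  remainder vanishes because \<open>|(1 + a) J(s)| \<le> \<phi>(Re s) + O(|s|)\<close> near \<open>0\<close>, no moment of \<open>B\<close> being available:
  either \<open>\<Prod>\<phi>(Re s / (1 + a)\<^sup>j)\<close> tends to \<open>0\<close>, or \<open>\<Sum>B\<^sub>j / (1 + a)\<^sup>j\<close> converges and \<open>R\<close> vanishes at infinity.

  For the uniqueness of the solution of the linear system, the difference \<open>d\<close> of two solutions satisfies
  \<open>d = A d\<close> with a square matrix \<open>A\<close>. If \<open>d \<noteq> 0\<close>, some \<open>w \<noteq> 0\<close> satisfies \<open>w A = w\<close>. But \<open>T\<close> contracts \<open>L\<^sup>1\<close> by the
  factor \<open>1 / (1 + a)\<close>, so \<open>g = T g + f\<close> is solvable for all \<open>f \<in> L\<^sup>1\<close>, and \<open>w\<close> annihilates the data induced by every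
  such \<open>f\<close>; these data are dense, hence \<open>w = 0\<close>.
\<close>

section \<open>Laplace transforms and gamma kernels\<close>

text \<open>The remainder is a borderline case: the product of k factors \<open>J\<close> decays
  like (1 + a)^-k, while rho(s / (1 + a)^k) may grow like (1 + a)^k, since nothing forces R to be
  integrable. The geometric rate alone therefore proves nothing, and the factors phi(Re s / (1 +
  a)^j) are carried along. They appear cleanly because the part of \<open>J\<close> that belongs to
  the dependence cancels at 0. Uniqueness has an obstacle of its own. For an arbitrary candidate (y,
  z) the series may have genuine poles, and if (1 + a)^j = 2 one of them can sit at the evaluation
  point 2 mu. The equations at mu, which is always a regular point, have to be used first to exclude
  that pole; only then do all equations become contour coefficients on small circles, which are
  linear in the unknowns. The dense family consists of polynomials times one exponential exp(-Lambda
  x). Their transforms are polynomials in 1 / (s + Lambda), and these can be concentrated on a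
  prescribed jet at mu or 2 mu.\<close>

text \<open>Gaussian elimination: a pivot in equation \<open>i0\<close> removes one unknown and
  leaves one equation fewer. At the end this turns a right null vector of a square matrix into a
  left one without determinants.\<close>

lemma underdetermined_system:
  fixes A :: "'i \<Rightarrow> 'j \<Rightarrow> 'a::field"
  assumes "finite I" "finite J" "card I < card J"
  shows "\<exists>x. (\<exists>j\<in>J. x j \<noteq> 0) \<and> (\<forall>i\<in>I. (\<Sum>j\<in>J. A i j * x j) = 0)"
  using assms
proof (induction I arbitrary: J A rule: finite_induct)
  case empty
  then obtain j where "j \<in> J" by fastforce
  then show ?case by (intro exI[of _ "\<lambda>_. 1"]) auto
next
  case (insert i0 I J A)
  show ?case
  proof (cases "\<forall>j\<in>J. A i0 j = 0")
    case True
    obtain x where "\<exists>j\<in>J. x j \<noteq> 0" "\<forall>i\<in>I. (\<Sum>j\<in>J. A i j * x j) = 0"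
      using insert.IH[of J A] insert.prems insert.hyps by auto
    with True show ?thesis by (intro exI[of _ x]) auto
  next
    case False
    then obtain j0 where j0: "j0 \<in> J" "A i0 j0 \<noteq> 0" by blast
    define A' where "A' i j = A i j - A i j0 * A i0 j / A i0 j0" for i j
    obtain x where x: "\<exists>j\<in>J - {j0}. x j \<noteq> 0" "\<forall>i\<in>I. (\<Sum>j\<in>J - {j0}. A' i j * x j) = 0"
    proof -
      have "card I < card (J - {j0})" using insert.prems insert.hyps j0 by simp
      then show ?thesis using insert.IH[of "J - {j0}" A'] insert.prems that by blast
    qed
    define x' where "x' = x(j0 := - (\<Sum>j\<in>J - {j0}. A i0 j * x j) / A i0 j0)"
    have split: "(\<Sum>j\<in>J. A i j * x' j) = A i j0 * x' j0 + (\<Sum>j\<in>J - {j0}. A i j * x j)" for i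
      unfolding sum.remove[OF insert.prems(1) j0(1)] by (simp add: x'_def)
    have "(\<Sum>j\<in>J. A i j * x' j) = 0" if "i \<in> insert i0 I" for i
    proof (cases "i = i0")
      case True
      then show ?thesis using j0 by (simp add: split) (simp add: x'_def)
    next
      case False
      have "(\<Sum>j\<in>J - {j0}. A i j * x j) =
          (\<Sum>j\<in>J - {j0}. A' i j * x j + (A i j0 / A i0 j0) * (A i0 j * x j))"
        by (intro sum.cong) (auto simp: A'_def algebra_simps)
      also have "\<dots> = (A i j0 / A i0 j0) * (\<Sum>j\<in>J - {j0}. A i0 j * x j)"
        using x(2) that False by (simp add: sum.distrib sum_distrib_left)
      finally show ?thesis by (simp add: split) (simp add: x'_def)
    qed
    moreover have "\<exists>j\<in>J. x' j \<noteq> 0" using x(1) by (auto simp: x'_def)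
    ultimately show ?thesis by blast
  qed
qed

section \<open>Analytic properties of Laplace transforms\<close>

text \<open>One condition for two classes: bounded functions such as the ruin probability, and
  integrable functions such as \<open>f\<^sub>B\<close>, which may be unbounded.\<close>

definition laplace_integrable :: "(real \<Rightarrow> real) \<Rightarrow> bool" where
  "laplace_integrable g \<longleftrightarrow> g \<in> borel_measurable borel \<and>
     (\<forall>\<sigma>>0. set_integrable lborel {0..} (\<lambda>x. exp (- \<sigma> * x) * g x))"

lemma has_bochner_integral_power_exp:
  fixes u :: real
  assumes "0 < u"
  shows "has_bochner_integral lborel (\<lambda>x. indicator {0..} x * (x ^ k * exp (- u * x))) (fact k / u ^ Suc k)"
proof -
  have "has_bochner_integral lborel (\<lambda>x. (0 + u * x) ^ k * exp (- (0 + u * x)) * indicat_real {0..} (0 + u * x))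
     (fact k /\<^sub>R \<bar>u\<bar>)"
    using lborel_has_bochner_integral_real_affine_iff[of u "\<lambda>x. x ^ k * exp (- x) * indicat_real {0..} x" "fact k" 0]
      has_bochner_integral_I0i_power_exp_m'[of k] assms by simp
  then have "has_bochner_integral lborel
      (\<lambda>x. (1 / u ^ k) * ((0 + u * x) ^ k * exp (- (0 + u * x)) * indicat_real {0..} (0 + u * x)))
     ((1 / u ^ k) * (fact k /\<^sub>R \<bar>u\<bar>))"
    by (rule has_bochner_integral_mult_right)
  moreover have "(\<lambda>x. (1 / u ^ k) * ((0 + u * x) ^ k * exp (- (0 + u * x)) * indicat_real {0..} (0 + u * x)))
      = (\<lambda>x. indicator {0..} x * (x ^ k * exp (- u * x)))"
    using assms by (auto simp: indicator_def power_mult_distrib zero_le_mult_iff)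
  moreover have "(1 / u ^ k) * (fact k /\<^sub>R \<bar>u\<bar>) = fact k / u ^ Suc k"
    using assms by (simp add: field_simps)
  ultimately show ?thesis by (simp only:)
qed

lemma set_integrable_power_exp:
  fixes u :: real
  assumes "0 < u"
  shows "set_integrable lborel {0..} (\<lambda>x. x ^ k * exp (- u * x))"
  using has_bochner_integral_power_exp[OF assms, of k]
  by (simp add: set_integrable_def has_bochner_integral_iff)

lemma laplace_integrable_bounded:
  assumes [measurable]: "g \<in> borel_measurable borel" and "\<And>x. 0 \<le> x \<Longrightarrow> \<bar>g x\<bar> \<le> K"
  shows "laplace_integrable g"
  unfolding laplace_integrable_def
proof (intro conjI allI impI)
  fix \<sigma> :: real assume "0 < \<sigma>"
  then have "set_integrable lborel {0..} (\<lambda>x. x ^ 0 * exp (- \<sigma> * x))" by (rule set_integrable_power_exp)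
  then have "integrable lborel (\<lambda>x. K * (indicator {0..} x * exp (- \<sigma> * x)))"
    by (simp add: set_integrable_def)
  then show "set_integrable lborel {0..} (\<lambda>x. exp (- \<sigma> * x) * g x)"
    unfolding set_integrable_def
    by (rule Bochner_Integration.integrable_bound)
      (use assms(2) in \<open>auto simp: abs_mult indicator_def mult.commute[of K] 
         intro!: mult_left_mono order.trans[OF _ abs_ge_self]\<close>)
qed (use assms in auto)

lemma laplace_integrable_integrable:
  assumes [measurable]: "g \<in> borel_measurable borel" and "set_integrable lborel {0..} g"
  shows "laplace_integrable g"
  unfolding laplace_integrable_def
proof (intro conjI allI impI)
  fix \<sigma> :: real assume "0 < \<sigma>"
  then show "set_integrable lborel {0..} (\<lambda>x. exp (- \<sigma> * x) * g x)"
    unfolding set_integrable_def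
    by (intro Bochner_Integration.integrable_bound[OF assms(2)[unfolded set_integrable_def]])
      (auto simp: abs_mult indicator_def intro!: mult_left_le_one_le)
qed (use assms in auto)

text \<open>Expands exp(-(s - s0) x) under the integral. With d = |s - s0| the norms of all terms
  add up to exp(-(Re s0 - d) x) |g x|, which is integrable because d < Re s0. This single expansion
  yields both the holomorphy of the transform and the formula for its derivatives.\<close>

lemma laplace_sums:
  assumes g: "laplace_integrable g" and s0: "0 < Re s0" and s: "s \<in> ball s0 (Re s0)"
  shows "(\<lambda>l. (LINT x:{0..}|lborel. exp (- s0 * of_real x) * (- of_real x) ^ l * of_real (g x)) / fact l
            * (s - s0) ^ l) sums laplace g s"
proof -
  have [measurable]: "g \<in> borel_measurable borel" using g by (simp add: laplace_integrable_def)
  define d where "d = norm (s - s0)"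
  have d: "d < Re s0" "0 \<le> d" using s by (auto simp: d_def dist_norm norm_minus_commute)
  define f where "f l x = indicator {0..} x *\<^sub>R (exp (- s0 * of_real x) * (- of_real x) ^ l * of_real (g x)
      / fact l * (s - s0) ^ l)" for l and x :: real
  define b where "b x = indicator {0..} x *\<^sub>R (exp (- (Re s0 - d) * x) * \<bar>g x\<bar>)" for x
  have ib: "integrable lborel b"
  proof -
    have "set_integrable lborel {0..} (\<lambda>x. exp (- (Re s0 - d) * x) * g x)"
      using g d unfolding laplace_integrable_def by (metis diff_gt_0_iff_gt)
    then have "integrable lborel (\<lambda>x. \<bar>indicator {0..} x *\<^sub>R (exp (- (Re s0 - d) * x) * g x)\<bar>)"
      unfolding set_integrable_def by (rule integrable_abs)
    moreover have "\<bar>indicator {0..} x *\<^sub>R (exp (- (Re s0 - d) * x) * g x)\<bar> = b x" for x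
      by (simp add: b_def abs_mult)
    ultimately show ?thesis by simp
  qed
  have [measurable]: "f l \<in> borel_measurable lborel" for l unfolding f_def by measurable
  have nf: "norm (f l x) = indicator {0..} x * (exp (- Re s0 * x) * \<bar>g x\<bar> * ((d * x) ^ l / fact l))" for l x
    by (simp add: f_def norm_mult norm_divide norm_power d_def power_mult_distrib indicator_def)
  have expo: "(\<lambda>l. (d * x) ^ l / fact l) sums exp (d * x)" for x
    using exp_converges[of "d * x"] by (simp add: divide_inverse mult.commute)
  have nfs: "(\<lambda>l. norm (f l x)) sums b x" for x
  proof -
    have "(\<lambda>l. norm (f l x)) sums (indicator {0..} x * (exp (- Re s0 * x) * \<bar>g x\<bar> * exp (d * x)))"
      unfolding nf by (intro sums_mult expo)
    also have "indicator {0..} x * (exp (- Re s0 * x) * \<bar>g x\<bar> * exp (d * x)) = b x"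
      by (simp add: b_def algebra_simps flip: exp_add)
    finally show ?thesis .
  qed
  have psum: "(\<Sum>l\<in>L. norm (f l x)) \<le> b x" if "finite L" for L x
    using sum_le_suminf[OF sums_summable[OF nfs] that] sums_unique[OF nfs] by simp
  have inf: "integrable lborel (f l)" for l
  proof (rule Bochner_Integration.integrable_bound[OF ib])
    show "AE x in lborel. norm (f l x) \<le> norm (b x)"
      using psum[of "{l}"] by (auto intro!: AE_I2 order.trans[OF _ abs_ge_self])
  qed auto
  have "(\<lambda>l. integral\<^sup>L lborel (f l)) sums (LINT x|lborel. (\<Sum>l. f l x))"
  proof (rule sums_integral)
    show "AE x in lborel. summable (\<lambda>l. norm (f l x))" using nfs by (auto dest: sums_summable)
    show "summable (\<lambda>l. LINT x|lborel. norm (f l x))"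
    proof (rule summableI_nonneg_bounded)
      fix N
      have "(\<Sum>l<N. LINT x|lborel. norm (f l x)) = (LINT x|lborel. (\<Sum>l<N. norm (f l x)))"
        using inf by (subst Bochner_Integration.integral_sum) auto
      also have "\<dots> \<le> integral\<^sup>L lborel b"
        using inf ib psum by (intro integral_mono) auto
      finally show "(\<Sum>l<N. LINT x|lborel. norm (f l x)) \<le> integral\<^sup>L lborel b" .
    qed auto
  qed (rule inf)
  moreover have "integral\<^sup>L lborel (f l) =
      (LINT x:{0..}|lborel. exp (- s0 * of_real x) * (- of_real x) ^ l * of_real (g x)) / fact l * (s - s0) ^ l" for l
    unfolding set_lebesgue_integral_def f_def
    by (subst integral_divide_zero[symmetric], subst integral_mult_left_zero[symmetric])
       (intro Bochner_Integration.integral_cong, auto simp: indicator_def)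
  moreover have "(\<Sum>l. f l x) = indicator {0..} x *\<^sub>R (exp (- s * of_real x) * of_real (g x))" for x
  proof -
    have "(\<lambda>l. ((- (s - s0) * of_real x) ^ l /\<^sub>R fact l)) sums exp (- (s - s0) * of_real x)"
      by (rule exp_converges)
    then have "(\<lambda>l. (indicator {0..} x *\<^sub>R (exp (- s0 * of_real x) * of_real (g x))) * ((- (s - s0) * of_real x) ^ l /\<^sub>R fact l)) 
      sums ((indicator {0..} x *\<^sub>R (exp (- s0 * of_real x) * of_real (g x))) * exp (- (s - s0) * of_real x))"
      by (rule sums_mult)
    moreover have "(indicator {0..} x *\<^sub>R (exp (- s0 * of_real x) * of_real (g x))) * ((- (s - s0) * of_real x) ^ l /\<^sub>R fact l)
       = f l x" for l
    proof -
      have "(- (s - s0) * of_real x) ^ l = (s - s0) ^ l * (- of_real x) ^ l"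
        by (subst power_mult_distrib[symmetric]) (simp only: mult_minus_left mult_minus_right)
      then show ?thesis by (simp add: f_def indicator_def scaleR_conv_of_real divide_inverse algebra_simps)
    qed
    moreover have "(indicator {0..} x *\<^sub>R (exp (- s0 * of_real x) * of_real (g x))) * exp (- (s - s0) * of_real x)
        = indicator {0..} x *\<^sub>R (exp (- s * of_real x) * of_real (g x))"
      by (simp add: indicator_def algebra_simps flip: exp_add)
    ultimately show ?thesis by (simp add: sums_iff)
  qed
  ultimately show ?thesis by (simp add: laplace_def set_lebesgue_integral_def)
qed

lemma laplace_holomorphic:
  assumes "laplace_integrable g"
  shows "laplace g holomorphic_on {s. 0 < Re s}"
proof -
  have "\<exists>U. open U \<and> s0 \<in> U \<and> laplace g holomorphic_on U" if "0 < Re s0" for s0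
    using power_series_holomorphic[OF laplace_sums[OF assms that]] that
    by (intro exI[of _ "ball s0 (Re s0)"]) auto
  then show ?thesis
    by (metis analytic_imp_holomorphic analytic_on_holomorphic analytic_at analytic_on_analytic_at mem_Collect_eq)
qed

lemma laplace_higher_deriv:
  assumes "laplace_integrable g" "0 < Re s0"
  shows "(deriv ^^ l) (laplace g) s0 =
    (LINT x:{0..}|lborel. exp (- s0 * of_real x) * (- of_real x) ^ l * of_real (g x))" (is "_ = ?c l")
proof -
  have "(laplace g \<circ> (+) s0) has_fps_expansion Abs_fps (\<lambda>l. ?c l / fact l)"
  proof (rule has_fps_expansionI)
    have "eventually (\<lambda>u. u \<in> ball 0 (Re s0)) (nhds (0::complex))"
      using assms(2) by (intro eventually_nhds_in_open) auto
    then show "\<forall>\<^sub>F u in nhds 0. (\<lambda>l. fps_nth (Abs_fps (\<lambda>l. ?c l / fact l)) l * u ^ l) sums (laplace g \<circ> (+) s0) u"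
    proof eventually_elim
      case (elim u)
      then show ?case using laplace_sums[OF assms, of "s0 + u"] by (simp add: dist_norm)
    qed
  qed
  from fps_nth_fps_expansion[OF this, of l] show ?thesis
    by (simp add: higher_deriv_shift_0[of l "laplace g" s0])
qed

text \<open>On the positive real axis this is the Gamma integral; both sides are holomorphic in the
  half-plane, so the identity theorem extends it. The case \<open>u = 0\<close> covers constant
  functions.\<close>

lemma laplace_power_exp:
  assumes "0 \<le> u" "0 < Re s"
  shows "laplace (\<lambda>x. x ^ k * exp (- u * x)) s = fact k / (s + of_real u) ^ Suc k"
proof -
  let ?g = "\<lambda>x::real. x ^ k * exp (- u * x)"
  have ok: "laplace_integrable ?g"
    unfolding laplace_integrable_def
  proof (intro conjI allI impI)
    fix \<sigma> :: real assume "0 < \<sigma>"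
    then show "set_integrable lborel {0..} (\<lambda>x. exp (- \<sigma> * x) * ?g x)"
      using set_integrable_power_exp[of "\<sigma> + u" k] assms(1) by (simp add: algebra_simps flip: exp_add)
  qed simp
  have real_case: "laplace ?g (of_real \<sigma>) = fact k / (of_real \<sigma> + of_real u) ^ Suc k" if "0 < \<sigma>" for \<sigma> :: real
  proof -
    have "laplace ?g (of_real \<sigma>) = (LINT x|lborel. of_real (indicator {0..} x * (x ^ k * exp (- (\<sigma> + u) * x))))"
      unfolding laplace_def set_lebesgue_integral_def
      by (intro Bochner_Integration.integral_cong)
        (auto simp: indicator_def algebra_simps simp flip: exp_add exp_of_real)
    also have "\<dots> = of_real (fact k / (\<sigma> + u) ^ Suc k)"
      using has_bochner_integral_power_exp[of "\<sigma> + u" k] assms(1) that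
      by (subst integral_of_real) (auto simp: has_bochner_integral_iff)
    finally show ?thesis by simp
  qed
  show ?thesis
  proof -
    have "laplace ?g s - fact k / (s + of_real u) ^ Suc k = 0"
    proof (rule analytic_continuation[of "\<lambda>s. laplace ?g s - fact k / (s + of_real u) ^ Suc k" "{s. 0 < Re s}" "of_real ` {0<..}" 1])
      show "(\<lambda>s. laplace ?g s - fact k / (s + of_real u) ^ Suc k) holomorphic_on {s. 0 < Re s}"
      proof -
        have "s + of_real u \<noteq> 0" if "0 < Re s" for s using that assms(1) by (auto simp: complex_eq_iff)
        then show ?thesis by (intro holomorphic_intros laplace_holomorphic ok) (auto simp del: power_Suc)
      qed
      show "(1::complex) islimpt (of_real ` {0<..})"
        unfolding islimpt_approachable
      proof (intro allI impI)
        fix e :: real assume "0 < e"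
        have "dist (of_real (1 + e / 2)) (1::complex) = \<bar>e / 2\<bar>"
          unfolding dist_norm by (metis add_diff_cancel_left' norm_of_real of_real_1 of_real_diff real_norm_def)
        then show "\<exists>x'\<in>of_real ` {0<..}. x' \<noteq> (1::complex) \<and> dist x' 1 < e"
          using \<open>0 < e\<close> by (intro bexI[of _ "of_real (1 + e / 2)"] imageI) auto
      qed
      show "connected {s. 0 < Re s}" by (intro convex_connected convex_halfspace_Re_gt)
    qed (use assms real_case in \<open>auto simp: open_halfspace_Re_gt\<close>)
    then show ?thesis by simp
  qed
qed

lemma norm_laplace_le:
  assumes "set_integrable lborel {0..} g" "0 \<le> Re s"
  shows "norm (laplace g s) \<le> (LINT x:{0..}|lborel. \<bar>g x\<bar>)"
proof -
  have "norm (laplace g s) \<le> (LINT x|lborel. norm (indicator {0..} x *\<^sub>R (exp (- s * of_real x) * of_real (g x))))"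
    unfolding laplace_def set_lebesgue_integral_def by (rule integral_norm_bound)
  also have "\<dots> \<le> (LINT x:{0..}|lborel. \<bar>g x\<bar>)"
    unfolding set_lebesgue_integral_def
  proof (rule integral_mono')
    show "integrable lborel (\<lambda>x. indicat_real {0..} x *\<^sub>R \<bar>g x\<bar>)"
      using set_integrable_abs[OF assms(1)] by (simp add: set_integrable_def)
  qed (use assms(2) in \<open>auto simp: indicator_def norm_mult intro!: mult_left_le_one_le\<close>)
  finally show ?thesis .
qed

section \<open>The Erlang kernel with a complex rate\<close>

text \<open>The product rule telescopes over the partial sum and only the last term survives. This
  supplies an antiderivative of the Erlang kernel for complex \<open>c\<close>.\<close>

lemma has_field_derivative_exp_partial_sum:
  fixes c z :: complex
  shows "((\<lambda>z. (\<Sum>l\<le>k. (c * z) ^ l / fact l) * exp (- c * z)) has_field_derivative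
      - c * (c * z) ^ k / fact k * exp (- c * z)) (at z)"
proof (induction k)
  case 0
  show ?case by (auto intro!: derivative_eq_intros)
next
  case (Suc k)
  have "((\<lambda>z. (c * z) ^ Suc k / fact (Suc k) * exp (- c * z)) has_field_derivative
      (of_nat (Suc k) * (c * z) ^ k * c / fact (Suc k) - c * (c * z) ^ Suc k / fact (Suc k)) * exp (- c * z)) (at z)"
    by (rule derivative_eq_intros refl | simp add: algebra_simps del: fact_Suc of_nat_Suc)+
  moreover have "of_nat (Suc k) * (c * z) ^ k * c / fact (Suc k) = c * (c * z) ^ k / (fact k :: complex)"
    by (simp add: field_simps del: of_nat_Suc)
  ultimately have "((\<lambda>z. (c * z) ^ Suc k / fact (Suc k) * exp (- c * z)) has_field_derivative
      (c * (c * z) ^ k / fact k - c * (c * z) ^ Suc k / fact (Suc k)) * exp (- c * z)) (at z)"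
    by (simp only:)
  from DERIV_add[OF Suc.IH this] show ?case
    by (simp add: algebra_simps del: fact_Suc power_Suc)
qed

lemma integral_erlang_kernel:
  fixes c :: complex and z :: real
  assumes "c \<noteq> 0" "0 \<le> z"
  shows "(LINT t:{0..z}|lborel. of_real t ^ k / fact k * exp (- c * of_real t)) =
    (1 - (\<Sum>l\<le>k. (c * of_real z) ^ l / fact l) * exp (- c * of_real z)) / c ^ Suc k"
proof -
  let ?P = "\<lambda>z. (\<Sum>l\<le>k. (c * z) ^ l / fact l) * exp (- c * z)"
  have ftc: "(LBINT t. indicat_real {0..z} t *\<^sub>R (of_real t ^ k / fact k * exp (- c * of_real t))) =
      (- ?P (of_real z) / c ^ Suc k) - (- ?P (of_real 0) / c ^ Suc k)"
  proof (rule integral_FTC_atLeastAtMost[OF assms(2)])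
    show "((\<lambda>x. - ?P (of_real x) / c ^ Suc k) has_vector_derivative of_real x ^ k / fact k * exp (- c * of_real x))
        (at x within {0..z})" for x
    proof (rule has_vector_derivative_real_field)
      have "((\<lambda>x. - ?P x / c ^ Suc k) has_field_derivative
          - (- c * (c * of_real x) ^ k / fact k * exp (- c * of_real x)) / c ^ Suc k) (at (of_real x))"
        by (intro DERIV_cdivide DERIV_minus has_field_derivative_exp_partial_sum)
      then show "((\<lambda>x. - ?P x / c ^ Suc k) has_field_derivative of_real x ^ k / fact k * exp (- c * of_real x)) (at (of_real x))"
        using assms(1) by (simp add: power_mult_distrib field_simps)
    qed
    show "continuous_on {0..z} (\<lambda>x. of_real x ^ k / fact k * exp (- c * of_real x))"
      by (intro continuous_intros) auto
  qed
  have P0: "?P 0 = 1"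
  proof -
    have "(\<Sum>l\<le>k. (c * 0) ^ l / fact l) = (\<Sum>l\<le>k. if l = 0 then 1 else (0::complex))"
      by (intro sum.cong) auto
    then show ?thesis by simp
  qed
  show ?thesis
    unfolding set_lebesgue_integral_def ftc of_real_0 P0 by (simp add: diff_divide_distrib)
qed

lemma set_integrable_power_exp_bounded:
  assumes [measurable]: "g \<in> borel_measurable borel" and K: "\<And>x. \<bar>g x\<bar> \<le> K" and "0 < Re s"
  shows "set_integrable lborel {0..} (\<lambda>x. exp (- s * of_real x) * (- of_real x) ^ l * of_real (g x))"
proof -
  have "integrable lborel (\<lambda>x. K * (indicator {0..} x * (x ^ l * exp (- Re s * x))))"
    using set_integrable_power_exp[OF assms(3), of l] by (simp add: set_integrable_def)
  then show ?thesis
    unfolding set_integrable_def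
  proof (rule Bochner_Integration.integrable_bound)
    have "norm (indicator {0..} x *\<^sub>R (exp (- s * of_real x) * (- of_real x) ^ l * of_real (g x)))
        \<le> norm (K * (indicator {0..} x * (x ^ l * exp (- Re s * x))))" for x
      using mult_right_mono[OF order.trans[OF K[of x] abs_ge_self[of K]], of "x ^ l * exp (- Re s * x)"]
      by (auto simp: indicator_def norm_mult norm_power abs_mult mult_ac)
    then show "AE x in lborel. norm (indicator {0..} x *\<^sub>R (exp (- s * of_real x) * (- of_real x) ^ l * of_real (g x)))
        \<le> norm (K * (indicator {0..} x * (x ^ l * exp (- Re s * x))))"
      by auto
  qed auto
qed

text \<open>This is where the derivatives at \<open>v\<close> come from. With z = y + t as new
  variable and the order of integration exchanged, the Erlang kernel is integrated over t in [0, z]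
  only. The resulting incomplete Gamma function is 1 minus a truncated exponential series times
  exp(-c z); against exp(-w z) its terms become z^l exp(-v z), whose integrals with \<open>g\<close>
  are derivatives of the transform at \<open>v\<close>.\<close>

lemma laplace_erlang_shift:
  fixes g :: "real \<Rightarrow> real" and w c :: complex and v :: real
  assumes [measurable]: "g \<in> borel_measurable borel" and K: "\<And>x. \<bar>g x\<bar> \<le> K"
    and w: "0 < Re w" and v: "0 < v" and c: "c = of_real v - w" "c \<noteq> 0"
  shows "(LINT t:{0..}|lborel. of_real (t ^ k / fact k * exp (- v * t)) *
      (LINT y:{0..}|lborel. exp (- w * of_real y) * of_real (g (y + t)))) =
    (laplace g w - (\<Sum>l\<le>k. (- c) ^ l / fact l * (deriv ^^ l) (laplace g) (of_real v))) / c ^ Suc k"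
proof -
  define e where "e t = t ^ k / fact k * exp (- v * t)" for t :: real
  define F where "F t z = (indicator {0..} t * indicator {t..} z) *\<^sub>R (of_real (e t) * exp (- w * of_real (z - t)) * of_real (g z))"
    for t z :: real
  have Fm [measurable]: "(\<lambda>(t, z). F t z) \<in> borel_measurable (lborel \<Otimes>\<^sub>M lborel)"
  proof -
    have "(\<lambda>(t, z). F t z) = (\<lambda>p. (indicator {0..} (fst p) * indicator {q. fst q \<le> snd q} p) *\<^sub>R
       (of_real (e (fst p)) * exp (- w * of_real (snd p - fst p)) * of_real (g (snd p))))"
      by (auto simp: F_def indicator_def)
    then show ?thesis unfolding e_def by simp
  qed
  have ie: "integrable lborel (\<lambda>t. indicator {0..} t * e t)"
    using set_integrable_power_exp[OF v, of k] by (simp add: set_integrable_def e_def)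
  have Kpos: "0 \<le> K" using K[of 0] by linarith
  have iw: "integrable lborel (\<lambda>y. indicator {0..} y * exp (- Re w * y))"
    using set_integrable_power_exp[OF w, of 0] by (simp add: set_integrable_def)
  have iwt: "integrable lborel (\<lambda>z. indicator {0..} (z - t) * exp (- Re w * (z - t)))" for t
    using lborel_integrable_real_affine[OF iw, of 1 "- t"] by (simp add: algebra_simps)
  have iwt_eq: "(LBINT z. indicator {0..} (z - t) * exp (- Re w * (z - t))) = 1 / Re w" for t
    using lborel_integral_real_affine[of 1 "\<lambda>y. indicator {0..} y * exp (- Re w * y)" "- t"]
      has_bochner_integral_power_exp[OF w, of 0]
    by (simp add: algebra_simps has_bochner_integral_iff)
  have Fb: "norm (F t z) \<le> indicator {0..} t * e t * K * (indicator {0..} (z - t) * exp (- Re w * (z - t)))" for t z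
  proof -
    have "\<bar>g z\<bar> * (e t * exp (- Re w * (z - t))) \<le> K * (e t * exp (- Re w * (z - t)))" if "0 \<le> t"
      using that by (intro mult_right_mono K) (auto simp: e_def)
    moreover have "norm (of_real (e t) * exp (- w * of_real (z - t)) * of_real (g z)) = \<bar>g z\<bar> * (e t * exp (- Re w * (z - t)))"
      if "0 \<le> t"
    proof -
      have "0 \<le> e t" using that by (simp add: e_def)
      then show ?thesis by (simp add: norm_mult norm_exp_eq_Re)
    qed
    ultimately show ?thesis
      by (auto simp: F_def indicator_def mult_ac)
  qed
  have [measurable]: "F t \<in> borel_measurable lborel" for t
    using measurable_Pair2[OF Fm, of t] by simp
  have iFt: "integrable lborel (F t)" for t
  proof (rule Bochner_Integration.integrable_bound)
    show "integrable lborel (\<lambda>z. indicator {0..} t * e t * K * (indicator {0..} (z - t) * exp (- Re w * (z - t))))"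
      using iwt by (rule integrable_mult_right)
    show "AE z in lborel. norm (F t z) \<le> norm (indicator {0..} t * e t * K * (indicator {0..} (z - t) * exp (- Re w * (z - t))))"
      unfolding real_norm_def by (rule AE_I2) (rule order.trans[OF Fb abs_ge_self])
  qed measurable
  have iF: "integrable (lborel \<Otimes>\<^sub>M lborel) (\<lambda>(t, z). F t z)"
  proof (rule lborel_pair.Fubini_integrable)
    show "integrable lborel (\<lambda>t. LBINT z. norm (case (t, z) of (t, z) \<Rightarrow> F t z))"
    proof (rule Bochner_Integration.integrable_bound)
      show "integrable lborel (\<lambda>t. (K / Re w) * (indicator {0..} t * e t))" using ie by simp
      have "(LBINT z. norm (F t z)) \<le> (LBINT z. indicator {0..} t * e t * K * (indicator {0..} (z - t) * exp (- Re w * (z - t))))" for t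
        by (rule integral_mono) (use iFt Fb iwt in auto)
      then have le: "(LBINT z. norm (F t z)) \<le> (K / Re w) * (indicator {0..} t * e t)" for t
        unfolding integral_mult_right_zero iwt_eq by (simp add: mult_ac)
      have "norm (LBINT z. norm (F t z)) \<le> norm ((K / Re w) * (indicator {0..} t * e t))" for t
      proof -
        have "norm (LBINT z. norm (F t z)) = (LBINT z. norm (F t z))" by simp
        then show ?thesis
          using le[of t] unfolding real_norm_def by linarith
      qed
      then show "AE t in lborel. norm (LBINT z. norm (case (t, z) of (t, z) \<Rightarrow> F t z)) \<le> norm ((K / Re w) * (indicator {0..} t * e t))"
        by simp
    qed measurable
  qed (use iFt in auto)
  have "(LINT t:{0..}|lborel. of_real (e t) * (LINT y:{0..}|lborel. exp (- w * of_real y) * of_real (g (y + t))))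
      = (LBINT t. LBINT z. F t z)"
    unfolding set_lebesgue_integral_def
  proof (rule Bochner_Integration.integral_cong[OF refl])
    fix t
    have "(LBINT y. indicator {0..} y *\<^sub>R (exp (- w * of_real y) * of_real (g (y + t)))) =
        (LBINT z. indicator {0..} (z - t) *\<^sub>R (exp (- w * of_real (z - t)) * of_real (g z)))"
      using lborel_integral_real_affine[of 1 "\<lambda>y. indicator {0..} y *\<^sub>R (exp (- w * of_real y) * of_real (g (y + t)))" "- t"]
      by simp
    then show "indicator {0..} t *\<^sub>R (of_real (e t) * (LBINT y. indicator {0..} y *\<^sub>R (exp (- w * of_real y) * of_real (g (y + t)))))
        = (LBINT z. F t z)"
      unfolding F_def by (simp add: indicator_def mult.assoc flip: integral_mult_right_zero integral_scaleR_right)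
  qed
  also have "\<dots> = (LBINT z. LBINT t. F t z)"
    using lborel_pair.Fubini_integral[OF iF] by simp
  also have "\<dots> = (LBINT z. indicator {0..} z *\<^sub>R ((exp (- w * of_real z) * of_real (g z)
      - (\<Sum>l\<le>k. (- c) ^ l / fact l * (exp (- of_real v * of_real z) * (- of_real z) ^ l * of_real (g z)))) / c ^ Suc k))"
  proof (rule Bochner_Integration.integral_cong[OF refl])
    fix z :: real
    show "(LBINT t. F t z) = indicator {0..} z *\<^sub>R ((exp (- w * of_real z) * of_real (g z)
      - (\<Sum>l\<le>k. (- c) ^ l / fact l * (exp (- of_real v * of_real z) * (- of_real z) ^ l * of_real (g z)))) / c ^ Suc k)"
    proof (cases "0 \<le> z")
      case True
      have Feq: "F t z = (exp (- w * of_real z) * of_real (g z)) *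
         (indicator {0..z} t *\<^sub>R (of_real t ^ k / fact k * exp (- c * of_real t)))" for t
      proof -
        have "exp (- of_real v * of_real t) * exp (- w * of_real (z - t)) = exp (- w * of_real z) * exp (- c * of_real t)"
          by (simp add: c algebra_simps flip: exp_add)
        then show ?thesis using True
          by (auto simp: F_def e_def indicator_def simp flip: exp_of_real)
      qed
      have "(LBINT t. F t z) = (exp (- w * of_real z) * of_real (g z)) *
          ((1 - (\<Sum>l\<le>k. (c * of_real z) ^ l / fact l) * exp (- c * of_real z)) / c ^ Suc k)"
        unfolding Feq integral_mult_right_zero integral_erlang_kernel[OF c(2) True, of k, unfolded set_lebesgue_integral_def] ..
      also have "\<dots> = (exp (- w * of_real z) * of_real (g z) -
          (\<Sum>l\<le>k. (c * of_real z) ^ l / fact l) * (exp (- w * of_real z) * exp (- c * of_real z) * of_real (g z))) / c ^ Suc k"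
        by (simp add: algebra_simps diff_divide_distrib)
      also have "exp (- w * of_real z) * exp (- c * of_real z) = exp (- of_real v * of_real z)"
        by (simp add: c algebra_simps flip: exp_add)
      also have "(\<Sum>l\<le>k. (c * of_real z) ^ l / fact l) * (exp (- of_real v * of_real z) * of_real (g z))
          = (\<Sum>l\<le>k. (- c) ^ l / fact l * (exp (- of_real v * of_real z) * (- of_real z) ^ l * of_real (g z)))"
        unfolding sum_distrib_right
      proof (rule sum.cong[OF refl])
        fix l
        have "(c * of_real z) ^ l = (- c) ^ l * (- of_real z) ^ l" by (simp flip: power_mult_distrib)
        then show "(c * of_real z) ^ l / fact l * (exp (- of_real v * of_real z) * of_real (g z))
          = (- c) ^ l / fact l * (exp (- of_real v * of_real z) * (- of_real z) ^ l * of_real (g z))" by simp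
      qed
      finally show ?thesis using True by simp
    next
      case False
      then have "F t z = 0" for t by (auto simp: F_def indicator_def)
      with False show ?thesis by simp
    qed
  qed
  also have "\<dots> = (laplace g w - (\<Sum>l\<le>k. (- c) ^ l / fact l * (deriv ^^ l) (laplace g) (of_real v))) / c ^ Suc k"
  proof -
    have i0: "integrable lborel (\<lambda>z. indicator {0..} z *\<^sub>R (exp (- w * of_real z) * of_real (g z)))"
      using set_integrable_power_exp_bounded[OF assms(1) K w, where l = 0] by (simp add: set_integrable_def)
    have il: "integrable lborel (\<lambda>z. indicator {0..} z *\<^sub>R (exp (- of_real v * of_real z) * (- of_real z) ^ l * of_real (g z)) :: complex)" for l
      using set_integrable_power_exp_bounded[OF assms(1) K, where s = "of_real v" and l = l] v by (simp add: set_integrable_def)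
    define G where [abs_def]: "G z = indicator {0..} z *\<^sub>R (exp (- w * of_real z) * of_real (g z))" for z
    define L where [abs_def]: "L l z = indicator {0..} z *\<^sub>R (exp (- of_real v * of_real z) * (- of_real z) ^ l * of_real (g z) :: complex)" for l and z :: real
    have iG: "integrable lborel G" and iL: "integrable lborel (L l)" for l
      using i0 il[of l] unfolding G_def L_def by simp_all
    have "(\<lambda>z. indicator {0..} z *\<^sub>R ((exp (- w * of_real z) * of_real (g z)
      - (\<Sum>l\<le>k. (- c) ^ l / fact l * (exp (- of_real v * of_real z) * (- of_real z) ^ l * of_real (g z)))) / c ^ Suc k)) =
      (\<lambda>z. (G z - (\<Sum>l\<le>k. (- c) ^ l / fact l * L l z)) / c ^ Suc k)"
      by (auto simp: indicator_def G_def L_def)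
    then have "(LBINT z. indicator {0..} z *\<^sub>R ((exp (- w * of_real z) * of_real (g z)
      - (\<Sum>l\<le>k. (- c) ^ l / fact l * (exp (- of_real v * of_real z) * (- of_real z) ^ l * of_real (g z)))) / c ^ Suc k)) =
      (integral\<^sup>L lborel G - (\<Sum>l\<le>k. (- c) ^ l / fact l * integral\<^sup>L lborel (L l))) / c ^ Suc k"
      using iG iL by (simp add: Bochner_Integration.integral_diff Bochner_Integration.integral_sum del: power_Suc)
    moreover have "laplace_integrable g" using K by (intro laplace_integrable_bounded) auto
    then have "integral\<^sup>L lborel (L l) = (deriv ^^ l) (laplace g) (of_real v)" for l
      using v by (subst laplace_higher_deriv) (simp_all add: set_lebesgue_integral_def L_def)
    moreover have "integral\<^sup>L lborel G = laplace g w"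
      by (simp add: laplace_def set_lebesgue_integral_def G_def)
    ultimately show ?thesis by (simp only:)
  qed
  finally show ?thesis by (simp add: e_def)
qed

section \<open>Paths of the surplus process\<close>

text \<open>Dropping the gains leaves pure growth by the factor 1 + a. Hence ruin forces the
  discounted waiting times to exceed the initial level, which is the only way in which the path
  enters the tail estimate.\<close>

lemma post_gain_level_lower_bound:
  assumes "0 < a" "\<And>i. 0 \<le> c i"
  shows "(1 + a) ^ k * (x - (\<Sum>j<k. b j / (1 + a) ^ j)) \<le> post_gain_level a x b c k"
proof (induction k)
  case (Suc k)
  have "(1 + a) ^ Suc k * (x - (\<Sum>j<Suc k. b j / (1 + a) ^ j)) =
      (1 + a) * ((1 + a) ^ k * (x - (\<Sum>j<k. b j / (1 + a) ^ j)) - b k)"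
    using assms(1) by (simp add: field_simps)
  also have "\<dots> \<le> (1 + a) * (post_gain_level a x b c k - b k) + c k"
    using Suc assms(1) assms(2)[of k] by (intro add_increasing2 mult_left_mono) auto
  finally show ?case by simp
qed simp

lemma post_gain_level_shift:
  "post_gain_level a x (case_nat b0 b) (case_nat c0 c) (Suc k) =
    post_gain_level a ((1 + a) * (x - b0) + c0) b c k"
  by (induction k) auto

text \<open>After k gains the path can vanish only at one time, level plus gain time. The
  uncountable search over t becomes a countable one over k for every path, so the ruin event is
  measurable.\<close>

lemma ruin_time_finite_iff:
  "ruin_time a x b c < \<infinity> \<longleftrightarrow>
    (\<exists>k. 0 \<le> post_gain_level a x b c k + gain_time b k \<and>
      card {i. 1 \<le> i \<and> gain_time b i \<le> post_gain_level a x b c k + gain_time b k} = k)"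
proof -
  have "ruin_time a x b c < \<infinity> \<longleftrightarrow> (\<exists>t\<ge>0. surplus a x b c t = 0)"
    unfolding ruin_time_def Inf_less_iff by auto
  also have "\<dots> \<longleftrightarrow> (\<exists>k. 0 \<le> post_gain_level a x b c k + gain_time b k \<and>
      card {i. 1 \<le> i \<and> gain_time b i \<le> post_gain_level a x b c k + gain_time b k} = k)"
  proof safe
    fix t :: real assume t: "0 \<le> t" "surplus a x b c t = 0"
    define k where "k = card {i. 1 \<le> i \<and> gain_time b i \<le> t}"
    have eq: "post_gain_level a x b c k + gain_time b k = t"
      using t(2) by (simp add: surplus_def k_def Let_def)
    have "0 \<le> post_gain_level a x b c k + gain_time b k \<and>
      card {i. 1 \<le> i \<and> gain_time b i \<le> post_gain_level a x b c k + gain_time b k} = k"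
      unfolding eq using t(1) k_def by blast
    then show "\<exists>k. 0 \<le> post_gain_level a x b c k + gain_time b k \<and>
      card {i. 1 \<le> i \<and> gain_time b i \<le> post_gain_level a x b c k + gain_time b k} = k" ..
  next
    fix k assume k: "0 \<le> post_gain_level a x b c k + gain_time b k"
      "card {i. 1 \<le> i \<and> gain_time b i \<le> post_gain_level a x b c k + gain_time b k} = k"
    then show "\<exists>t\<ge>0. surplus a x b c t = 0"
      by (intro exI[of _ "post_gain_level a x b c k + gain_time b k"]) (simp add: surplus_def Let_def)
  qed
  finally show ?thesis .
qed

text \<open>Between gains the path falls at unit rate, so it reaches 0 as soon as a waiting time
  exceeds the level at its start. The inequality is strict because the surplus at a gain time
  already includes the gain. Unbounded gain times make the number of gains up to any time
  finite.\<close>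

lemma ruin_time_finite_iff_level:
  assumes b: "\<And>i. 0 < b i" and c: "\<And>i. 0 \<le> c i" and "0 < a" "0 \<le> x"
    and unb: "\<And>t. \<exists>k. t < gain_time b k"
  shows "ruin_time a x b c < \<infinity> \<longleftrightarrow> (\<exists>k. post_gain_level a x b c k < b k)"
proof -
  have T_Suc: "gain_time b (Suc k) = gain_time b k + b k" for k by (simp add: gain_time_def)
  have T_mono: "strict_mono (gain_time b)" using b by (intro strict_monoI_Suc) (simp add: T_Suc)
  have card: "{i. 1 \<le> i \<and> gain_time b i \<le> t} = {1..m}"
    if "gain_time b m \<le> t" "t < gain_time b (Suc m)" for t m
  proof -
    have "gain_time b i \<le> t \<longleftrightarrow> i \<le> m" for i
    proof
      assume "gain_time b i \<le> t"
      with that(2) have "gain_time b i < gain_time b (Suc m)" by linarith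
      then show "i \<le> m" using strict_mono_less[OF T_mono] by simp
    next
      assume "i \<le> m"
      then have "gain_time b i \<le> gain_time b m" by (simp add: strict_mono_less_eq[OF T_mono])
      then show "gain_time b i \<le> t" using that(1) by (rule order.trans)
    qed
    then have "{i. 1 \<le> i \<and> gain_time b i \<le> t} = {i. 1 \<le> i \<and> i \<le> m}" by simp
    then show ?thesis by (simp add: atLeastAtMost_def atLeast_def atMost_def Collect_conj_eq)
  qed
  show ?thesis
    unfolding ruin_time_finite_iff
  proof safe
    fix k assume k: "0 \<le> post_gain_level a x b c k + gain_time b k"
      "card {i. 1 \<le> i \<and> gain_time b i \<le> post_gain_level a x b c k + gain_time b k} = k"
    define t where "t = post_gain_level a x b c k + gain_time b k"
    define m where "m = (LEAST m. t < gain_time b (Suc m))"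
    have T0: "gain_time b 0 = 0" by (simp add: gain_time_def)
    obtain k' where "t < gain_time b k'" using unb by blast
    also have "gain_time b k' < gain_time b (Suc k')" using T_mono by (simp add: strict_mono_less)
    finally have m1: "t < gain_time b (Suc m)" unfolding m_def by (rule LeastI)
    have m2: "gain_time b m \<le> t"
    proof (cases m)
      case 0
      then show ?thesis using k(1) T0 by (simp add: t_def)
    next
      case (Suc m')
      then have "\<not> t < gain_time b (Suc m')"
        using not_less_Least[of m' "\<lambda>m. t < gain_time b (Suc m)"] unfolding m_def by simp
      then show ?thesis using Suc by simp
    qed
    have "k = m" using k(2) card[OF m2 m1] by (simp add: t_def)
    then show "\<exists>k. post_gain_level a x b c k < b k"
      using m1 by (intro exI[of _ k]) (simp add: t_def T_Suc)
  next
    fix k0 assume k0: "post_gain_level a x b c k0 < b k0"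
    \<comment> \<open>The path is not stopped, so later levels may be negative. At the first index
      with an excessive waiting time the level is still nonnegative, hence the candidate ruin time
      is too.\<close>
    define k where "k = (LEAST k. post_gain_level a x b c k < b k)"
    have k: "post_gain_level a x b c k < b k" unfolding k_def using k0 by (rule LeastI)
    have lev: "0 \<le> post_gain_level a x b c k"
    proof (cases k)
      case (Suc k')
      then have "\<not> post_gain_level a x b c k' < b k'"
        using not_less_Least[of k' "\<lambda>k. post_gain_level a x b c k < b k"] unfolding k_def by simp
      then show ?thesis using Suc assms(3) c[of k'] by simp
    qed (use assms in simp)
    have "0 \<le> gain_time b k" by (simp add: gain_time_def sum_nonneg less_imp_le[OF b])
    then show "\<exists>k. 0 \<le> post_gain_level a x b c k + gain_time b k \<and>
      card {i. 1 \<le> i \<and> gain_time b i \<le> post_gain_level a x b c k + gain_time b k} = k"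
      using lev k card[of k "post_gain_level a x b c k + gain_time b k"]
      by (intro exI[of _ k] conjI) (simp_all add: T_Suc add.commute)
  qed
qed

text \<open>The substitution v = F(x) in the integral of 1 - 2 v, done without differentiating F:
  F(u)^2 is the mass of a square under N x N, and the diagonal splits it into two triangles that
  each contribute the integral of F up to u.\<close>

lemma integral_cdf_atMost:
  fixes f :: "real \<Rightarrow> real"
  assumes "prob_space N" and N: "N = density lborel (\<lambda>x. ennreal (f x))" and [measurable]: "f \<in> borel_measurable borel"
  shows "(LINT x|N. indicator {..u} x * (1 - 2 * cdf N x)) = cdf N u - (cdf N u)\<^sup>2"
proof -
  interpret prob_space N by fact
  interpret P: pair_prob_space N N by unfold_locales
  have sN [measurable_cong, simp]: "sets N = sets borel" by (simp add: N)
  have mN: "borel_measurable N = (borel_measurable borel :: (real \<Rightarrow> real) set)"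
    by (rule measurable_cong_sets) simp_all
  have mN2: "borel_measurable (N \<Otimes>\<^sub>M N) = (borel_measurable (borel \<Otimes>\<^sub>M borel) :: (real \<times> real \<Rightarrow> real) set)"
    by (intro measurable_cong_sets sets_pair_measure_cong) simp_all
  have [simp]: "space N = UNIV" by (simp add: N)
  have bd: "integrable N g" if "g \<in> borel_measurable borel" "\<And>x. \<bar>g x\<bar> \<le> K" for g :: "real \<Rightarrow> real" and K
    by (rule integrable_const_bound[of _ K]) (use that mN in auto)
  have bd2: "integrable (N \<Otimes>\<^sub>M N) g" if "g \<in> borel_measurable (borel \<Otimes>\<^sub>M borel)" "\<And>x. \<bar>g x\<bar> \<le> K" for g :: "real \<times> real \<Rightarrow> real" and K
    by (rule P.integrable_const_bound[of _ K])
      (use that mN2 in auto)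
  have [measurable]: "cdf N \<in> borel_measurable borel"
    by (intro borel_measurable_mono monoI) (auto simp: cdf_def intro!: finite_measure_mono)
  have cdf_bd: "\<bar>cdf N x\<bar> \<le> 1" for x by (simp add: cdf_def)
  let ?g = "\<lambda>(x, y). indicator {..u} x * indicator {..x} y :: real"
  have [measurable]: "?g \<in> borel_measurable (borel \<Otimes>\<^sub>M borel)"
  proof -
    have "?g = (\<lambda>p. indicator {..u} (fst p) * indicator {p. snd p \<le> fst p} p)"
      by (auto simp: indicator_def)
    then show ?thesis by simp
  qed
  have ig: "integrable (N \<Otimes>\<^sub>M N) ?g" by (rule bd2[of _ 1]) (auto simp: indicator_def)
  have half: "(LINT x|N. LINT y|N. indicator {..u} x * indicator {..x} y) = (LINT x|N. indicator {..u} x * cdf N x)"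
    by (simp add: cdf_def)
  have half': "(LINT x|N. LINT y|N. indicator {..u} y * indicator {..y} x) = (LINT x|N. indicator {..u} x * cdf N x)"
    unfolding P.Fubini_integral[OF ig] by (rule half)
  have "(cdf N u)\<^sup>2 = (LINT x|N. LINT y|N. indicator {..u} x * indicator {..u} y)"
    by (simp add: cdf_def power2_eq_square)
  also have "\<dots> = (LINT x|N. (LINT y|N. indicator {..u} x * indicator {..x} y) + (LINT y|N. indicator {..u} y * indicator {..y} x))"
  proof (rule Bochner_Integration.integral_cong[OF refl])
    fix x
    \<comment> \<open>The diagonal is counted in both triangles; it is null because N has a
      density.\<close>
    have "AE y in N. y \<noteq> x"
      unfolding N by (subst AE_density) (auto intro: AE_mp[OF AE_lborel_singleton])
    then have "(LINT y|N. indicator {..u} x * indicator {..u} y) =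
        (LINT y|N. (indicator {..u} x * indicator {..x} y + indicator {..u} y * indicator {..y} x) :: real)"
      by (intro integral_cong_AE) (auto simp: indicator_def)
    also have "\<dots> = (LINT y|N. indicator {..u} x * indicator {..x} y) + (LINT y|N. indicator {..u} y * indicator {..y} x)"
      by (intro Bochner_Integration.integral_add bd[of _ 1]) (auto simp: indicator_def)
    finally show "(LINT y|N. indicator {..u} x * indicator {..u} y) = (LINT y|N. indicator {..u} x * indicator {..x} y) + (LINT y|N. indicator {..u} y * indicator {..y} x :: real)" .
  qed
  also have "\<dots> = (LINT x|N. LINT y|N. indicator {..u} x * indicator {..x} y) + (LINT x|N. LINT y|N. indicator {..u} y * indicator {..y} x)"
    using P.integrable_fst'[OF ig] P.integrable_snd[OF ig]
    by (intro Bochner_Integration.integral_add) (auto simp: split_beta')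
  finally have sq: "(cdf N u)\<^sup>2 = 2 * (LINT x|N. indicator {..u} x * cdf N x)" by (simp only: half half')
  have "(LINT x|N. indicator {..u} x * (1 - 2 * cdf N x)) = (LINT x|N. indicator {..u} x - 2 * (indicator {..u} x * cdf N x))"
    by (simp add: algebra_simps)
  also have "\<dots> = cdf N u - 2 * (LINT x|N. indicator {..u} x * cdf N x)"
  proof -
    have "integrable N (\<lambda>x. indicator {..u} x * cdf N x)"
      using cdf_bd by (intro bd[of _ 1]) (auto simp: indicator_def)
    then have "integrable N (\<lambda>x. 2 * (indicator {..u} x * cdf N x))" by simp
    moreover have "integrable N (indicat_real {..u})" by (rule bd[of _ 1]) (auto simp: indicator_def)
    moreover have "integral\<^sup>L N (indicat_real {..u}) = cdf N u" by (simp add: cdf_def)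
    ultimately show ?thesis by (simp add: Bochner_Integration.integral_diff)
  qed
  finally show ?thesis using sq by simp
qed

section \<open>The ruin probability as a renewal function\<close>

context dual_risk_model
begin

abbreviation "lawB \<equiv> distr M borel (B 0)"
abbreviation "lawC \<equiv> distr M borel (C 0)"
abbreviation "f\<^sub>C \<equiv> erlang_density (n - 1) \<mu>"
abbreviation "h \<equiv> (\<lambda>x. f\<^sub>B x * (1 - 2 * cdf lawB x))"

lemma measurable_B [measurable]: "B i \<in> borel_measurable M"
  and measurable_C [measurable]: "C i \<in> borel_measurable M"
  and measurable_f [measurable]: "f\<^sub>B \<in> borel_measurable borel"
proof -
  show "B i \<in> borel_measurable M" "C i \<in> borel_measurable M"
    using interarrival[of i] gain[of i] by (simp_all add: distributed_def measurable_lborel1)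
  show "f\<^sub>B \<in> borel_measurable borel"
    using distributed_real_measurable[OF density_nonneg interarrival[of 0]] by simp
qed

lemma distr_B: "distr M borel (B i) = density lborel (\<lambda>t. ennreal (f\<^sub>B t))"
  using distributed_distr_eq_density[OF interarrival[of i]] by (simp add: distr_cong[of M M borel lborel])

lemma distr_C: "distr M borel (C i) = density lborel (\<lambda>t. ennreal (f\<^sub>C t))"
  using distributed_distr_eq_density[OF gain[of i]] by (simp add: distr_cong[of M M borel lborel])

lemma AE_distr_pos:
  fixes f :: "real \<Rightarrow> real"
  assumes "distr M borel X = density lborel (\<lambda>t. ennreal (f t))" "X \<in> borel_measurable M"
    "f \<in> borel_measurable borel" "\<And>t. t < 0 \<Longrightarrow> f t = 0"
  shows "AE \<omega> in M. 0 < X \<omega>"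
proof -
  have "AE t in density lborel (\<lambda>t. ennreal (f t)). 0 < t"
  proof (subst AE_density)
    show "AE t in lborel. 0 < ennreal (f t) \<longrightarrow> 0 < t"
      using AE_lborel_singleton[of 0]
    proof eventually_elim
      case (elim t)
      then show ?case using assms(4)[of t] by (cases t "0::real" rule: linorder_cases) auto
    qed
  qed (use assms(3) in simp)
  then show ?thesis
    unfolding assms(1)[symmetric] using assms(2) by (subst (asm) AE_distr_iff) auto
qed

lemma AE_B_pos: "AE \<omega> in M. 0 < B i \<omega>"
  by (rule AE_distr_pos[OF distr_B]) (auto dest: density_support)

lemma AE_C_pos: "AE \<omega> in M. 0 < C i \<omega>"
  by (rule AE_distr_pos[OF distr_C]) (auto simp: erlang_density_def)

definition phi_real :: "real \<Rightarrow> real" where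
  "phi_real r = (LINT \<omega>|M. exp (- r * B 0 \<omega>))"

lemma integrable_exp_B: "0 \<le> r \<Longrightarrow> integrable M (\<lambda>\<omega>. exp (- r * B i \<omega>))"
  using AE_B_pos[of i] by (intro integrable_const_bound[of _ 1]) (auto elim!: eventually_mono)

lemma integral_exp_B: "(LINT \<omega>|M. exp (- r * B i \<omega>)) = phi_real r"
proof -
  have "(LINT \<omega>|M. exp (- r * B i \<omega>)) = (LINT x|distr M borel (B i). exp (- r * x))" for i
    by (subst integral_distr) auto
  then show ?thesis unfolding phi_real_def by (simp add: distr_B)
qed

lemma phi_real_pos: "0 \<le> r \<Longrightarrow> 0 < phi_real r"
proof -
  assume "0 \<le> r"
  have "integral\<^sup>L M (\<lambda>_. 0) < phi_real r"
    unfolding phi_real_def using integrable_exp_B[OF \<open>0 \<le> r\<close>]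
    by (intro integral_less_AE_space) (auto simp: emeasure_space_1)
  then show ?thesis by simp
qed

lemma phi_real_mono: "0 \<le> r \<Longrightarrow> r \<le> r' \<Longrightarrow> phi_real r' \<le> phi_real r"
  unfolding phi_real_def using AE_B_pos[of 0]
  by (intro integral_mono_AE integrable_exp_B) (auto elim!: eventually_mono simp: mult_right_mono)

lemma phi_real_le_1: "0 \<le> r \<Longrightarrow> phi_real r \<le> 1"
  using phi_real_mono[of 0 r] by (simp add: phi_real_def prob_space)

lemma phi_real_1_less: "phi_real 1 < 1"
proof -
  have "phi_real 1 < integral\<^sup>L M (\<lambda>_. 1)"
    unfolding phi_real_def using AE_B_pos[of 0] integrable_exp_B[of 1 0]
    by (intro integral_less_AE_space) (auto simp: emeasure_space_1)
  then show ?thesis by (simp add: prob_space)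
qed

lemma integral_exp_sum_B:
  assumes "\<And>j. 0 \<le> r j"
  shows "integrable M (\<lambda>\<omega>. exp (- (\<Sum>j<K. r j * B j \<omega>)))"
    and "(LINT \<omega>|M. exp (- (\<Sum>j<K. r j * B j \<omega>))) = (\<Prod>j<K. phi_real (r j))"
proof -
  have eq: "exp (- (\<Sum>j<K. r j * B j \<omega>)) = (\<Prod>j<K. exp (- r j * B j \<omega>))" for \<omega>
    by (simp add: exp_sum[symmetric] sum_negf)
  have ind: "indep_vars (\<lambda>_. borel) (\<lambda>j \<omega>. exp (- r j * B j \<omega>)) {..<K}"
  proof -
    have "indep_vars (\<lambda>_. borel) (\<lambda>j \<omega>. (\<lambda>p. exp (- r j * fst p)) (B j \<omega>, C j \<omega>)) UNIV"
      by (rule indep_vars_compose2[OF independent]) simp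
    then have "indep_vars (\<lambda>_. borel) (\<lambda>j \<omega>. exp (- r j * B j \<omega>)) UNIV" by simp
    then show ?thesis by (rule indep_vars_subset) simp
  qed
  have int: "\<And>j. j \<in> {..<K} \<Longrightarrow> integrable M (\<lambda>\<omega>. exp (- r j * B j \<omega>))"
    using assms by (intro integrable_exp_B)
  show "integrable M (\<lambda>\<omega>. exp (- (\<Sum>j<K. r j * B j \<omega>)))"
    unfolding eq by (rule indep_vars_integrable[OF _ ind int]) auto
  show "(LINT \<omega>|M. exp (- (\<Sum>j<K. r j * B j \<omega>))) = (\<Prod>j<K. phi_real (r j))"
    using indep_vars_lebesgue_integral[OF finite_lessThan ind int] unfolding eq integral_exp_B .
qed

text \<open>Chernoff bound with exponent 1: the k-th gain time is at most m with probability at most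
  exp(m) times \<open>phi_real 1\<close> to the power k, and \<open>phi_real 1\<close> is below 1
  because B is positive.\<close>

lemma AE_gain_time_unbounded: "AE \<omega> in M. \<forall>t. \<exists>k. t < gain_time (\<lambda>i. B i \<omega>) k"
proof -
  have "AE \<omega> in M. \<exists>k. real m < gain_time (\<lambda>i. B i \<omega>) k" for m :: nat
  proof -
    let ?E = "{\<omega> \<in> space M. \<forall>k. gain_time (\<lambda>i. B i \<omega>) k \<le> real m}"
    have [measurable]: "(\<lambda>\<omega>. gain_time (\<lambda>i. B i \<omega>) k) \<in> borel_measurable M" for k
      unfolding gain_time_def by measurable
    have "prob ?E \<le> exp (real m) * phi_real 1 ^ k" for k
    proof -
      have "prob ?E = (LINT \<omega>|M. indicator ?E \<omega>)" by simp
      also have "\<dots> \<le> (LINT \<omega>|M. exp (real m) * exp (- (\<Sum>j<k. 1 * B j \<omega>)))"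
      proof (rule integral_mono)
        show "indicator ?E \<omega> \<le> exp (real m) * exp (- (\<Sum>j<k. 1 * B j \<omega>))" for \<omega>
          by (auto simp: indicator_def gain_time_def simp flip: exp_add)
        show "integrable M (\<lambda>\<omega>. exp (real m) * exp (- (\<Sum>j<k. 1 * B j \<omega>)))"
          using integral_exp_sum_B(1)[of "\<lambda>_. 1" k] by simp
        show "integrable M (indicat_real ?E)"
          by (intro integrable_real_indicator) (auto simp: emeasure_eq_measure)
      qed
      also have "\<dots> = exp (real m) * phi_real 1 ^ k"
        using integral_exp_sum_B(2)[of "\<lambda>_. 1" k] by simp
      finally show ?thesis .
    qed
    moreover have "(\<lambda>k. exp (real m) * phi_real 1 ^ k) \<longlonglongrightarrow> exp (real m) * 0"
      using phi_real_1_less phi_real_pos[of 1] by (intro tendsto_intros LIMSEQ_power_zero) auto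
    ultimately have "prob ?E \<le> exp (real m) * 0"
      by (intro LIMSEQ_le_const[of "\<lambda>k. exp (real m) * phi_real 1 ^ k"]) blast+
    then have "prob ?E \<le> 0" by simp
    then have "prob ?E = 0" by (simp add: measure_le_0_iff)
    then have "AE \<omega> in M. \<omega> \<notin> ?E" by (intro AE_not_in) (auto simp: null_sets_def emeasure_eq_measure)
    then show ?thesis using AE_space by eventually_elim (auto simp: not_le)
  qed
  then have "AE \<omega> in M. \<forall>m. \<exists>k. real m < gain_time (\<lambda>i. B i \<omega>) k"
    by (simp add: AE_all_countable)
  then show ?thesis
  proof eventually_elim
    case (elim \<omega>)
    show ?case
    proof
      fix t :: real
      obtain m :: nat where "t < real m" using reals_Archimedean2 by blast
      with elim show "\<exists>k. t < gain_time (\<lambda>i. B i \<omega>) k" by (meson less_trans)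
    qed
  qed
qed

section \<open>The canonical path space and the FGM law\<close>

definition ruin_level :: "real \<Rightarrow> (nat \<Rightarrow> real \<times> real) \<Rightarrow> bool" where
  "ruin_level x w \<longleftrightarrow> (\<exists>k. post_gain_level a x (\<lambda>i. fst (w i)) (\<lambda>i. snd (w i)) k < fst (w k))"

definition law :: "(real \<times> real) measure" where
  "law = distr M (borel \<Otimes>\<^sub>M borel) (\<lambda>\<omega>. (B 0 \<omega>, C 0 \<omega>))"

abbreviation "path_law \<equiv> PiM (UNIV :: nat set) (\<lambda>_. law)"

text \<open>The ruin probability on the product space of all paths, where conditioning on the first
  pair amounts to splitting off one coordinate. It is defined for all real \<open>x\<close>, so that
  the renewal equation needs no case distinction on the sign of its arguments.\<close>

definition ruin_prob' :: "real \<Rightarrow> real" where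
  "ruin_prob' x = measure path_law {w \<in> space path_law. ruin_level x w}"

lemma sets_law [measurable_cong, simp]: "sets law = sets (borel \<Otimes>\<^sub>M borel)"
  by (simp add: law_def)

lemma space_law [simp]: "space law = UNIV"
  by (simp add: law_def space_pair_measure)

lemma space_path_law [simp]: "space path_law = UNIV"
  by (simp add: space_PiM)

lemma measurable_post_gain_level [measurable]:
  assumes [measurable]: "f \<in> borel_measurable N" "\<And>i. (\<lambda>z. b z i) \<in> borel_measurable N" "\<And>i. (\<lambda>z. c z i) \<in> borel_measurable N"
  shows "(\<lambda>z. post_gain_level a (f z) (b z) (c z) k) \<in> borel_measurable N"
  by (induction k) auto

lemma prob_space_law: "prob_space law"
  unfolding law_def by (rule prob_space_distr) simp

sublocale law: prob_space law
  by (rule prob_space_law)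

sublocale path: sequence_space law
  by unfold_locales

lemma measurable_ruin_level [measurable]:
  "Measurable.pred (borel \<Otimes>\<^sub>M path_law) (\<lambda>z. ruin_level (fst z) (snd z))"
  unfolding ruin_level_def by measurable

lemma cdf_abs_le_1: "\<bar>cdf lawB x\<bar> \<le> 1" "\<bar>cdf lawC x\<bar> \<le> 1"
  by (simp_all add: cdf_def prob_space.prob_le_1 prob_space_distr)

lemma measurable_cdf [measurable]: "cdf lawB \<in> borel_measurable borel" "cdf lawC \<in> borel_measurable borel"
  by (intro borel_measurable_mono monoI,
      auto simp: cdf_def intro!: finite_measure.finite_measure_mono prob_space.finite_measure prob_space_distr)+

definition fgm_density :: "real \<times> real \<Rightarrow> real" where
  "fgm_density p = 1 + \<theta> * (1 - 2 * cdf lawB (fst p)) * (1 - 2 * cdf lawC (snd p))"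

lemma measurable_fgm_density [measurable]: "fgm_density \<in> borel_measurable (borel \<Otimes>\<^sub>M borel)"
  unfolding fgm_density_def by measurable

lemma fgm_density_bounds: "0 \<le> fgm_density p" "fgm_density p \<le> 2"
proof -
  have "\<bar>1 - 2 * cdf lawB x\<bar> \<le> 1" "\<bar>1 - 2 * cdf lawC x\<bar> \<le> 1" for x
    using cdf_abs_le_1[of x] by (auto simp: cdf_def abs_le_iff)
  then have "\<bar>\<theta> * (1 - 2 * cdf lawB (fst p)) * (1 - 2 * cdf lawC (snd p))\<bar> \<le> 1 * 1 * 1"
    unfolding abs_mult using dependence by (intro mult_mono) auto
  then show "0 \<le> fgm_density p" "fgm_density p \<le> 2"
    unfolding fgm_density_def by linarith+
qed

lemma integral_law_product:
  fixes u v :: "real \<Rightarrow> 'b::{real_normed_algebra, banach, second_countable_topology}"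
  assumes [measurable]: "u \<in> borel_measurable borel" "v \<in> borel_measurable borel"
    and bd: "\<And>x. norm (u x) \<le> Ku" "\<And>x. norm (v x) \<le> Kv"
  shows "(LINT p|(lawB \<Otimes>\<^sub>M lawC). u (fst p) * v (snd p)) = (LINT x|lawB. u x) * (LINT y|lawC. v y)"
proof -
  interpret LB: prob_space lawB by (rule prob_space_distr) simp
  interpret LC: prob_space lawC by (rule prob_space_distr) simp
  interpret P: pair_prob_space lawB lawC by unfold_locales
  have [measurable_cong, simp]: "sets (lawB \<Otimes>\<^sub>M lawC) = sets (borel \<Otimes>\<^sub>M borel)"
    by (intro sets_pair_measure_cong) auto
  have "norm (u (fst p) * v (snd p)) \<le> Ku * Kv" for p
    using order.trans[OF norm_ge_zero bd(1)]
    by (intro order.trans[OF norm_mult_ineq] mult_mono bd) auto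
  then have "integrable (lawB \<Otimes>\<^sub>M lawC) (\<lambda>p. u (fst p) * v (snd p))"
    by (intro P.integrable_const_bound[of _ "Ku * Kv"]) auto
  then have "(LINT x|lawB. LINT y|lawC. u x * v y) = (LINT p|(lawB \<Otimes>\<^sub>M lawC). u (fst p) * v (snd p))"
    by (subst P.integral_fst'[symmetric]) auto
  moreover have "integrable lawB u" "integrable lawC v"
    using bd by (auto intro!: LB.integrable_const_bound[of _ Ku] LC.integrable_const_bound[of _ Kv])
  ultimately show ?thesis by simp
qed

text \<open>Both measures agree on the quadrants, an intersection-stable generator: by
  \<open>integral_cdf_atMost\<close> in each variable the density integrates to u v + theta (u -
  u^2) (v - v^2), the FGM copula at the marginal values. The right-hand side does not mention
  \<open>i\<close>, so the pairs are identically distributed.\<close>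

lemma joint_law:
  "distr M (borel \<Otimes>\<^sub>M borel) (\<lambda>\<omega>. (B i \<omega>, C i \<omega>)) = density (lawB \<Otimes>\<^sub>M lawC) (\<lambda>p. ennreal (fgm_density p))"
    (is "?L = ?R")
proof -
  interpret LB: prob_space lawB by (rule prob_space_distr) simp
  interpret LC: prob_space lawC by (rule prob_space_distr) simp
  interpret P: pair_prob_space lawB lawC by unfold_locales
  have sP [measurable_cong, simp]: "sets (lawB \<Otimes>\<^sub>M lawC) = sets (borel \<Otimes>\<^sub>M borel)"
    by (intro sets_pair_measure_cong) auto
  have lawBi: "distr M borel (B i) = lawB" and lawCi: "distr M borel (C i) = lawC" by (simp_all only: distr_B distr_C)
  have Int: "{..p} \<inter> {..q} = {..(min (fst p) (fst q), min (snd p) (snd q))}" for p q :: "real \<times> real"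
    by (auto simp: less_eq_prod_def)
  have iC: "(LINT x|N. indicator {..u} x * (1 - 2 * cdf N x)) = cdf N u - (cdf N u)\<^sup>2"
    if "N = lawB \<or> N = lawC" for N u
    using that
  proof
    assume "N = lawB"
    then show ?thesis using LB.prob_space_axioms distr_B[of 0] by (intro integral_cdf_atMost[where f = "f\<^sub>B"]) auto
  next
    assume "N = lawC"
    then show ?thesis using LC.prob_space_axioms distr_C[of 0] by (intro integral_cdf_atMost[where f = "f\<^sub>C"]) auto
  qed
  have eq: "emeasure ?L {..p} = emeasure ?R {..p}" for p :: "real \<times> real"
  proof -
    obtain u v where p: "p = (u, v)" by (cases p)
    have pa: "{..p} = {..u} \<times> {..v}" by (auto simp: p)
    have [measurable]: "{..p} \<in> sets (borel \<Otimes>\<^sub>M borel)" unfolding pa by simp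
    have "emeasure ?L {..p} = emeasure M {\<omega> \<in> space M. B i \<omega> \<le> u \<and> C i \<omega> \<le> v}"
      unfolding pa by (subst emeasure_distr) (auto intro!: arg_cong[where f = "emeasure M"])
    also have "\<dots> = ennreal (fgm_copula \<theta> (cdf lawB u) (cdf lawC v))"
      by (simp add: emeasure_eq_measure joint_cdf lawBi lawCi)
    finally have L: "emeasure ?L {..p} = ennreal (fgm_copula \<theta> (cdf lawB u) (cdf lawC v))" .
    let ?IB = "\<lambda>x. indicator {..u} x * (1 - 2 * cdf lawB x)"
    let ?IC = "\<lambda>x. indicator {..v} x * (1 - 2 * cdf lawC x)"
    have bB: "norm (?IB x) \<le> 3" and bC: "norm (?IC x) \<le> 3" for x
      using cdf_abs_le_1[of x] by (auto simp: indicator_def)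
    have m: "?IB \<in> borel_measurable borel" "?IC \<in> borel_measurable borel" by measurable
    have "emeasure ?R {..p} = (\<integral>\<^sup>+q. ennreal (fgm_density q * indicator {..p} q) \<partial>(lawB \<Otimes>\<^sub>M lawC))"
      by (subst emeasure_density) (auto intro!: nn_integral_cong simp: indicator_def)
    also have "\<dots> = ennreal (LINT q|(lawB \<Otimes>\<^sub>M lawC). fgm_density q * indicator {..p} q)"
      using fgm_density_bounds
      by (intro nn_integral_eq_integral P.integrable_const_bound[of _ 2]) (auto simp: indicator_def)
    also have "(\<lambda>q. fgm_density q * indicator {..p} q) = (\<lambda>q. indicator {..u} (fst q) * indicator {..v} (snd q)
        + \<theta> * (?IB (fst q) * ?IC (snd q)))"
      by (auto simp: fun_eq_iff fgm_density_def pa indicator_def)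
    also have "(LINT q|(lawB \<Otimes>\<^sub>M lawC). indicator {..u} (fst q) * indicator {..v} (snd q) + \<theta> * (?IB (fst q) * ?IC (snd q))) =
       (LINT q|(lawB \<Otimes>\<^sub>M lawC). indicator {..u} (fst q) * indicator {..v} (snd q)) + \<theta> * (LINT q|(lawB \<Otimes>\<^sub>M lawC). ?IB (fst q) * ?IC (snd q))"
    proof -
      have "norm (?IB (fst q) * ?IC (snd q)) \<le> 3 * 3" for q
        unfolding norm_mult by (intro mult_mono bB[unfolded norm_mult] bC[unfolded norm_mult]) auto
      then have "integrable (lawB \<Otimes>\<^sub>M lawC) (\<lambda>q. ?IB (fst q) * ?IC (snd q))"
        by (intro P.integrable_const_bound[of _ "3 * 3"]) auto
      moreover have "integrable (lawB \<Otimes>\<^sub>M lawC) (\<lambda>q. indicator {..u} (fst q) * indicator {..v} (snd q) :: real)"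
        by (intro P.integrable_const_bound[of _ 1]) (auto simp: indicator_def)
      ultimately show ?thesis by simp
    qed
    also have "(LINT q|(lawB \<Otimes>\<^sub>M lawC). indicat_real {..u} (fst q) * indicator {..v} (snd q)) = cdf lawB u * cdf lawC v"
      by (subst integral_law_product[where Ku = 1 and Kv = 1]) (auto simp: indicator_def cdf_def)
    also have "(LINT q|(lawB \<Otimes>\<^sub>M lawC). ?IB (fst q) * ?IC (snd q)) = (cdf lawB u - (cdf lawB u)\<^sup>2) * (cdf lawC v - (cdf lawC v)\<^sup>2)"
      by (subst integral_law_product[OF m bB bC]) (simp add: iC)
    finally show ?thesis
      unfolding L fgm_copula_def by (simp add: power2_eq_square algebra_simps)
  qed
  have sborel: "sets (borel \<Otimes>\<^sub>M borel) = sigma_sets UNIV (range (\<lambda>p :: real \<times> real. {..p}))"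
    unfolding borel_prod by (subst borel_eq_atMost) simp
  show ?thesis
  proof (rule measure_eqI_generator_eq)
    show "Int_stable (range (\<lambda>p :: real \<times> real. {..p}))"
      by (auto simp: Int_stable_def Int)
    show "range (\<lambda>k::nat. {..(real k, real k)}) \<subseteq> range (\<lambda>p. {..p})" by auto
    show "(\<Union>k::nat. {..(real k, real k)}) = UNIV"
    proof safe
      fix x y :: real
      obtain k :: nat where "max x y \<le> real k" using real_arch_simple by blast
      then show "(x, y) \<in> (\<Union>k::nat. {..(real k, real k)})" by (intro UN_I[of k]) auto
    qed auto
    show "emeasure ?L {..(real k, real k)} \<noteq> \<infinity>" for k :: nat
      using finite_measure.emeasure_finite[OF prob_space.finite_measure[OF prob_space_distr[of "\<lambda>\<omega>. (B i \<omega>, C i \<omega>)" "borel \<Otimes>\<^sub>M borel"]]]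
      by simp
  qed (use eq sborel in auto)
qed

lemma distr_path: "distr M path_law (\<lambda>\<omega> i. (B i \<omega>, C i \<omega>)) = path_law"
proof -
  have "distr M (borel \<Otimes>\<^sub>M borel) (\<lambda>\<omega>. (B i \<omega>, C i \<omega>)) = law" for i
    unfolding law_def joint_law ..
  moreover have "distr M (PiM UNIV (\<lambda>_::nat. borel \<Otimes>\<^sub>M borel)) (\<lambda>\<omega>. \<lambda>i\<in>UNIV. (B i \<omega>, C i \<omega>)) =
      PiM UNIV (\<lambda>i. distr M (borel \<Otimes>\<^sub>M borel) (\<lambda>\<omega>. (B i \<omega>, C i \<omega>)))"
    using independent by (subst (asm) indep_vars_iff_distr_eq_PiM) auto
  moreover have "distr M path_law (\<lambda>\<omega> i. (B i \<omega>, C i \<omega>)) =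
     distr M (PiM UNIV (\<lambda>_::nat. borel \<Otimes>\<^sub>M borel)) (\<lambda>\<omega>. \<lambda>i\<in>UNIV. (B i \<omega>, C i \<omega>))"
    by (intro distr_cong sets_PiM_cong) auto
  ultimately show ?thesis by simp
qed

lemma pred_ruin_level [measurable]: "Measurable.pred path_law (ruin_level x)"
  unfolding ruin_level_def by measurable

lemma sets_ruin_level: "{w. ruin_level x w} \<in> sets path_law"
  using pred_ruin_level[of x] by (simp add: pred_def)

lemma measurable_path [measurable]: "(\<lambda>\<omega> i. (B i \<omega>, C i \<omega>)) \<in> measurable M path_law"
  by (rule measurable_PiM_single') auto

lemma ruin_prob'_eq_prob:
  "ruin_prob' x = prob {\<omega> \<in> space M. ruin_level x (\<lambda>i. (B i \<omega>, C i \<omega>))}"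
proof -
  have "ruin_prob' x = measure (distr M path_law (\<lambda>\<omega> i. (B i \<omega>, C i \<omega>))) {w \<in> space path_law. ruin_level x w}"
    unfolding ruin_prob'_def distr_path ..
  then show ?thesis
    by (subst (asm) measure_distr) (auto intro!: arg_cong[where f = prob] sets_ruin_level)
qed

lemma ruin_prob_eq:
  assumes "0 \<le> x"
  shows "ruin_prob M B C a x = ruin_prob' x"
  unfolding ruin_prob_def ruin_prob'_eq_prob
proof (rule measure_eq_AE)
  have ae: "AE \<omega> in M. (\<forall>i. 0 < B i \<omega>) \<and> (\<forall>i. 0 < C i \<omega>)"
    using AE_B_pos AE_C_pos by (simp add: AE_all_countable)
  show "AE \<omega> in M. \<omega> \<in> {\<omega> \<in> space M. ruin_time a x (\<lambda>i. B i \<omega>) (\<lambda>i. C i \<omega>) < \<infinity>} \<longleftrightarrow>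
      \<omega> \<in> {\<omega> \<in> space M. ruin_level x (\<lambda>i. (B i \<omega>, C i \<omega>))}"
    using ae AE_gain_time_unbounded
  proof eventually_elim
    case (elim \<omega>)
    then show ?case
      using ruin_time_finite_iff_level[of "\<lambda>i. B i \<omega>" "\<lambda>i. C i \<omega>" a x] assms proportion_pos
      by (simp add: ruin_level_def less_imp_le)
  qed
  have [measurable]: "(\<lambda>\<omega>. gain_time (\<lambda>i. B i \<omega>) k) \<in> borel_measurable M" for k
    unfolding gain_time_def by measurable
  \<comment> \<open>The countable form of ruin is used here, since the level criterion holds only
    almost surely.\<close>
  show "{\<omega> \<in> space M. ruin_time a x (\<lambda>i. B i \<omega>) (\<lambda>i. C i \<omega>) < \<infinity>} \<in> sets M"
    unfolding ruin_time_finite_iff by measurable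
qed measurable

lemma ruin_level_shift:
  "ruin_level x (case_nat p w) \<longleftrightarrow> x < fst p \<or> ruin_level ((1 + a) * (x - fst p) + snd p) w"
proof -
  have f: "fst (case_nat p w i) = case_nat (fst p) (\<lambda>i. fst (w i)) i"
    "snd (case_nat p w i) = case_nat (snd p) (\<lambda>i. snd (w i)) i" for i
    by (auto split: nat.split)
  have "ruin_level x (case_nat p w) \<longleftrightarrow>
     x < fst p \<or> (\<exists>k. post_gain_level a x (case_nat (fst p) (\<lambda>i. fst (w i))) (case_nat (snd p) (\<lambda>i. snd (w i))) (Suc k) < fst (w k))"
  proof -
    have "(\<exists>k. P k) \<longleftrightarrow> P 0 \<or> (\<exists>k. P (Suc k))" for P :: "nat \<Rightarrow> bool"
      by (metis not0_implies_Suc)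
    from this[of "\<lambda>k. post_gain_level a x (case_nat (fst p) (\<lambda>i. fst (w i))) (case_nat (snd p) (\<lambda>i. snd (w i))) k
        < case_nat (fst p) (\<lambda>i. fst (w i)) k"]
    show ?thesis unfolding ruin_level_def f by (simp del: post_gain_level.simps(2))
  qed
  then show ?thesis unfolding post_gain_level_shift by (simp add: ruin_level_def)
qed

lemma measurable_ruin_prob' [measurable]: "ruin_prob' \<in> borel_measurable borel"
proof -
  have "{z \<in> space (borel \<Otimes>\<^sub>M path_law). ruin_level (fst z) (snd z)} \<in> sets (borel \<Otimes>\<^sub>M path_law)"
    by measurable
  then have "(\<lambda>x. emeasure path_law (Pair x -` {z \<in> space (borel \<Otimes>\<^sub>M path_law). ruin_level (fst z) (snd z)})) \<in> borel_measurable borel"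
    by (rule path.P.measurable_emeasure_Pair)
  then have "(\<lambda>x. enn2real (emeasure path_law (Pair x -` {z \<in> space (borel \<Otimes>\<^sub>M path_law). ruin_level (fst z) (snd z)}))) \<in> borel_measurable borel"
    by measurable
  moreover have "Pair x -` {z \<in> space (borel \<Otimes>\<^sub>M path_law). ruin_level (fst z) (snd z)} = {w \<in> space path_law. ruin_level x w}" for x
    by (auto simp: space_pair_measure)
  ultimately show ?thesis by (simp add: ruin_prob'_def[abs_def] measure_def)
qed

lemma ruin_prob'_bounds: "0 \<le> ruin_prob' x" "ruin_prob' x \<le> 1"
  by (simp_all add: ruin_prob'_def)

text \<open>First-step analysis: \<open>path.PiM_iter\<close> presents the path law as the image of
  the law of the first pair times the path law of the rest, and \<open>ruin_level_shift\<close> says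
  what remains of the ruin event once the first pair is known.\<close>

lemma ruin_prob'_renewal:
  "ruin_prob' x = (LINT p|law. (if x < fst p then 1 else ruin_prob' ((1 + a) * (x - fst p) + snd p)))"
proof -
  let ?E = "{w \<in> space path_law. ruin_level x w}"
  let ?g = "\<lambda>p. if x < fst p then 1 else ruin_prob' ((1 + a) * (x - fst p) + snd p)"
  have sE: "?E \<in> sets path_law" by measurable
  have mcn: "(\<lambda>(s, w). case_nat s w) \<in> measurable (law \<Otimes>\<^sub>M path_law) path_law" by measurable
  have gm: "?g \<in> borel_measurable law" by measurable
  have "ennreal (ruin_prob' x) = emeasure path_law ?E"
    by (simp add: ruin_prob'_def path.P.emeasure_eq_measure)
  also have "\<dots> = emeasure (distr (law \<Otimes>\<^sub>M path_law) path_law (\<lambda>(s, w). case_nat s w)) ?E"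
    by (simp only: path.PiM_iter)
  also have "\<dots> = emeasure (law \<Otimes>\<^sub>M path_law) ((\<lambda>(s, w). case_nat s w) -` ?E \<inter> space (law \<Otimes>\<^sub>M path_law))"
    by (rule emeasure_distr[OF mcn sE])
  also have "\<dots> = (\<integral>\<^sup>+p. emeasure path_law (Pair p -` ((\<lambda>(s, w). case_nat s w) -` ?E \<inter> space (law \<Otimes>\<^sub>M path_law))) \<partial>law)"
    by (rule path.P.emeasure_pair_measure_alt[OF measurable_sets[OF mcn sE]])
  also have "\<dots> = (\<integral>\<^sup>+p. ennreal (?g p) \<partial>law)"
  proof (rule nn_integral_cong)
    fix p
    have "Pair p -` ((\<lambda>(s, w). case_nat s w) -` ?E \<inter> space (law \<Otimes>\<^sub>M path_law)) =
       {w \<in> space path_law. x < fst p \<or> ruin_level ((1 + a) * (x - fst p) + snd p) w}"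
      by (auto simp: space_pair_measure ruin_level_shift)
    moreover have "emeasure path_law \<dots> = ennreal (?g p)"
      using path.P.emeasure_space_1
      by (cases "x < fst p") (simp_all add: ruin_prob'_def path.P.emeasure_eq_measure)
    ultimately show "emeasure path_law (Pair p -` ((\<lambda>(s, w). case_nat s w) -` ?E \<inter> space (law \<Otimes>\<^sub>M path_law))) = ennreal (?g p)"
      by (simp only:)
  qed
  also have "\<dots> = ennreal (LINT p|law. ?g p)"
    using ruin_prob'_bounds gm
    by (intro nn_integral_eq_integral law.integrable_const_bound[of _ 1]) auto
  finally show ?thesis
    using ruin_prob'_bounds by (subst (asm) ennreal_inj) (auto intro!: integral_nonneg)
qed

text \<open>Markov's inequality for 1 - exp(-r S), where S is the discounted sum of waiting times.
  Ruin forces some S K above \<open>x\<close>, so there this variable is at least 1 - exp(-r x); its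
  mean is 1 minus a product of values of \<open>phi_real\<close>, hence at most
  \<open>1 - q\<close>.\<close>

lemma ruin_prob'_tail:
  assumes "0 < x" "0 < r" and q: "\<And>K. q \<le> (\<Prod>j<K. phi_real (r / (1 + a) ^ j))"
  shows "ruin_prob' x * (1 - exp (- r * x)) \<le> 1 - q"
proof -
  define S where "S K \<omega> = (\<Sum>j<K. B j \<omega> / (1 + a) ^ j)" for K \<omega>
  have [measurable]: "S K \<in> borel_measurable M" for K unfolding S_def by measurable
  \<comment> \<open>Quantifying over \<open>k \<le> K\<close> makes the events increase on every
    path; \<open>S\<close> itself is monotone only almost surely.\<close>
  define E where "E K = {\<omega> \<in> space M. \<exists>k\<le>K. x < S k \<omega>}" for K
  have [measurable]: "E K \<in> sets M" for K unfolding E_def by measurable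
  have aeB: "AE \<omega> in M. \<forall>i. 0 < B i \<omega>" and aeC: "AE \<omega> in M. \<forall>i. 0 < C i \<omega>"
    using AE_B_pos AE_C_pos by (simp_all add: AE_all_countable)
  have E_bound: "prob (E K) * (1 - exp (- r * x)) \<le> 1 - q" for K
  proof -
    have int: "integrable M (\<lambda>\<omega>. exp (- r * S K \<omega>))"
      and eq: "(LINT \<omega>|M. exp (- r * S K \<omega>)) = (\<Prod>j<K. phi_real (r / (1 + a) ^ j))"
      using integral_exp_sum_B[of "\<lambda>j. r / (1 + a) ^ j" K] assms proportion_pos
      by (simp_all add: S_def sum_distrib_left sum_negf)
    have "prob (E K) * (1 - exp (- r * x)) = (LINT \<omega>|M. indicator (E K) \<omega> * (1 - exp (- r * x)))"
      by simp
    also have "\<dots> \<le> (LINT \<omega>|M. 1 - exp (- r * S K \<omega>))"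
    proof (rule integral_mono_AE)
      show "AE \<omega> in M. indicator (E K) \<omega> * (1 - exp (- r * x)) \<le> 1 - exp (- r * S K \<omega>)"
        using aeB
      proof eventually_elim
        case (elim \<omega>)
        have "S k \<omega> \<le> S K \<omega>" if "k \<le> K" for k
          unfolding S_def using that elim proportion_pos by (intro sum_mono2) (auto intro!: divide_nonneg_nonneg less_imp_le)
        moreover have "0 \<le> S K \<omega>"
          unfolding S_def using elim proportion_pos by (intro sum_nonneg) (auto intro!: divide_nonneg_nonneg less_imp_le)
        ultimately show ?case
          using assms by (force simp: indicator_def E_def)
      qed
      show "integrable M (\<lambda>\<omega>. indicator (E K) \<omega> * (1 - exp (- r * x)))"
        by (intro integrable_mult_left integrable_real_indicator) (auto simp: emeasure_eq_measure)
    qed (use int in auto)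
    also have "\<dots> = 1 - (\<Prod>j<K. phi_real (r / (1 + a) ^ j))"
      using int eq by (simp add: prob_space)
    finally show ?thesis using q[of K] by linarith
  qed
  have "(\<lambda>K. prob (E K)) \<longlonglongrightarrow> prob (\<Union>K. E K)"
    by (rule finite_Lim_measure_incseq) (auto simp: incseq_def E_def intro: order.trans)
  then have "(\<lambda>K. prob (E K) * (1 - exp (- r * x))) \<longlonglongrightarrow> prob (\<Union>K. E K) * (1 - exp (- r * x))"
    by (intro tendsto_intros)
  then have "prob (\<Union>K. E K) * (1 - exp (- r * x)) \<le> 1 - q"
    using E_bound by (intro LIMSEQ_le_const2) auto
  moreover have le: "ruin_prob' x \<le> prob (\<Union>K. E K)"
    unfolding ruin_prob'_eq_prob
  proof (rule finite_measure_mono_AE)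
    show "AE \<omega> in M. \<omega> \<in> {\<omega> \<in> space M. ruin_level x (\<lambda>i. (B i \<omega>, C i \<omega>))} \<longrightarrow> \<omega> \<in> (\<Union>K. E K)"
      using aeC
    proof eventually_elim
      case (elim \<omega>)
      show ?case
      proof
        assume "\<omega> \<in> {\<omega> \<in> space M. ruin_level x (\<lambda>i. (B i \<omega>, C i \<omega>))}"
        then obtain k where k: "\<omega> \<in> space M" "post_gain_level a x (\<lambda>i. B i \<omega>) (\<lambda>i. C i \<omega>) k < B k \<omega>"
          by (auto simp: ruin_level_def)
        have "(1 + a) ^ k * (x - S k \<omega>) \<le> post_gain_level a x (\<lambda>i. B i \<omega>) (\<lambda>i. C i \<omega>) k"
          unfolding S_def using elim proportion_pos by (intro post_gain_level_lower_bound) (auto intro: less_imp_le)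
        also note k(2)
        finally have "x - S k \<omega> < B k \<omega> / (1 + a) ^ k"
          using proportion_pos by (simp add: pos_less_divide_eq mult.commute)
        then have "x < S (Suc k) \<omega>" by (simp add: S_def)
        then show "\<omega> \<in> (\<Union>K. E K)" using k(1) by (auto simp: E_def)
      qed
    qed
  qed measurable
  moreover have "0 \<le> 1 - exp (- r * x)" using assms(1,2) by simp
  ultimately show ?thesis
    using mult_right_mono[OF le, of "1 - exp (- r * x)"] by linarith
qed

end

section \<open>The Laplace transform of the renewal operator\<close>

text \<open>Translates \<open>laplace_erlang_shift\<close> at w = s / alpha into the shape of
  \<open>J_fun\<close> and \<open>H_fun\<close>. With c = v - s / alpha both pole fractions are mu /
  c up to sign, and (mu / c)^(k+1) c^l = mu^l (mu / c)^(k+1-l) lowers the exponent by l.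
  \<open>F\<close> and \<open>Y\<close> stay arbitrary, since the identity is applied to candidate
  solutions as well.\<close>

lemma erlang_transform_poles:
  fixes \<mu> v s \<alpha> F :: complex and Y :: "nat \<Rightarrow> complex"
  assumes "\<alpha> \<noteq> 0" "s \<noteq> v * \<alpha>"
  shows "\<mu> ^ Suc k * ((F - (\<Sum>l\<le>k. (- (v - s / \<alpha>)) ^ l / fact l * Y l)) / (v - s / \<alpha>) ^ Suc k) =
    (\<mu> * \<alpha> / (v * \<alpha> - s)) ^ Suc k * F
    + (-1) ^ k * (\<Sum>l = 0..k. \<mu> ^ l * Y l / fact l * (\<mu> * \<alpha> / (s - v * \<alpha>)) ^ (Suc k - l))"
proof -
  define c where "c = v - s / \<alpha>"
  have c: "c \<noteq> 0" using assms by (simp add: c_def field_simps)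
  have X: "\<mu> * \<alpha> / (v * \<alpha> - s) = \<mu> / c" "\<mu> * \<alpha> / (s - v * \<alpha>) = - (\<mu> / c)"
    using assms c by (auto simp: c_def field_simps)
  have tm: "(\<mu> / c) ^ Suc k * ((- c) ^ l / fact l * Y l) = - ((-1) ^ k * (\<mu> ^ l * Y l / fact l * (- (\<mu> / c)) ^ (Suc k - l)))"
    if "l \<le> k" for l
  proof -
    have "(\<mu> / c) ^ Suc k * c ^ l = (\<mu> / c) ^ (Suc k - l) * ((\<mu> / c) ^ l * c ^ l)"
      using that by (simp add: mult.assoc[symmetric] power_add[symmetric] del: power_Suc)
    also have "(\<mu> / c) ^ l * c ^ l = \<mu> ^ l" using c by (simp add: power_divide)
    finally have 1: "(\<mu> / c) ^ Suc k * c ^ l = (\<mu> / c) ^ (Suc k - l) * \<mu> ^ l" .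
    have "(-1) ^ k * (- (\<mu> / c)) ^ (Suc k - l) = (-1) ^ (k + (Suc k - l)) * (\<mu> / c) ^ (Suc k - l)"
      by (subst power_minus) (simp add: power_add)
    also have "(-1 :: complex) ^ (k + (Suc k - l)) = - ((-1) ^ l)"
    proof -
      have "k + (Suc k - l) + l = Suc (2 * k)" using that by simp
      then have "(-1 :: complex) ^ (k + (Suc k - l)) * (-1) ^ l = -1" by (simp flip: power_add)
      then show ?thesis by (cases "even l") auto
    qed
    finally have 2: "(-1) ^ k * (- (\<mu> / c)) ^ (Suc k - l) = - ((-1) ^ l) * (\<mu> / c) ^ (Suc k - l)" .
    have "(\<mu> / c) ^ Suc k * ((- c) ^ l / fact l * Y l) = (-1) ^ l * ((\<mu> / c) ^ Suc k * c ^ l) * (Y l / fact l)"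
      by (subst power_minus) simp
    also have "\<dots> = - (((-1) ^ k * (- (\<mu> / c)) ^ (Suc k - l)) * \<mu> ^ l * (Y l / fact l))"
      unfolding 1 2 by simp
    finally show ?thesis by (simp add: mult_ac)
  qed
  have "\<mu> ^ Suc k * ((F - (\<Sum>l\<le>k. (- c) ^ l / fact l * Y l)) / c ^ Suc k) =
      (\<mu> / c) ^ Suc k * F - (\<Sum>l\<le>k. (\<mu> / c) ^ Suc k * ((- c) ^ l / fact l * Y l))"
    by (simp add: power_divide diff_divide_distrib right_diff_distrib sum_distrib_left sum_divide_distrib mult_ac del: power_Suc)
  also have "(\<Sum>l\<le>k. (\<mu> / c) ^ Suc k * ((- c) ^ l / fact l * Y l)) =
      (\<Sum>l\<le>k. - ((-1) ^ k * (\<mu> ^ l * Y l / fact l * (- (\<mu> / c)) ^ (Suc k - l))))"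
    by (intro sum.cong tm) auto
  finally show ?thesis
    unfolding X c_def[symmetric] by (simp add: sum_negf sum_distrib_left atMost_atLeast0)
qed

context dual_risk_model
begin

abbreviation "phi \<equiv> laplace_stieltjes M (B 0)"
abbreviation "hs \<equiv> laplace h"

definition renewal_op :: "(real \<Rightarrow> real) \<Rightarrow> real \<Rightarrow> real" where
  "renewal_op g x = (LINT p|law. (if x < fst p then 0 else g ((1 + a) * (x - fst p) + snd p)))"

text \<open>The part of \<open>H_fun\<close> that is linear in \<open>y\<close> and
  \<open>z\<close>, produced by \<open>renewal_op\<close>. The summand removed is the transform of
  P(B > x).\<close>

definition H_hom :: "(nat \<Rightarrow> complex) \<Rightarrow> (nat \<Rightarrow> complex) \<Rightarrow> complex \<Rightarrow> complex" where
  "H_hom y z s = H_fun n \<mu> a \<theta> phi hs y z s - (1 - phi s) / s"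

abbreviation "J \<equiv> J_fun n \<mu> a \<theta> phi hs"

text \<open>Cut off at 0 to be bounded by 1 on the whole line for Re s >= 0; since B is positive
  almost surely, expectations do not change.\<close>

definition exp_B :: "complex \<Rightarrow> real \<Rightarrow> complex" where
  "exp_B s x = indicator {0..} x *\<^sub>R exp (- s * of_real x)"

lemma measurable_exp_B [measurable]: "exp_B s \<in> borel_measurable borel"
  unfolding exp_B_def by measurable

lemma norm_exp_B_le: "0 \<le> Re s \<Longrightarrow> norm (exp_B s x) \<le> 1"
  by (auto simp: exp_B_def indicator_def)

lemma AE_law_pos: "AE p in law. 0 < fst p \<and> 0 < snd p"
  unfolding law_def using AE_B_pos[of 0] AE_C_pos[of 0]
  by (subst AE_distr_iff) (auto elim: eventually_elim2)

lemma integral_exp_B_law: "(LINT x|lawB. exp_B s x) = phi s"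
  unfolding laplace_stieltjes_def using AE_B_pos[of 0]
  by (subst integral_distr) (auto simp: exp_B_def intro!: integral_cong_AE elim!: eventually_mono)

lemma integral_exp_B_h: "(LINT x|lawB. of_real (1 - 2 * cdf lawB x) * exp_B s x) = hs s"
proof -
  have "(LINT x|lawB. of_real (1 - 2 * cdf lawB x) * exp_B s x) =
      (LINT x|density lborel (\<lambda>t. ennreal (f\<^sub>B t)). of_real (1 - 2 * cdf lawB x) * exp_B s x)"
    by (simp only: distr_B)
  also have "\<dots> = (LINT x|lborel. f\<^sub>B x *\<^sub>R (of_real (1 - 2 * cdf lawB x) * exp_B s x))"
    using density_nonneg by (subst integral_density) auto
  also have "\<dots> = hs s"
    unfolding laplace_def set_lebesgue_integral_def
    by (intro Bochner_Integration.integral_cong) (auto simp: exp_B_def indicator_def scaleR_conv_of_real)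
  finally show ?thesis .
qed

text \<open>In the density 1 + theta (1 - 2 F_B) (1 - 2 F_C) write 1 - 2 F_C = 2 (1 - F_C) - 1. The
  expectation splits into products: phi - theta hs meets the gain density, of rate mu, and 2 theta
  hs meets the density times its own tail, of rate 2 mu.\<close>

lemma integral_law:
  fixes v :: "real \<Rightarrow> complex"
  assumes s: "0 \<le> Re s" and [measurable]: "v \<in> borel_measurable borel" and v: "\<And>x. norm (v x) \<le> K"
  shows "(LINT p|law. exp_B s (fst p) * v (snd p)) =
    (phi s - of_real \<theta> * hs s) * (LINT x|lawC. v x)
    + 2 * of_real \<theta> * hs s * (LINT x|lawC. of_real (1 - cdf lawC x) * v x)"
proof -
  interpret LB: prob_space lawB by (rule prob_space_distr) simp
  interpret LC: prob_space lawC by (rule prob_space_distr) simp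
  interpret P: pair_prob_space lawB lawC by unfold_locales
  have [measurable_cong, simp]: "sets (lawB \<Otimes>\<^sub>M lawC) = sets (borel \<Otimes>\<^sub>M borel)"
    by (intro sets_pair_measure_cong) auto
  let ?u' = "\<lambda>x. of_real (1 - 2 * cdf lawB x) * exp_B s x"
  let ?v' = "\<lambda>x. of_real (1 - 2 * cdf lawC x) * v x"
  have u: "norm (exp_B s x) \<le> 1" for x using s by (rule norm_exp_B_le)
  have K: "0 \<le> K" using order.trans[OF norm_ge_zero v] .
  have one: "\<bar>1 - 2 * cdf lawB x\<bar> \<le> 1" "\<bar>1 - 2 * cdf lawC x\<bar> \<le> 1" "\<bar>1 - cdf lawC x\<bar> \<le> 1" for x
    using cdf_abs_le_1[of x] by (auto simp: cdf_def abs_le_iff)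
  have u': "norm (?u' x) \<le> 1 * 1" for x
    unfolding norm_mult norm_of_real by (intro mult_mono one u) auto
  have v': "norm (?v' x) \<le> 1 * K" "norm (of_real (1 - cdf lawC x) * v x) \<le> 1 * K" for x
    unfolding norm_mult norm_of_real by (intro mult_mono one v; simp)+
  have m: "?u' \<in> borel_measurable borel" "?v' \<in> borel_measurable borel" by measurable
  have "norm (exp_B s (fst p) * v (snd p)) \<le> 1 * K" "norm (?u' (fst p) * ?v' (snd p)) \<le> (1 * 1) * (1 * K)" for p
    unfolding norm_mult[of "exp_B _ _"] norm_mult[of "?u' _"] by (intro mult_mono u v u' v'; simp add: K)+
  then have int: "integrable (lawB \<Otimes>\<^sub>M lawC) (\<lambda>p. exp_B s (fst p) * v (snd p))"
     "integrable (lawB \<Otimes>\<^sub>M lawC) (\<lambda>p. ?u' (fst p) * ?v' (snd p))"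
    by (auto intro!: P.integrable_const_bound[of _ "1 * K"] P.integrable_const_bound[of _ "(1 * 1) * (1 * K)"])
  have "(LINT p|law. exp_B s (fst p) * v (snd p)) =
      (LINT p|(lawB \<Otimes>\<^sub>M lawC). fgm_density p *\<^sub>R (exp_B s (fst p) * v (snd p)))"
    unfolding law_def joint_law using fgm_density_bounds by (subst integral_density) auto
  also have "\<dots> = (LINT p|(lawB \<Otimes>\<^sub>M lawC). exp_B s (fst p) * v (snd p) + of_real \<theta> * (?u' (fst p) * ?v' (snd p)))"
    by (intro Bochner_Integration.integral_cong) (auto simp: fgm_density_def scaleR_conv_of_real algebra_simps)
  also have "\<dots> = (LINT p|(lawB \<Otimes>\<^sub>M lawC). exp_B s (fst p) * v (snd p))
      + of_real \<theta> * (LINT p|(lawB \<Otimes>\<^sub>M lawC). ?u' (fst p) * ?v' (snd p))"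
    using int by simp
  also have "(LINT p|(lawB \<Otimes>\<^sub>M lawC). exp_B s (fst p) * v (snd p)) = phi s * (LINT x|lawC. v x)"
    by (subst integral_law_product[OF _ _ u v]) (auto simp: integral_exp_B_law)
  also have "(LINT p|(lawB \<Otimes>\<^sub>M lawC). ?u' (fst p) * ?v' (snd p)) = hs s * (LINT x|lawC. ?v' x)"
    by (subst integral_law_product[OF m u' v'(1)]) (simp only: integral_exp_B_h)
  also have "(LINT x|lawC. ?v' x) = (LINT x|lawC. 2 * (of_real (1 - cdf lawC x) * v x) - v x)"
    by (intro Bochner_Integration.integral_cong) (auto simp: algebra_simps)
  also have "\<dots> = 2 * (LINT x|lawC. of_real (1 - cdf lawC x) * v x) - (LINT x|lawC. v x)"
  proof -
    have "integrable lawC (\<lambda>x. of_real (1 - cdf lawC x) * v x)" "integrable lawC v"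
      using v v' by (auto intro!: LC.integrable_const_bound[of _ K])
    then show ?thesis by simp
  qed
  finally show ?thesis by (simp add: algebra_simps)
qed

text \<open>After exchanging the integrals, x = B + y / (1 + a) turns exp(-s x) dx into exp(-s B)
  exp(-s y / (1 + a)) dy / (1 + a). This is the origin of the scaled argument and of the prefactor 1
  / (1 + a).\<close>

lemma laplace_renewal_op_integral:
  fixes g :: "real \<Rightarrow> real"
  assumes [measurable]: "g \<in> borel_measurable borel" and K: "\<And>x. \<bar>g x\<bar> \<le> K" and s: "0 < Re s"
  shows "laplace (renewal_op g) s =
    (LINT p|law. exp_B s (fst p) * ((LINT y:{0..}|lborel. exp (- (s / (1 + a)) * of_real y) * of_real (g (y + snd p))) / of_real (1 + a)))"
proof -
  interpret P: pair_sigma_finite law lborel ..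
  have K0: "0 \<le> K" using K[of 0] by linarith
  define F where "F p x = (indicator {0..} x * indicator {fst p..} x) *\<^sub>R
      (exp (- s * of_real x) * of_real (g ((1 + a) * (x - fst p) + snd p)))" for p x
  have Fm [measurable]: "(\<lambda>(p, x). F p x) \<in> borel_measurable (law \<Otimes>\<^sub>M lborel)"
  proof -
    have "(\<lambda>(p, x). F p x) = (\<lambda>q. (indicator {0..} (snd q) * indicator {q. fst (fst q) \<le> snd q} q) *\<^sub>R
      (exp (- s * of_real (snd q)) * of_real (g ((1 + a) * (snd q - fst (fst q)) + snd (fst q)))))"
      by (auto simp: F_def indicator_def)
    then show ?thesis by simp
  qed
  have [measurable]: "F p \<in> borel_measurable lborel" for p
    using measurable_Pair2[OF Fm, of p] by simp
  have b: "has_bochner_integral lborel (\<lambda>x. indicator {0..} x * exp (- Re s * x)) (1 / Re s)"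
    using has_bochner_integral_power_exp[OF s, of 0] by simp
  have Fb: "norm (F p x) \<le> K * (indicator {0..} x * exp (- Re s * x))" for p x
  proof -
    have "\<bar>g y\<bar> * exp (- Re s * x) \<le> K * exp (- Re s * x)" for y
      by (intro mult_right_mono K) auto
    then show ?thesis
      using K0 by (auto simp: F_def indicator_def norm_mult mult.commute)
  qed
  have ib: "integrable lborel (\<lambda>x. K * (indicator {0..} x * exp (- Re s * x)))"
    using b by (intro integrable_mult_right) (simp add: has_bochner_integral_iff)
  have iF: "integrable lborel (F p)" for p
  proof (rule Bochner_Integration.integrable_bound[OF ib])
    show "AE x in lborel. norm (F p x) \<le> norm (K * (indicator {0..} x * exp (- Re s * x)))"
      unfolding real_norm_def by (rule AE_I2) (rule order.trans[OF Fb abs_ge_self])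
  qed measurable
  have iFF: "integrable (law \<Otimes>\<^sub>M lborel) (\<lambda>(p, x). F p x)"
  proof (rule P.Fubini_integrable)
    show "integrable law (\<lambda>p. LBINT x. norm (case (p, x) of (p, x) \<Rightarrow> F p x))"
    proof (rule law.integrable_const_bound[of _ "K / Re s"])
      have "(LBINT x. norm (F p x)) \<le> (LBINT x. K * (indicator {0..} x * exp (- Re s * x)))" for p
        by (rule integral_mono) (use iF ib Fb in auto)
      also have "(LBINT x. K * (indicator {0..} x * exp (- Re s * x))) = K / Re s"
        unfolding integral_mult_right_zero using b by (simp add: has_bochner_integral_iff)
      finally show "AE p in law. norm (LBINT x. norm (case (p, x) of (p, x) \<Rightarrow> F p x)) \<le> K / Re s"
        by simp
    qed measurable
  qed (use iF in auto)
  have "laplace (renewal_op g) s = (LBINT x. LINT p|law. F p x)"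
    unfolding laplace_def set_lebesgue_integral_def
  proof (rule Bochner_Integration.integral_cong[OF refl])
    fix x
    have "(LINT p|law. F p x) = (LINT p|law. (indicator {0..} x *\<^sub>R exp (- s * of_real x)) * of_real (if x < fst p then 0 else g ((1 + a) * (x - fst p) + snd p)))"
      by (intro Bochner_Integration.integral_cong) (auto simp: F_def indicator_def)
    also have "\<dots> = (indicator {0..} x *\<^sub>R exp (- s * of_real x)) * of_real (renewal_op g x)"
      unfolding integral_mult_right_zero renewal_op_def integral_complex_of_real ..
    finally show "indicator {0..} x *\<^sub>R (exp (- s * of_real x) * of_real (renewal_op g x)) = (LINT p|law. F p x)"
      by simp
  qed
  also have "\<dots> = (LINT p|law. (LBINT x. F p x))"
    by (rule P.Fubini_integral[OF iFF])
  also have "\<dots> = (LINT p|law. exp_B s (fst p) * ((LINT y:{0..}|lborel. exp (- (s / (1 + a)) * of_real y) * of_real (g (y + snd p))) / of_real (1 + a)))"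
  proof (rule integral_cong_AE)
    show "AE p in law. (LBINT x. F p x) = exp_B s (fst p) * ((LINT y:{0..}|lborel. exp (- (s / (1 + a)) * of_real y) * of_real (g (y + snd p))) / of_real (1 + a))"
      using AE_law_pos
    proof eventually_elim
      case (elim p)
      have "(LBINT x. F p x) = \<bar>1 / (1 + a)\<bar> *\<^sub>R (LBINT y. F p (fst p + 1 / (1 + a) * y))"
        by (rule lborel_integral_real_affine) (use proportion_pos in auto)
      also have "(\<lambda>y. F p (fst p + 1 / (1 + a) * y)) =
          (\<lambda>y. exp (- s * of_real (fst p)) * (indicator {0..} y *\<^sub>R (exp (- (s / (1 + a)) * of_real y) * of_real (g (y + snd p)))))"
      proof
        fix y :: real
        have ind: "indicator {0..} (fst p + 1 / (1 + a) * y) * indicator {fst p..} (fst p + 1 / (1 + a) * y) = (indicator {0..} y :: real)"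
          using elim proportion_pos by (auto simp: indicator_def zero_le_divide_iff)
        have "- s * of_real (fst p + 1 / (1 + a) * y) = - s * of_real (fst p) + - (s / of_real (1 + a)) * of_real y"
          by (simp add: algebra_simps)
        then have e: "exp (- s * of_real (fst p + 1 / (1 + a) * y)) = exp (- s * of_real (fst p)) * exp (- (s / of_real (1 + a)) * of_real y)"
          by (simp only: exp_add)
        have r: "(1 + a) * (fst p + 1 / (1 + a) * y - fst p) + snd p = y + snd p"
          using proportion_pos by simp
        show "F p (fst p + 1 / (1 + a) * y) = exp (- s * of_real (fst p)) * (indicator {0..} y *\<^sub>R (exp (- (s / (1 + a)) * of_real y) * of_real (g (y + snd p))))"
          unfolding F_def ind e r by (simp add: scaleR_conv_of_real)
      qed
      finally show ?case
        using elim proportion_pos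
        by (simp add: exp_B_def set_lebesgue_integral_def scaleR_conv_of_real)
    qed
  qed (unfold set_lebesgue_integral_def, measurable)
  finally show ?thesis .
qed

lemma integral_lawC:
  fixes v :: "real \<Rightarrow> complex"
  assumes [measurable]: "v \<in> borel_measurable borel"
  shows "(LINT x|lawC. v x) = (LINT x:{0..}|lborel. of_real (\<mu> ^ n * (x ^ (n - 1) / fact (n - 1) * exp (- \<mu> * x))) * v x)"
proof -
  have "(LINT x|lawC. v x) = (LINT x|density lborel (\<lambda>t. ennreal (f\<^sub>C t)). v x)"
    by (simp only: distr_C)
  also have "\<dots> = (LINT x|lborel. f\<^sub>C x *\<^sub>R v x)"
    using rate_pos by (subst integral_density) auto
  also have "\<dots> = (LINT x:{0..}|lborel. of_real (\<mu> ^ n * (x ^ (n - 1) / fact (n - 1) * exp (- \<mu> * x))) * v x)"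
    unfolding set_lebesgue_integral_def using stages
    by (intro Bochner_Integration.integral_cong)
      (auto simp: erlang_density_def indicator_def scaleR_conv_of_real Suc_diff_1 not_less)
  finally show ?thesis .
qed

lemma cdf_lawC: "0 \<le> x \<Longrightarrow> 1 - cdf lawC x = (\<Sum>i = 0..n - 1. (\<mu> * x) ^ i / fact i * exp (- \<mu> * x))"
proof -
  assume "0 \<le> x"
  have "cdf lawC x = enn2real (emeasure (density lborel (\<lambda>t. ennreal (f\<^sub>C t))) {..x})"
    unfolding cdf_def measure_def distr_C ..
  also have "\<dots> = erlang_CDF (n - 1) \<mu> x"
    using rate_pos by (simp add: emeasure_erlang_density)
  finally show ?thesis
    using \<open>0 \<le> x\<close> by (simp add: erlang_CDF_def atMost_atLeast0 algebra_simps)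
qed

definition data :: "(real \<Rightarrow> real) \<Rightarrow> real \<Rightarrow> nat \<Rightarrow> complex" where
  "data g v l = (deriv ^^ l) (laplace g) (of_real v)"

text \<open>The expectation over the gain is a mixture of Erlang kernels applied to the shifted
  transform \<open>V\<close>, and each kernel is evaluated by
  \<open>laplace_erlang_shift\<close>.\<close>

lemma laplace_renewal_op:
  fixes g :: "real \<Rightarrow> real"
  assumes g [measurable]: "g \<in> borel_measurable borel" and K: "\<And>x. \<bar>g x\<bar> \<le> K" and s: "0 < Re s"
    and s1: "s \<noteq> \<mu> * (1 + a)" and s2: "s \<noteq> 2 * \<mu> * (1 + a)"
  shows "laplace (renewal_op g) s = J s * laplace g (s / (1 + a)) + H_hom (data g \<mu>) (data g (2 * \<mu>)) s"
proof -
  define w where "w = s / (1 + a)"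
  define V where "V c = (LINT y:{0..}|lborel. exp (- w * of_real y) * of_real (g (y + c)))" for c
  define T where "T k v = (laplace g w - (\<Sum>l\<le>k. (- (of_real v - w)) ^ l / fact l * data g v l)) / (of_real v - w) ^ Suc k" for k v
  have a1: "(1 + of_real a :: complex) \<noteq> 0" using proportion_pos
    by (auto simp: complex_eq_iff)
  have w: "0 < Re w" 
  proof -
    have "w = s / of_real (1 + a)" by (simp add: w_def)
    then show ?thesis using s proportion_pos by (simp only: Re_divide_of_real) simp
  qed
  have K0: "0 \<le> K" using K[of 0] by linarith
  have [measurable]: "V \<in> borel_measurable borel"
  proof -
    have "(\<lambda>c. LBINT y. indicator {0..} y *\<^sub>R (exp (- w * of_real y) * of_real (g (y + c)))) \<in> borel_measurable borel"
      by measurable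
    then show ?thesis unfolding V_def[abs_def] set_lebesgue_integral_def .
  qed
  have bh: "has_bochner_integral lborel (\<lambda>x. indicator {0..} x * exp (- Re w * x)) (1 / Re w)"
    using has_bochner_integral_power_exp[OF w, of 0] by simp
  have VK: "norm (V c) \<le> K / Re w" for c
  proof -
    have le: "norm (indicator {0..} y *\<^sub>R (exp (- w * of_real y) * of_real (g (y + c)))) \<le> K * (indicator {0..} y * exp (- Re w * y))" for y
      using mult_right_mono[OF K[of "y + c"], of "exp (- Re w * y)"]
      by (auto simp: indicator_def norm_mult mult.commute)
    have "norm (V c) \<le> (LBINT y. norm (indicator {0..} y *\<^sub>R (exp (- w * of_real y) * of_real (g (y + c)))))"
      unfolding V_def set_lebesgue_integral_def by (rule integral_norm_bound)
    also have "\<dots> \<le> (LBINT y. K * (indicator {0..} y * exp (- Re w * y)))"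
      using bh K0 le by (intro integral_mono') (auto simp: has_bochner_integral_iff)
    also have "\<dots> = K / Re w" unfolding integral_mult_right_zero using bh by (simp add: has_bochner_integral_iff)
    finally show ?thesis .
  qed
  have erl: "(LINT t:{0..}|lborel. of_real (t ^ k / fact k * exp (- v * t)) * V t) = T k v"
    if "0 < v" "of_real v - w \<noteq> 0" for k v
    unfolding V_def T_def data_def by (rule laplace_erlang_shift[OF g K w that(1) refl that(2)])
  have ierl: "integrable lborel (\<lambda>t. indicator {0..} t *\<^sub>R (of_real (t ^ k / fact k * exp (- v * t)) * V t))"
    if "0 < v" for k v
  proof (rule Bochner_Integration.integrable_bound)
    show "integrable lborel (\<lambda>t. (K / Re w / fact k) * (indicator {0..} t * (t ^ k * exp (- v * t))))"
      using has_bochner_integral_power_exp[OF that, of k] by (intro integrable_mult_right) (simp add: has_bochner_integral_iff)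
    have "norm (indicator {0..} t *\<^sub>R (of_real (t ^ k / fact k * exp (- v * t)) * V t))
        \<le> norm ((K / Re w / fact k) * (indicator {0..} t * (t ^ k * exp (- v * t))))" for t
    proof (cases "0 \<le> t")
      case True
      have "norm (of_real (t ^ k / fact k * exp (- v * t)) * V t) = (t ^ k / fact k * exp (- v * t)) * norm (V t)"
        unfolding norm_mult norm_of_real using True by simp
      also have "\<dots> \<le> (t ^ k / fact k * exp (- v * t)) * (K / Re w)"
        using True by (intro mult_left_mono VK) auto
      also have "\<dots> = norm ((K / Re w / fact k) * (indicator {0..} t * (t ^ k * exp (- v * t))))"
        using True K0 w by (simp add: abs_mult mult_ac)
      finally show ?thesis using True by simp
    qed simp
    then show "AE t in lborel. norm (indicator {0..} t *\<^sub>R (of_real (t ^ k / fact k * exp (- v * t)) * V t))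
        \<le> norm ((K / Re w / fact k) * (indicator {0..} t * (t ^ k * exp (- v * t))))" by simp
  qed measurable
  have wmu: "of_real \<mu> - w \<noteq> 0" "of_real (2 * \<mu>) - w \<noteq> 0"
    using s1 s2 a1 by (auto simp: w_def field_simps)
  have I1: "(LINT x|lawC. V x) = of_real \<mu> ^ n * T (n - 1) \<mu>"
  proof -
    have "(LINT x|lawC. V x) = (LBINT x. of_real \<mu> ^ n * (indicator {0..} x *\<^sub>R (of_real (x ^ (n - 1) / fact (n - 1) * exp (- \<mu> * x)) * V x)))"
      unfolding integral_lawC[OF \<open>V \<in> borel_measurable borel\<close>] set_lebesgue_integral_def
      by (intro Bochner_Integration.integral_cong) auto
    also have "\<dots> = of_real \<mu> ^ n * T (n - 1) \<mu>"
      unfolding integral_mult_right_zero erl[OF rate_pos wmu(1), unfolded set_lebesgue_integral_def] ..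
    finally show ?thesis .
  qed
  have I2: "(LINT x|lawC. of_real (1 - cdf lawC x) * V x) =
      (\<Sum>i = 0..n - 1. of_nat ((n - 1 + i) choose i) * (of_real \<mu> ^ (n + i) * T (n - 1 + i) (2 * \<mu>)))"
  proof -
    have m: "(\<lambda>x. of_real (1 - cdf lawC x) * V x) \<in> borel_measurable borel" by measurable
    have "(LINT x|lawC. of_real (1 - cdf lawC x) * V x) =
        (LBINT x. \<Sum>i = 0..n - 1. of_nat ((n - 1 + i) choose i) * (of_real \<mu> ^ (n + i) *
           (indicator {0..} x *\<^sub>R (of_real (x ^ (n - 1 + i) / fact (n - 1 + i) * exp (- (2 * \<mu>) * x)) * V x))))"
      unfolding integral_lawC[OF m] set_lebesgue_integral_def
    proof (rule Bochner_Integration.integral_cong[OF refl])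
      fix x :: real
      show "indicator {0..} x *\<^sub>R (of_real (\<mu> ^ n * (x ^ (n - 1) / fact (n - 1) * exp (- \<mu> * x))) * (of_real (1 - cdf lawC x) * V x)) =
        (\<Sum>i = 0..n - 1. of_nat ((n - 1 + i) choose i) * (of_real \<mu> ^ (n + i) *
           (indicator {0..} x *\<^sub>R (of_real (x ^ (n - 1 + i) / fact (n - 1 + i) * exp (- (2 * \<mu>) * x)) * V x))))"
      proof (cases "0 \<le> x")
        case True
        \<comment> \<open>The tail of an Erlang variable is a Poisson sum, so density times tail is
          a mixture of kernels of rate 2 mu with n + i stages; merging the two factorials produces
          the binomial coefficient.\<close>
        have "\<mu> ^ n * (x ^ (n - 1) / fact (n - 1) * exp (- \<mu> * x)) * ((\<mu> * x) ^ i / fact i * exp (- \<mu> * x)) =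
            real ((n - 1 + i) choose i) * (\<mu> ^ (n + i) * (x ^ (n - 1 + i) / fact (n - 1 + i) * exp (- (2 * \<mu>) * x)))" for i
        proof -
          have e: "exp (- \<mu> * x) * exp (- \<mu> * x) = exp (- (2 * \<mu>) * x)" by (simp flip: exp_add)
          have "real ((n - 1 + i) choose i) = fact (n - 1 + i) / (fact i * fact (n - 1))"
            by (subst binomial_fact) auto
          then have c: "real ((n - 1 + i) choose i) / fact (n - 1 + i) = 1 / (fact i * fact (n - 1))" by simp
          have "\<mu> ^ n * (x ^ (n - 1) / fact (n - 1) * exp (- \<mu> * x)) * ((\<mu> * x) ^ i / fact i * exp (- \<mu> * x)) =
            \<mu> ^ (n + i) * x ^ (n - 1 + i) * (1 / (fact i * fact (n - 1))) * (exp (- \<mu> * x) * exp (- \<mu> * x))"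
            by (simp add: power_mult_distrib power_add mult_ac)
          also have "\<dots> = real ((n - 1 + i) choose i) * (\<mu> ^ (n + i) * (x ^ (n - 1 + i) / fact (n - 1 + i) * exp (- (2 * \<mu>) * x)))"
            unfolding e c[symmetric] by simp
          finally show ?thesis .
        qed
        then have "\<mu> ^ n * (x ^ (n - 1) / fact (n - 1) * exp (- \<mu> * x)) * (1 - cdf lawC x) =
          (\<Sum>i = 0..n - 1. real ((n - 1 + i) choose i) * (\<mu> ^ (n + i) * (x ^ (n - 1 + i) / fact (n - 1 + i) * exp (- (2 * \<mu>) * x))))"
          unfolding cdf_lawC[OF True] sum_distrib_left by (intro sum.cong) auto
        then have "complex_of_real (\<mu> ^ n * (x ^ (n - 1) / fact (n - 1) * exp (- \<mu> * x)) * (1 - cdf lawC x)) * V x =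
          of_real (\<Sum>i = 0..n - 1. real ((n - 1 + i) choose i) * (\<mu> ^ (n + i) * (x ^ (n - 1 + i) / fact (n - 1 + i) * exp (- (2 * \<mu>) * x)))) * V x"
          by (simp only:)
        then show ?thesis using True by (simp add: sum_distrib_right mult.assoc)
      qed simp
    qed
    also have "\<dots> = (\<Sum>i = 0..n - 1. LBINT x. of_nat ((n - 1 + i) choose i) * (of_real \<mu> ^ (n + i) *
           (indicator {0..} x *\<^sub>R (of_real (x ^ (n - 1 + i) / fact (n - 1 + i) * exp (- (2 * \<mu>) * x)) * V x))))"
      using ierl[of "2 * \<mu>"] rate_pos
      by (intro Bochner_Integration.integral_sum integrable_mult_right) auto
    also have "\<dots> = (\<Sum>i = 0..n - 1. of_nat ((n - 1 + i) choose i) * (of_real \<mu> ^ (n + i) * T (n - 1 + i) (2 * \<mu>)))"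
      using rate_pos unfolding integral_mult_right_zero
      by (subst erl[OF _ wmu(2), unfolded set_lebesgue_integral_def]) auto
    finally show ?thesis .
  qed
  have "laplace (renewal_op g) s = (LINT p|law. exp_B s (fst p) * (V (snd p) / of_real (1 + a)))"
    unfolding V_def w_def by (rule laplace_renewal_op_integral[OF g K s])
  also have "\<dots> = (LINT p|law. exp_B s (fst p) * V (snd p)) / of_real (1 + a)"
    unfolding times_divide_eq_right by (rule integral_divide_zero)
  also have "\<dots> = ((phi s - \<theta> * hs s) * (LINT x|lawC. V x) + 2 * \<theta> * hs s * (LINT x|lawC. of_real (1 - cdf lawC x) * V x)) / (1 + a)"
    using s VK by (subst integral_law[where K = "K / Re w"]) auto
  also have "\<dots> = (phi s - \<theta> * hs s) / (1 + a) * (of_real \<mu> ^ n * T (n - 1) \<mu>)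
     + 2 * \<theta> * hs s / (1 + a) * (\<Sum>i = 0..n - 1. of_nat ((n - 1 + i) choose i) * (of_real \<mu> ^ (n + i) * T (n - 1 + i) (2 * \<mu>)))"
    unfolding I1 I2 by (simp add: add_divide_distrib)
  also have "of_real \<mu> ^ n * T (n - 1) \<mu> = (\<mu> * (1 + a) / (\<mu> * (1 + a) - s)) ^ n * laplace g w
      + (-1) ^ (n - 1) * (\<Sum>l = 0..n - 1. \<mu> ^ l * data g \<mu> l / fact l * (\<mu> * (1 + a) / (s - \<mu> * (1 + a))) ^ (n - l))"
    using erlang_transform_poles[of "1 + of_real a" s "of_real \<mu>" "of_real \<mu>" "n - 1" "laplace g w" "data g \<mu>"] a1 s1 stages
    by (simp add: T_def w_def del: power_Suc)
  also have "(\<Sum>i = 0..n - 1. of_nat ((n - 1 + i) choose i) * (of_real \<mu> ^ (n + i) * T (n - 1 + i) (2 * \<mu>))) =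
     (\<Sum>i = 0..n - 1. of_nat ((n - 1 + i) choose i) * ((\<mu> * (1 + a) / (2 * \<mu> * (1 + a) - s)) ^ (n + i) * laplace g w
       + (-1) ^ (n - 1 + i) * (\<Sum>l = 0..n - 1 + i. \<mu> ^ l * data g (2 * \<mu>) l / fact l * (\<mu> * (1 + a) / (s - 2 * \<mu> * (1 + a))) ^ (n + i - l))))"
  proof (rule sum.cong[OF refl])
    fix i
    show "of_nat ((n - 1 + i) choose i) * (of_real \<mu> ^ (n + i) * T (n - 1 + i) (2 * \<mu>)) = of_nat ((n - 1 + i) choose i) * ((\<mu> * (1 + a) / (2 * \<mu> * (1 + a) - s)) ^ (n + i) * laplace g w
       + (-1) ^ (n - 1 + i) * (\<Sum>l = 0..n - 1 + i. \<mu> ^ l * data g (2 * \<mu>) l / fact l * (\<mu> * (1 + a) / (s - 2 * \<mu> * (1 + a))) ^ (n + i - l)))"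
      using erlang_transform_poles[of "1 + of_real a" s "of_real (2 * \<mu>)" "of_real \<mu>" "n - 1 + i" "laplace g w" "data g (2 * \<mu>)"] a1 s2 stages
      by (simp add: T_def w_def del: power_Suc)
  qed
  also have "(phi s - \<theta> * hs s) / (1 + a) * ((\<mu> * (1 + a) / (\<mu> * (1 + a) - s)) ^ n * laplace g w
      + (-1) ^ (n - 1) * (\<Sum>l = 0..n - 1. \<mu> ^ l * data g \<mu> l / fact l * (\<mu> * (1 + a) / (s - \<mu> * (1 + a))) ^ (n - l)))
     + 2 * \<theta> * hs s / (1 + a) * (\<Sum>i = 0..n - 1. of_nat ((n - 1 + i) choose i) * ((\<mu> * (1 + a) / (2 * \<mu> * (1 + a) - s)) ^ (n + i) * laplace g w
       + (-1) ^ (n - 1 + i) * (\<Sum>l = 0..n - 1 + i. \<mu> ^ l * data g (2 * \<mu>) l / fact l * (\<mu> * (1 + a) / (s - 2 * \<mu> * (1 + a))) ^ (n + i - l))))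
     = J s * laplace g w + H_hom (data g \<mu>) (data g (2 * \<mu>)) s"
  proof -
    have sgn: "(-1) ^ (n + i - 1) = ((-1) ^ (n - 1 + i) :: complex)" for i using stages by simp
    show ?thesis
      unfolding J_fun_def H_hom_def H_fun_def sgn
      by (simp add: algebra_simps sum.distrib sum_distrib_left add_divide_distrib sum_divide_distrib)
  qed
  finally show ?thesis unfolding w_def .
qed

end

section \<open>Functional equation\<close>

lemma iterate_functional_equation:
  fixes J F H :: "complex \<Rightarrow> complex" and \<alpha> :: complex
  assumes "\<And>k. F (s / \<alpha> ^ k) = J (s / \<alpha> ^ k) * F (s / \<alpha> ^ Suc k) + H (s / \<alpha> ^ k)"
  shows "F s = (\<Sum>k<K. (\<Prod>j<k. J (s / \<alpha> ^ j)) * H (s / \<alpha> ^ k)) + (\<Prod>j<K. J (s / \<alpha> ^ j)) * F (s / \<alpha> ^ K)"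
proof (induction K)
  case (Suc K)
  then show ?case by (subst (asm) assms[of K]) (simp add: algebra_simps)
qed simp

text \<open>Since \<open>t j\<close> is at least tau, t_j + c q^j is at most (1 + (c / tau) q^j)
  t_j, hence at most exp((c / tau) q^j) t_j, and the exponents form a convergent geometric series.
  The first \<open>N\<close> factors are merely bounded by \<open>X\<close>, at the price (X /
  tau)^N.\<close>

lemma prod_le_perturbed:
  fixes x t :: "nat \<Rightarrow> real"
  assumes x: "\<And>j. 0 \<le> x j" and t: "\<And>j. \<tau> \<le> t j" "0 < \<tau>" "\<tau> \<le> 1"
    and small: "\<And>j. N \<le> j \<Longrightarrow> x j \<le> t j + c * q ^ j" and init: "\<And>j. j < N \<Longrightarrow> x j \<le> X"
    and c: "0 \<le> c" and q: "0 < q" "q < 1" and X: "1 \<le> X"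
  shows "(\<Prod>j<k. x j) \<le> (X / \<tau>) ^ N * exp (c / \<tau> / (1 - q)) * (\<Prod>j<k. t j)"
proof -
  define y where "y j = (if j < N then X / \<tau> else exp (c / \<tau> * q ^ j))" for j
  have X1: "1 \<le> X / \<tau>" using X t(2,3) by (simp add: pos_le_divide_eq)
  have tj: "0 < t j" for j using t(1)[of j] t(2) by linarith
  have y1: "1 \<le> y j" for j using c q t(2) X1 by (simp add: y_def)
  have xy: "x j \<le> y j * t j" for j
  proof (cases "j < N")
    case True
    have "x j \<le> X" using init True .
    also have "X = X / \<tau> * \<tau>" using t(2) by simp
    also have "\<dots> \<le> X / \<tau> * t j" using X1 t(1) by (intro mult_left_mono) auto
    finally show ?thesis using True by (simp add: y_def)
  next
    case False
    have "x j \<le> t j + c * q ^ j" using small False by simp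
    also have "c * q ^ j \<le> c * q ^ j * (t j / \<tau>)"
      using mult_left_mono[of 1 "t j / \<tau>" "c * q ^ j"] c q t(1)[of j] t(2) by (simp add: pos_le_divide_eq)
    also have "t j + c * q ^ j * (t j / \<tau>) = (1 + c / \<tau> * q ^ j) * t j" by (simp add: algebra_simps)
    also have "\<dots> \<le> exp (c / \<tau> * q ^ j) * t j"
      using tj[of j] by (intro mult_right_mono exp_ge_add_one_self) auto
    finally show ?thesis using False by (simp add: y_def)
  qed
  have "(\<Prod>j<k. x j) \<le> (\<Prod>j<k. y j * t j)"
    using x xy by (intro prod_mono) auto
  also have "\<dots> = (\<Prod>j<k. y j) * (\<Prod>j<k. t j)" by (simp add: prod.distrib)
  also have "(\<Prod>j<k. y j) \<le> (X / \<tau>) ^ N * exp (c / \<tau> / (1 - q))"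
  proof -
    \<comment> \<open>All \<open>y j\<close> are at least 1, so adding factors is harmless; this
      also covers k < N.\<close>
    have "(\<Prod>j<k. y j) \<le> (\<Prod>j<N + k. y j)"
      using y1 by (intro prod_mono2) (auto intro: order.trans[OF zero_le_one])
    also have "\<dots> = (\<Prod>j<N. y j) * (\<Prod>j\<in>{N..<N + k}. y j)"
      by (subst prod.union_disjoint[symmetric]) (auto intro!: prod.cong)
    also have "(\<Prod>j<N. y j) = (X / \<tau>) ^ N" by (simp add: y_def)
    also have "(\<Prod>j\<in>{N..<N + k}. y j) = exp (c / \<tau> * (\<Sum>j\<in>{N..<N + k}. q ^ j))"
      by (simp add: y_def exp_sum sum_distrib_left)
    also have "\<dots> \<le> exp (c / \<tau> / (1 - q))"
    proof -
      have "(\<Sum>j\<in>{N..<N + k}. q ^ j) \<le> (\<Sum>j. q ^ j)"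
        using c q t(2) by (intro sum_le_suminf summable_geometric) auto
      also have "\<dots> = 1 / (1 - q)" using c q t(2) by (intro suminf_geometric) auto
      finally have "c / \<tau> * (\<Sum>j\<in>{N..<N + k}. q ^ j) \<le> c / \<tau> * (1 / (1 - q))"
        using c q t(2) by (intro mult_left_mono) auto
      then show ?thesis by simp
    qed
    finally show ?thesis using X1 by (simp add: mult_left_mono)
  qed
  finally show ?thesis using tj by (simp add: mult_right_mono prod_nonneg less_imp_le)
qed

lemma holomorphic_zero_linear_bound:
  fixes f :: "complex \<Rightarrow> complex"
  assumes "f holomorphic_on S" "open S" "0 \<in> S" "f 0 = 0"
  shows "\<exists>\<epsilon>>0. \<exists>C\<ge>0. \<forall>s. norm s \<le> \<epsilon> \<longrightarrow> norm (f s) \<le> C * norm s"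
proof -
  have "(f has_field_derivative deriv f 0) (at 0)" using assms by (intro holomorphic_derivI)
  then have "((\<lambda>s. f s / s) \<longlongrightarrow> deriv f 0) (at 0)"
    using assms(4) by (simp add: has_field_derivative_iff)
  then have "eventually (\<lambda>s. norm (f s / s) < norm (deriv f 0) + 1) (at 0)"
    using order_tendstoD(2)[OF tendsto_norm, of "\<lambda>s. f s / s" "deriv f 0" "at 0" "norm (deriv f 0) + 1"] by simp
  then obtain d where d: "0 < d" "\<And>s. s \<noteq> 0 \<Longrightarrow> norm s < d \<Longrightarrow> norm (f s / s) < norm (deriv f 0) + 1"
    by (auto simp: eventually_at dist_norm)
  have "norm (f s) \<le> (norm (deriv f 0) + 1) * norm s" if "norm s \<le> d / 2" for s
  proof (cases "s = 0")
    case False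
    then have "norm (f s / s) < norm (deriv f 0) + 1" using that d by auto
    then show ?thesis using False by (simp add: norm_divide pos_divide_less_eq less_imp_le)
  qed (use assms(4) in auto)
  then show ?thesis using d(1) by (intro exI[of _ "d / 2"] conjI exI[of _ "norm (deriv f 0) + 1"]) auto
qed

lemma laplace_bounded_add:
  assumes f: "f \<in> borel_measurable borel" "\<And>x. \<bar>f x\<bar> \<le> K" and g: "g \<in> borel_measurable borel" "\<And>x. \<bar>g x\<bar> \<le> L"
    and s: "0 < Re s"
  shows "laplace (\<lambda>x. f x + c * g x) s = laplace f s + of_real c * laplace g s"
proof -
  have i: "set_integrable lborel {0..} (\<lambda>x. exp (- s * of_real x) * of_real (f x))"
      "set_integrable lborel {0..} (\<lambda>x. exp (- s * of_real x) * of_real (g x))"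
    using set_integrable_power_exp_bounded[OF f s, of 0] set_integrable_power_exp_bounded[OF g s, of 0] by simp_all
  have "laplace (\<lambda>x. f x + c * g x) s =
     (LINT x:{0..}|lborel. exp (- s * of_real x) * of_real (f x) + of_real c * (exp (- s * of_real x) * of_real (g x)))"
    unfolding laplace_def by (intro set_lebesgue_integral_cong) (auto simp: algebra_simps)
  then show ?thesis
    using i by (simp add: set_integral_add laplace_def)
qed

lemma laplace_const: "0 < Re s \<Longrightarrow> laplace (\<lambda>_. 1) s = 1 / s"
  using laplace_power_exp[of 0 s 0] by simp

text \<open>Abelian estimate, obtained by splitting the integral at \<open>X\<close>: if g vanishes
  at infinity, Re s times the transform becomes small as Re s tends to 0. With \<open>X = 0\<close>
  it is the trivial bound.\<close>

lemma norm_laplace_bounded_le: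
  assumes [measurable]: "g \<in> borel_measurable borel" and b: "\<And>x. \<bar>g x\<bar> \<le> K" "\<And>x. X \<le> x \<Longrightarrow> \<bar>g x\<bar> \<le> \<delta>"
    and s: "0 < Re s" and "0 \<le> X"
  shows "norm (laplace g s) \<le> K * X + \<delta> / Re s"
proof -
  have K: "0 \<le> K" and \<delta>: "0 \<le> \<delta>" using b(1)[of 0] b(2)[of X] by linarith+
  have be: "has_bochner_integral lborel (\<lambda>x. indicator {0..} x * exp (- Re s * x)) (1 / Re s)"
    using has_bochner_integral_power_exp[OF s, of 0] by simp
  have bi: "has_bochner_integral lborel (indicat_real {0..X}) X"
    using assms by (simp add: has_bochner_integral_iff)
  have "norm (laplace g s) \<le> (LBINT x. norm (indicator {0..} x *\<^sub>R (exp (- s * of_real x) * of_real (g x))))"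
    unfolding laplace_def set_lebesgue_integral_def by (rule integral_norm_bound)
  also have "\<dots> \<le> (LBINT x. K * indicator {0..X} x + \<delta> * (indicator {0..} x * exp (- Re s * x)))"
  proof (rule integral_mono')
    show "integrable lborel (\<lambda>x. K * indicator {0..X} x + \<delta> * (indicator {0..} x * exp (- Re s * x)))"
      using be bi by (simp add: has_bochner_integral_iff)
    show "norm (indicator {0..} x *\<^sub>R (exp (- s * of_real x) * of_real (g x)))
      \<le> K * indicator {0..X} x + \<delta> * (indicator {0..} x * exp (- Re s * x))" for x
    proof (cases "0 \<le> x")
      case True
      show ?thesis
      proof (cases "x \<le> X")
        case True
        have "exp (- Re s * x) * \<bar>g x\<bar> \<le> 1 * K"
          using s \<open>0 \<le> x\<close> by (intro mult_mono b) auto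
        also have "\<dots> \<le> 1 * K + \<delta> * exp (- Re s * x)" using \<delta> by simp
        finally show ?thesis using True \<open>0 \<le> x\<close> by (simp add: norm_mult)
      next
        case False
        then have "exp (- Re s * x) * \<bar>g x\<bar> \<le> exp (- Re s * x) * \<delta>" by (intro mult_left_mono b) auto
        then show ?thesis using False \<open>0 \<le> x\<close> by (simp add: norm_mult mult.commute)
      qed
    qed (use K in auto)
    show "0 \<le> K * indicator {0..X} x + \<delta> * (indicator {0..} x * exp (- Re s * x))" for x
      using K \<delta> by simp
  qed
  also have "\<dots> = K * X + \<delta> / Re s"
    using be bi by (simp add: has_bochner_integral_iff)
  finally show ?thesis .
qed

context dual_risk_model
begin

abbreviation "\<alpha> \<equiv> 1 + complex_of_real a"

lemma \<alpha>_nz: "\<alpha> \<noteq> 0" "1 + a \<noteq> 0" "1 < 1 + a" "0 < 1 + a"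
  using proportion_pos by (auto simp: complex_eq_iff)

lemma \<alpha>_power: "\<alpha> ^ k = of_real ((1 + a) ^ k)"
  by simp

lemma norm_\<alpha>: "norm \<alpha> = 1 + a"
proof -
  have eq: "\<alpha> = of_real (1 + a)" by simp
  have "\<bar>1 + a\<bar> = 1 + a" using proportion_pos by simp
  then show ?thesis by (simp only: eq norm_of_real)
qed

lemma Re_div_\<alpha>: "Re (s / \<alpha> ^ k) = Re s / (1 + a) ^ k" "norm (s / \<alpha> ^ k) = norm s / (1 + a) ^ k"
  unfolding \<alpha>_power using \<alpha>_nz by (simp_all only: Re_divide_of_real norm_divide norm_of_real) simp

lemma measurable_renewal_op [measurable]:
  assumes [measurable]: "g \<in> borel_measurable borel"
  shows "renewal_op g \<in> borel_measurable borel"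
  unfolding renewal_op_def[abs_def] by measurable

lemma renewal_op_bound:
  assumes "g \<in> borel_measurable borel" "\<And>x. \<bar>g x\<bar> \<le> K"
  shows "\<bar>renewal_op g x\<bar> \<le> K"
proof -
  have "\<bar>renewal_op g x\<bar> \<le> (LINT p|law. \<bar>if x < fst p then 0 else g ((1 + a) * (x - fst p) + snd p)\<bar>)"
    unfolding renewal_op_def by (rule integral_abs_bound)
  also have "\<dots> \<le> (LINT p|law. K)"
    using assms order.trans[OF abs_ge_zero assms(2)] by (intro integral_mono') auto
  finally show ?thesis using law.prob_space by simp
qed

abbreviation "rho \<equiv> laplace ruin_prob'"

lemma laplace_ruin_prob: "laplace (ruin_prob M B C a) = rho"
  unfolding laplace_def by (intro ext set_lebesgue_integral_cong) (auto simp: ruin_prob_eq)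

lemma ruin_prob'_abs: "\<bar>ruin_prob' x\<bar> \<le> 1"
  using ruin_prob'_bounds[of x] by simp

text \<open>P(B > x) is expressed as 1 minus the operator applied to 1, so that all summands have
  known transforms; the coefficients \<open>(-1)\<close> and \<open>1\<close> fit the form of
  \<open>laplace_bounded_add\<close>.\<close>

lemma ruin_prob'_fixed_point: "ruin_prob' x = (1 + (-1) * renewal_op (\<lambda>_. 1) x) + 1 * renewal_op ruin_prob' x"
proof -
  let ?j = "\<lambda>p. if x < fst p then 0 else 1 :: real"
  let ?r = "\<lambda>p. if x < fst p then 0 else ruin_prob' ((1 + a) * (x - fst p) + snd p)"
  have i: "integrable law ?j" "integrable law ?r"
    using ruin_prob'_abs by (auto intro!: law.integrable_const_bound[of _ 1])
  have "ruin_prob' x = (LINT p|law. (1 - ?j p) + ?r p)"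
  proof -
    have "(if x < fst p then 1 else ruin_prob' ((1 + a) * (x - fst p) + snd p)) = (1 - ?j p) + ?r p" for p by simp
    then show ?thesis using ruin_prob'_renewal[of x] by presburger
  qed
  also have "\<dots> = (1 - (LINT p|law. ?j p)) + (LINT p|law. ?r p)"
    using i law.prob_space by simp
  finally show ?thesis by (simp add: renewal_op_def)
qed

lemma laplace_renewal_op_one:
  assumes s: "0 < Re s"
  shows "laplace (renewal_op (\<lambda>_. 1)) s = phi s / s"
proof -
  have w: "0 < Re (s / \<alpha>)" using s \<alpha>_nz Re_div_\<alpha>[of s 1] by simp
  have "laplace (renewal_op (\<lambda>_. 1)) s = (LINT p|law. exp_B s (fst p) * (laplace (\<lambda>_. 1) (s / \<alpha>) / of_real (1 + a)))"
    using laplace_renewal_op_integral[of "\<lambda>_. 1" 1 s] s by (simp add: laplace_def)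
  also have "\<dots> = (LINT p|law. exp_B s (fst p) / s)"
    unfolding laplace_const[OF w] using \<alpha>_nz(1) by simp
  also have "\<dots> = (LINT p|law. exp_B s (fst p)) / s" by (rule integral_divide_zero)
  also have "(LINT p|law. exp_B s (fst p)) = (LINT \<omega>|M. exp_B s (B 0 \<omega>))"
    unfolding law_def by (subst integral_distr) auto
  also have "\<dots> = phi s"
    unfolding integral_exp_B_law[symmetric] by (subst integral_distr) auto
  finally show ?thesis .
qed

abbreviation "p_coef \<equiv> data ruin_prob' \<mu>"
abbreviation "q_coef \<equiv> data ruin_prob' (2 * \<mu>)"

lemma rho_functional_equation:
  assumes s: "0 < Re s" "s \<noteq> \<mu> * (1 + a)" "s \<noteq> 2 * \<mu> * (1 + a)"
  shows "rho s = J s * rho (s / \<alpha>) + H_fun n \<mu> a \<theta> phi hs p_coef q_coef s"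
proof -
  have m1: "renewal_op (\<lambda>_. 1) \<in> borel_measurable borel" by measurable
  have m2: "renewal_op ruin_prob' \<in> borel_measurable borel" by measurable
  have b1: "\<bar>renewal_op (\<lambda>_. 1) x\<bar> \<le> 1" for x by (rule renewal_op_bound) auto
  have b2: "\<bar>renewal_op ruin_prob' x\<bar> \<le> 1" for x by (rule renewal_op_bound) (auto simp: ruin_prob'_abs)
  have m3: "(\<lambda>x. 1 + (-1) * renewal_op (\<lambda>_. 1) x) \<in> borel_measurable borel" using m1 by measurable
  have b3: "\<bar>1 + (-1) * renewal_op (\<lambda>_. 1) x\<bar> \<le> 2" for x using b1[of x] by linarith
  have "rho s = laplace (\<lambda>x. (1 + (-1) * renewal_op (\<lambda>_. 1) x) + 1 * renewal_op ruin_prob' x) s"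
    using ruin_prob'_fixed_point by (intro arg_cong[where f = "\<lambda>g. laplace g s"] ext)
  also have "\<dots> = laplace (\<lambda>x. 1 + (-1) * renewal_op (\<lambda>_. 1) x) s + of_real 1 * laplace (renewal_op ruin_prob') s"
    by (rule laplace_bounded_add[OF m3 b3 m2 b2 s(1)])
  also have "laplace (\<lambda>x. 1 + (-1) * renewal_op (\<lambda>_. 1) x) s = laplace (\<lambda>_. 1) s + of_real (-1) * laplace (renewal_op (\<lambda>_. 1)) s"
    by (rule laplace_bounded_add[OF _ _ m1 b1 s(1), where K = 1]) auto
  also have "\<dots> = (1 - phi s) / s"
    using laplace_const[OF s(1)] laplace_renewal_op_one[OF s(1)] by (simp add: diff_divide_distrib)
  also have "laplace (renewal_op ruin_prob') s = J s * rho (s / \<alpha>) + H_hom p_coef q_coef s"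
    using laplace_renewal_op[OF measurable_ruin_prob' ruin_prob'_abs s] by simp
  finally show ?thesis by (simp add: H_hom_def)
qed

lemma norm_hs_le: "0 \<le> Re s \<Longrightarrow> norm (hs s) \<le> 1"
proof -
  interpret LB: prob_space lawB by (rule prob_space_distr) simp
  assume s: "0 \<le> Re s"
  have one: "\<bar>1 - 2 * cdf lawB x\<bar> \<le> 1" for x
    using cdf_abs_le_1[of x] by (auto simp: cdf_def abs_le_iff)
  have "norm (of_real (1 - 2 * cdf lawB x) * exp_B s x) \<le> 1 * 1" for x
    unfolding norm_mult norm_of_real using s by (intro mult_mono one norm_exp_B_le) auto
  then have "norm (LINT x|lawB. of_real (1 - 2 * cdf lawB x) * exp_B s x) \<le> (LINT x|lawB. 1)"
    by (intro order.trans[OF integral_norm_bound] integral_mono') auto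
  then show ?thesis unfolding integral_exp_B_h using LB.prob_space by simp
qed

text \<open>Weakening this bound to 1 would lose the product that decides the fate of the
  remainder.\<close>

lemma norm_phi_le: "norm (phi s) \<le> phi_real (Re s)"
proof -
  have "norm (phi s) \<le> (LINT \<omega>|M. norm (exp (- s * of_real (B 0 \<omega>))))"
    unfolding laplace_stieltjes_def by (rule integral_norm_bound)
  then show ?thesis by (simp add: phi_real_def)
qed

text \<open>\<open>JA\<close>, \<open>JB\<close>, \<open>HA\<close>, \<open>HB\<close> are the
  rational factors of \<open>J\<close> and \<open>H_hom\<close>. They are holomorphic near 0,
  whereas phi and hs are only known to be bounded on the closed half-plane and may fail to be
  differentiable at 0.\<close>

definition JA :: "complex \<Rightarrow> complex" where
  "JA s = (of_real \<mu> * (1 + of_real a) / (of_real \<mu> * (1 + of_real a) - s)) ^ n / (1 + of_real a)"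

definition JB :: "complex \<Rightarrow> complex" where
  "JB s = 2 * of_real \<theta> / (1 + of_real a) * (\<Sum>i = 0..n - 1. of_nat ((n - 1 + i) choose i) *
          (of_real \<mu> * (1 + of_real a) / (2 * of_real \<mu> * (1 + of_real a) - s)) ^ (n + i))"

lemma J_split: "J s = (phi s - \<theta> * hs s) * JA s + hs s * JB s"
  by (simp add: J_fun_def JA_def JB_def)

definition HA :: "(nat \<Rightarrow> complex) \<Rightarrow> complex \<Rightarrow> complex" where
  "HA y s = (-1) ^ (n - 1) / (1 + of_real a) * (\<Sum>l = 0..n - 1. of_real \<mu> ^ l * y l / fact l *
          (of_real \<mu> * (1 + of_real a) / (s - of_real \<mu> * (1 + of_real a))) ^ (n - l))"

definition HB :: "(nat \<Rightarrow> complex) \<Rightarrow> complex \<Rightarrow> complex" where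
  "HB z s = 2 * of_real \<theta> * (\<Sum>i = 0..n - 1. of_nat ((n - 1 + i) choose i) *
          (\<Sum>l = 0..n - 1 + i. (-1) ^ (n + i - 1) * of_real \<mu> ^ l / (fact l * (1 + of_real a)) *
             (of_real \<mu> * (1 + of_real a) / (s - 2 * of_real \<mu> * (1 + of_real a))) ^ (n + i - l) * z l))"

lemma H_hom_split: "H_hom y z s = (phi s - \<theta> * hs s) * HA y s + hs s * HB z s"
  by (simp add: H_hom_def H_fun_def HA_def HB_def)

abbreviation "no_pole \<equiv> - {complex_of_real (\<mu> * (1 + a)), complex_of_real (2 * \<mu> * (1 + a))}"

lemma rational_holomorphic:
  "JA holomorphic_on no_pole" "JB holomorphic_on no_pole" "HA y holomorphic_on no_pole" "HB z holomorphic_on no_pole"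
proof -
  have nz: "of_real \<mu> * \<alpha> - s \<noteq> 0" "2 * of_real \<mu> * \<alpha> - s \<noteq> 0" "s - of_real \<mu> * \<alpha> \<noteq> 0" "s - 2 * of_real \<mu> * \<alpha> \<noteq> 0"
    if "s \<in> no_pole" for s using that by auto
  show "JA holomorphic_on no_pole" "JB holomorphic_on no_pole" "HA y holomorphic_on no_pole" "HB z holomorphic_on no_pole"
    unfolding JA_def[abs_def] JB_def[abs_def] HA_def[abs_def] HB_def[abs_def]
    using nz \<alpha>_nz(1) by (auto intro!: holomorphic_intros)
qed

text \<open>At 0, alpha \<open>JA\<close> equals 1 and \<open>JB\<close> equals theta
  \<open>JA\<close>, so alpha \<open>J\<close> is phi plus two terms whose rational factors vanish
  at 0. The linear error comes from these factors alone, phi and hs being bounded by 1.\<close>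

lemma J_small_bound:
  "\<exists>\<epsilon>>0. \<exists>C\<ge>0. \<forall>s. 0 \<le> Re s \<longrightarrow> norm s \<le> \<epsilon> \<longrightarrow> (1 + a) * norm (J s) \<le> phi_real (Re s) + C * norm s"
proof -
  have op: "open no_pole" "0 \<in> no_pole" using rate_pos \<alpha>_nz by (auto simp: open_Compl)
  \<comment> \<open>The identity says that the tail 1 - F_C(C) has mean 1/2; it reduces to the sum
    of binom(n-1+i, i) / 2^i being 2^(n-1).\<close>
  have sum_half: "2 * (\<Sum>i = 0..n - 1. of_nat ((n - 1 + i) choose i) * (of_real \<mu> * \<alpha> / (2 * of_real \<mu> * \<alpha> - 0)) ^ (n + i)) = (1::complex)"
  proof -
    have X: "of_real \<mu> * \<alpha> \<noteq> 0" using rate_pos \<alpha>_nz(1) by simp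
    have "2 * of_real \<mu> * \<alpha> - 0 = 2 * (of_real \<mu> * \<alpha>)" by (simp only: diff_0_right mult.assoc)
    then have h: "of_real \<mu> * \<alpha> / (2 * of_real \<mu> * \<alpha> - 0) = (1 / 2 :: complex)"
      using nonzero_divide_mult_cancel_right[OF X, of 2] by (simp only:)
    have "(\<Sum>i = 0..n - 1. of_nat ((n - 1 + i) choose i) * (1 / 2) ^ (n + i)) =
        (1 / 2) ^ n * (\<Sum>i\<le>n - 1. (of_nat (n - 1 + i) gchoose i) / 2 ^ i :: complex)"
      by (simp add: sum_distrib_left power_add atMost_atLeast0 power_divide binomial_gbinomial)
    also have "\<dots> = (1 / 2) ^ n * 2 ^ (n - 1)" by (simp only: gbinomial_sum_nat_pow2)
    also have "\<dots> = 1 / 2" using stages by (cases n) (auto simp: power_divide)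
    finally show ?thesis unfolding h by (simp add: mult.commute)
  qed
  have "(\<lambda>s. \<alpha> * JA s - 1) holomorphic_on no_pole" "(\<lambda>s. \<alpha> * (JB s - \<theta> * JA s)) holomorphic_on no_pole"
    by (intro holomorphic_intros rational_holomorphic)+
  moreover have JA0: "\<alpha> * JA 0 = 1" using \<alpha>_nz(1) rate_pos by (simp add: JA_def)
  moreover have "\<alpha> * (JB 0 - \<theta> * JA 0) = 0"
  proof -
    have "\<alpha> * JB 0 = \<theta> * (2 * (\<Sum>i = 0..n - 1. of_nat ((n - 1 + i) choose i) * (of_real \<mu> * \<alpha> / (2 * of_real \<mu> * \<alpha> - 0)) ^ (n + i)))"
      unfolding JB_def using \<alpha>_nz(1) by (simp del: diff_0_right)
    then have "\<alpha> * JB 0 = \<theta>" unfolding sum_half by simp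
    then show ?thesis using JA0 by (simp add: algebra_simps)
  qed
  ultimately obtain e1 C1 e2 C2 where e: "0 < e1" "0 \<le> C1" "\<And>s. norm s \<le> e1 \<Longrightarrow> norm (\<alpha> * JA s - 1) \<le> C1 * norm s"
     "0 < e2" "0 \<le> C2" "\<And>s. norm s \<le> e2 \<Longrightarrow> norm (\<alpha> * (JB s - \<theta> * JA s)) \<le> C2 * norm s"
    using holomorphic_zero_linear_bound[of "\<lambda>s. \<alpha> * JA s - 1" no_pole]
      holomorphic_zero_linear_bound[of "\<lambda>s. \<alpha> * (JB s - \<theta> * JA s)" no_pole] op by auto
  have "(1 + a) * norm (J s) \<le> phi_real (Re s) + (C1 + C2) * norm s" if s: "0 \<le> Re s" "norm s \<le> min e1 e2" for s
  proof -
    have "phi s * (\<alpha> * JA s - 1) + hs s * (\<alpha> * (JB s - \<theta> * JA s)) + phi s = \<alpha> * J s"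
      unfolding J_split by (simp add: algebra_simps)
    from this[symmetric] have "norm (\<alpha> * J s) \<le> norm (phi s) * norm (\<alpha> * JA s - 1) + norm (hs s) * norm (\<alpha> * (JB s - \<theta> * JA s)) + norm (phi s)"
      unfolding norm_mult[symmetric] by (simp only: order.trans[OF norm_triangle_ineq add_right_mono[OF norm_triangle_ineq]])
    also have "\<dots> \<le> 1 * (C1 * norm s) + 1 * (C2 * norm s) + phi_real (Re s)"
      using s e norm_hs_le[of s] norm_phi_le[of s] phi_real_le_1[of "Re s"]
      by (intro add_mono mult_mono) auto
    finally show ?thesis
      unfolding norm_mult norm_\<alpha> by (simp add: algebra_simps)
  qed
  then show ?thesis using e by (intro exI[of _ "min e1 e2"] conjI exI[of _ "C1 + C2"]) auto
qed

end

section \<open>Convergence of the series\<close>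

context dual_risk_model
begin

definition regular :: "complex set" where
  "regular = {s. 0 < Re s} - singular_points \<mu> a"

lemma singular_pointsE:
  assumes "s \<in> singular_points \<mu> a"
  obtains j v where "v \<in> {\<mu>, 2 * \<mu>}" "s = of_real (v * (1 + a) ^ (j + 1))"
proof -
  from assms consider j where "s = of_real (\<mu> * (1 + a) ^ (j + 1))" | j where "s = of_real (2 * \<mu> * (1 + a) ^ (j + 1))"
    unfolding singular_points_def by blast
  then show thesis
  proof cases
    case (1 j)
    then show thesis by (intro that[of \<mu> j]) simp_all
  next
    case (2 j)
    then show thesis by (intro that[of "2 * \<mu>" j]) simp_all
  qed
qed

lemma singular_pointsI: "v \<in> {\<mu>, 2 * \<mu>} \<Longrightarrow> of_real (v * (1 + a) ^ (j + 1)) \<in> singular_points \<mu> a"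
  unfolding singular_points_def by auto

lemma finite_singular_points: "finite (singular_points \<mu> a \<inter> cball 0 R)"
proof -
  obtain N where N: "R / \<mu> < (1 + a) ^ N" using real_arch_pow[of "1 + a"] proportion_pos by auto
  have "singular_points \<mu> a \<inter> cball 0 R \<subseteq> (\<lambda>(v, j). of_real (v * (1 + a) ^ (j + 1))) ` ({\<mu>, 2 * \<mu>} \<times> {..N})"
  proof
    fix s assume s: "s \<in> singular_points \<mu> a \<inter> cball 0 R"
    then obtain j v where jv: "v \<in> {\<mu>, 2 * \<mu>}" "s = of_real (v * (1 + a) ^ (j + 1))"
      using singular_pointsE[of s] by blast
    have "\<mu> * (1 + a) ^ j \<le> v * (1 + a) ^ (j + 1)"
      using jv(1) rate_pos proportion_pos by (intro mult_mono power_increasing) auto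
    also have "\<dots> \<le> R"
    proof -
      have "norm s \<le> R" using s by simp
      then show ?thesis unfolding jv(2) norm_of_real by linarith
    qed
    finally have "(1 + a) ^ j \<le> R / \<mu>" using rate_pos by (simp add: pos_le_divide_eq mult.commute)
    then have "(1 + a) ^ j < (1 + a) ^ N" using N by linarith
    then have "j \<le> N" using proportion_pos by simp
    then show "s \<in> (\<lambda>(v, j). of_real (v * (1 + a) ^ (j + 1))) ` ({\<mu>, 2 * \<mu>} \<times> {..N})"
      using jv by (intro image_eqI[of _ _ "(v, j)"]) auto
  qed
  then show ?thesis by (rule finite_subset) auto
qed

lemma singular_points_isolated:
  "\<exists>d>0. \<forall>w \<in> singular_points \<mu> a. w \<noteq> s \<longrightarrow> d \<le> dist s w"
proof -
  obtain d where d: "0 < d" "\<forall>w \<in> singular_points \<mu> a \<inter> cball 0 (norm s + 1). w \<noteq> s \<longrightarrow> d \<le> dist s w"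
    using finite_set_avoid[OF finite_singular_points] by blast
  have "min d 1 \<le> dist s w" if "w \<in> singular_points \<mu> a" "w \<noteq> s" for w
  proof (cases "w \<in> cball 0 (norm s + 1)")
    case True
    then show ?thesis using d that by force
  next
    case False
    then have "norm s + 1 < norm w" by simp
    then have "1 < norm (w - s)" using norm_triangle_ineq2[of w s] by linarith
    then show ?thesis by (simp add: dist_norm norm_minus_commute)
  qed
  then show ?thesis using d(1) by (intro exI[of _ "min d 1"]) auto
qed

lemma open_regular: "open regular"
proof -
  have "open (- singular_points \<mu> a)"
    unfolding open_dist
  proof
    fix s assume s: "s \<in> - singular_points \<mu> a"
    obtain d where d: "0 < d" "\<forall>w \<in> singular_points \<mu> a. w \<noteq> s \<longrightarrow> d \<le> dist s w"
      using singular_points_isolated by blast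
    then show "\<exists>e>0. \<forall>y. dist y s < e \<longrightarrow> y \<in> - singular_points \<mu> a"
      using s by (intro exI[of _ d]) (auto simp: dist_commute not_le[symmetric])
  qed
  then have "open ({s. 0 < Re s} \<inter> - singular_points \<mu> a)" by (intro open_Int open_halfspace_Re_gt)
  then show ?thesis by (simp add: regular_def Diff_eq)
qed

text \<open>The singular set is closed under multiplication by alpha, so its complement is stable
  under division: no iterate of the functional equation meets a pole.\<close>

lemma regular_div: "s \<in> regular \<Longrightarrow> s / \<alpha> ^ k \<in> regular"
proof -
  assume s: "s \<in> regular"
  have "s / \<alpha> ^ k \<notin> singular_points \<mu> a"
  proof
    assume "s / \<alpha> ^ k \<in> singular_points \<mu> a"
    then obtain j v where jv: "v \<in> {\<mu>, 2 * \<mu>}" "s / \<alpha> ^ k = of_real (v * (1 + a) ^ (j + 1))" by (rule singular_pointsE)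
    then have "s = of_real (v * (1 + a) ^ (j + 1)) * \<alpha> ^ k" using \<alpha>_nz by (simp add: field_simps)
    also have "\<dots> = of_real (v * (1 + a) ^ ((j + k) + 1))"
      by (simp add: power_add)
    finally have "s \<in> singular_points \<mu> a" using singular_pointsI[OF jv(1)] by simp
    then show False using s by (simp add: regular_def)
  qed
  then show ?thesis using s \<alpha>_nz by (simp add: regular_def Re_div_\<alpha>)
qed

lemma regular_no_pole: "regular \<subseteq> no_pole"
  using singular_pointsI[of \<mu> 0] singular_pointsI[of "2 * \<mu>" 0] by (auto simp: regular_def)

lemma regular_functional_equation:
  assumes "s \<in> regular"
  shows "rho s = J s * rho (s / \<alpha>) + H_fun n \<mu> a \<theta> phi hs p_coef q_coef s"
  using regular_no_pole assms by (intro rho_functional_equation) (auto simp: regular_def)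

lemma scaled_compact:
  assumes K: "compact K" "K \<subseteq> regular" and "0 < \<epsilon>"
  obtains N where "\<And>s k. s \<in> K \<Longrightarrow> N \<le> k \<Longrightarrow> norm (s / \<alpha> ^ k) \<le> \<epsilon>"
proof -
  obtain R where R: "\<And>s. s \<in> K \<Longrightarrow> norm s \<le> R" using compact_imp_bounded[OF K(1)] by (auto simp: bounded_iff)
  obtain N where N: "R / \<epsilon> < (1 + a) ^ N" using real_arch_pow[of "1 + a"] proportion_pos by auto
  have "norm (s / \<alpha> ^ k) \<le> \<epsilon>" if "s \<in> K" "N \<le> k" for s k
  proof -
    have "R / \<epsilon> \<le> (1 + a) ^ k"
      using N power_increasing[OF that(2), of "1 + a"] proportion_pos by linarith
    then have "R \<le> \<epsilon> * (1 + a) ^ k" using assms(3) by (simp add: pos_divide_le_eq mult.commute)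
    with R[OF that(1)] show ?thesis unfolding Re_div_\<alpha> using \<alpha>_nz by (simp add: pos_divide_le_eq)
  qed
  then show thesis by (rule that)
qed

text \<open>From some power on, the scaled copies of \<open>K\<close> lie in a small disc around 0
  on which \<open>f\<close> is holomorphic. With the finitely many remaining copies that disc forms
  one compact subset of \<open>no_pole\<close>.\<close>

lemma bounded_along_scaling:
  assumes K: "compact K" "K \<subseteq> regular" and f: "f holomorphic_on no_pole"
  obtains L where "0 \<le> L" "\<And>s k. s \<in> K \<Longrightarrow> norm (f (s / \<alpha> ^ k) :: complex) \<le> L"
proof -
  have "open no_pole" "0 \<in> no_pole" using rate_pos \<alpha>_nz by (auto simp: open_Compl)
  then obtain \<epsilon> where e: "0 < \<epsilon>" "cball 0 \<epsilon> \<subseteq> no_pole" by (meson open_contains_cball)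
  obtain N where N: "\<And>s k. s \<in> K \<Longrightarrow> N \<le> k \<Longrightarrow> norm (s / \<alpha> ^ k) \<le> \<epsilon>"
    using scaled_compact[OF K e(1)] by blast
  define T where "T = cball 0 \<epsilon> \<union> (\<Union>k<N. (\<lambda>s. s / \<alpha> ^ k) ` K)"
  have "compact T" unfolding T_def
    using K(1) \<alpha>_nz by (intro compact_Un compact_UN compact_continuous_image) (auto intro!: continuous_intros)
  moreover have "T \<subseteq> no_pole"
  proof -
    have "(\<lambda>s. s / \<alpha> ^ k) ` K \<subseteq> no_pole" for k
    proof (rule image_subsetI)
      fix s assume "s \<in> K"
      then show "s / \<alpha> ^ k \<in> no_pole" using subsetD[OF K(2)] regular_div subsetD[OF regular_no_pole] by simp
    qed
    then show ?thesis unfolding T_def using e(2) by (simp only: Un_subset_iff UN_subset_iff) simp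
  qed
  ultimately have "bounded (f ` T)"
    using f by (intro compact_imp_bounded compact_continuous_image holomorphic_on_imp_continuous_on)
      (auto intro: holomorphic_on_subset)
  then obtain L where L: "\<And>s. s \<in> T \<Longrightarrow> norm (f s) \<le> L" by (auto simp: bounded_iff)
  have "s / \<alpha> ^ k \<in> T" if "s \<in> K" for s k
    using N[OF that, of k] that by (cases "N \<le> k") (auto simp: T_def)
  moreover have "0 \<le> L" using L[of 0] e(1) order.trans[OF norm_ge_zero] by (auto simp: T_def)
  ultimately show thesis using L by (intro that[of L]) auto
qed

lemma phi_hs_combination_bound:
  assumes "0 \<le> Re s" "norm u \<le> L" "norm v \<le> L'"
  shows "norm ((phi s - \<theta> * hs s) * u + hs s * v) \<le> 2 * L + L'"
proof -
  have "norm (phi s) \<le> 1" using norm_phi_le[of s] phi_real_le_1[OF assms(1)] by linarith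
  moreover have "\<bar>\<theta>\<bar> * norm (hs s) \<le> 1 * 1" using dependence norm_hs_le[OF assms(1)] by (intro mult_mono) auto
  ultimately have "norm (phi s - \<theta> * hs s) \<le> 2"
    using norm_triangle_ineq4[of "phi s" "\<theta> * hs s"] by (simp add: norm_mult)
  then have "norm ((phi s - \<theta> * hs s) * u) \<le> 2 * L" unfolding norm_mult using assms by (intro mult_mono) auto
  moreover have "norm (hs s * v) \<le> 1 * L'" unfolding norm_mult using assms norm_hs_le by (intro mult_mono) auto
  ultimately show ?thesis using norm_triangle_ineq[of "(phi s - \<theta> * hs s) * u" "hs s * v"] by linarith
qed

abbreviation "J_prod k s \<equiv> (\<Prod>j<k. J (s / \<alpha> ^ j))"

text \<open>\<open>J_small_bound\<close> applies to all but the first N factors, the crude bound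
  \<open>X\<close> to these, and \<open>prod_le_perturbed\<close> combines them uniformly on
  \<open>K\<close>. The factors \<open>phi_real\<close> are kept for the remainder.\<close>

lemma J_prod_bound:
  assumes K: "compact K" "K \<subseteq> regular"
  obtains L where "0 \<le> L"
    "\<And>s k. s \<in> K \<Longrightarrow> (1 + a) ^ k * norm (J_prod k s) \<le> L * (\<Prod>j<k. phi_real (Re s / (1 + a) ^ j))"
proof -
  obtain \<epsilon> c where e: "0 < \<epsilon>" "0 \<le> c" "\<And>s. 0 \<le> Re s \<Longrightarrow> norm s \<le> \<epsilon> \<Longrightarrow> (1 + a) * norm (J s) \<le> phi_real (Re s) + c * norm s"
    using J_small_bound by blast
  obtain N where N: "\<And>s k. s \<in> K \<Longrightarrow> N \<le> k \<Longrightarrow> norm (s / \<alpha> ^ k) \<le> \<epsilon>"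
    using scaled_compact[OF K e(1)] by blast
  obtain R where R: "\<And>s. s \<in> K \<Longrightarrow> norm s \<le> R" using compact_imp_bounded[OF K(1)] by (auto simp: bounded_iff)
  define R' where "R' = max R 0"
  obtain L where L: "0 \<le> L" "\<And>s k. s \<in> K \<Longrightarrow> norm (JA (s / \<alpha> ^ k)) \<le> L"
    using bounded_along_scaling[OF K rational_holomorphic(1)] by blast
  obtain L' where L': "0 \<le> L'" "\<And>s k. s \<in> K \<Longrightarrow> norm (JB (s / \<alpha> ^ k)) \<le> L'"
    using bounded_along_scaling[OF K rational_holomorphic(2)] by blast
  define X where "X = max 1 ((1 + a) * (2 * L + L'))"
  \<comment> \<open>All arguments of \<open>phi_real\<close> are at most \<open>R'\<close>, so this
    is a common positive lower bound; cutting \<open>R'\<close> at 0 covers an empty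
    \<open>K\<close>.\<close>
  define \<tau> where "\<tau> = phi_real R'"
  define C where "C = (X / \<tau>) ^ N * exp (c * R' / \<tau> / (1 - 1 / (1 + a)))"
  have \<tau>: "0 < \<tau>" "\<tau> \<le> 1" unfolding \<tau>_def R'_def by (auto intro: phi_real_pos phi_real_le_1)
  have "(1 + a) ^ k * norm (J_prod k s) \<le> C * (\<Prod>j<k. phi_real (Re s / (1 + a) ^ j))" if s: "s \<in> K" for s k
  proof -
    have Re: "0 \<le> Re (s / \<alpha> ^ j)" for j
      using regular_div[of s j] s K(2) by (auto simp: regular_def)
    have sR: "norm s \<le> R'" using R[OF s] by (simp add: R'_def)
    have "(\<Prod>j<k. (1 + a) * norm (J (s / \<alpha> ^ j))) \<le> C * (\<Prod>j<k. phi_real (Re s / (1 + a) ^ j))"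
      unfolding C_def
    proof (rule prod_le_perturbed)
      show "\<tau> \<le> phi_real (Re s / (1 + a) ^ j)" for j
        unfolding \<tau>_def
      proof (rule phi_real_mono)
        show "0 \<le> Re s / (1 + a) ^ j" using Re[of j] by (simp only: Re_div_\<alpha>)
        have "Re s / (1 + a) ^ j \<le> norm (s / \<alpha> ^ j)" using complex_Re_le_cmod[of "s / \<alpha> ^ j"] by (simp only: Re_div_\<alpha>)
        also have "\<dots> \<le> norm s" unfolding Re_div_\<alpha> using proportion_pos by (simp add: pos_divide_le_eq mult_le_cancel_left1)
        finally show "Re s / (1 + a) ^ j \<le> R'" using sR by linarith
      qed
      show "(1 + a) * norm (J (s / \<alpha> ^ j)) \<le> phi_real (Re s / (1 + a) ^ j) + c * R' * (1 / (1 + a)) ^ j" if "N \<le> j" for j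
      proof -
        have "(1 + a) * norm (J (s / \<alpha> ^ j)) \<le> phi_real (Re (s / \<alpha> ^ j)) + c * norm (s / \<alpha> ^ j)"
          using Re N[OF s that] by (rule e(3))
        also have "c * norm (s / \<alpha> ^ j) \<le> c * R' * (1 / (1 + a)) ^ j"
          using divide_right_mono[OF mult_left_mono[OF sR e(2)], of "(1 + a) ^ j"] \<alpha>_nz
          unfolding Re_div_\<alpha> by (simp add: power_divide)
        finally show ?thesis by (simp only: Re_div_\<alpha>)
      qed
      show "(1 + a) * norm (J (s / \<alpha> ^ j)) \<le> X" for j
      proof -
        have "norm (J (s / \<alpha> ^ j)) \<le> 2 * L + L'"
          unfolding J_split by (rule phi_hs_combination_bound[OF Re L(2)[OF s] L'(2)[OF s]])
        then have "(1 + a) * norm (J (s / \<alpha> ^ j)) \<le> (1 + a) * (2 * L + L')" using \<alpha>_nz by (intro mult_left_mono) auto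
        then show ?thesis by (simp add: X_def)
      qed
    qed (use \<tau> e(2) \<alpha>_nz proportion_pos in \<open>auto simp: X_def R'_def\<close>)
    then show ?thesis by (simp add: prod.distrib prod_norm)
  qed
  moreover have "0 \<le> C" using \<tau> by (simp add: C_def X_def)
  ultimately show thesis by (rule that[rotated])
qed

text \<open>Enough whenever the function multiplied by the product stays bounded along the scaling;
  only the remainder with \<open>rho\<close> needs the finer bound.\<close>

lemma J_prod_bound_geometric:
  assumes K: "compact K" "K \<subseteq> regular"
  obtains L where "0 \<le> L" "\<And>s k. s \<in> K \<Longrightarrow> norm (J_prod k s) \<le> L * (1 / (1 + a)) ^ k"
proof -
  obtain C where C: "0 \<le> C" "\<And>s k. s \<in> K \<Longrightarrow> (1 + a) ^ k * norm (J_prod k s) \<le> C * (\<Prod>j<k. phi_real (Re s / (1 + a) ^ j))"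
    using J_prod_bound[OF K] by blast
  have "norm (J_prod k s) \<le> C * (1 / (1 + a)) ^ k" if s: "s \<in> K" for s k
  proof -
    have "0 \<le> Re s / (1 + a) ^ j" for j using s K(2) \<alpha>_nz by (auto simp: regular_def)
    then have "(\<Prod>j<k. phi_real (Re s / (1 + a) ^ j)) \<le> 1"
      using phi_real_pos phi_real_le_1 by (intro prod_le_1) (auto intro: less_imp_le)
    then have "C * (\<Prod>j<k. phi_real (Re s / (1 + a) ^ j)) \<le> C * 1" using C(1) by (intro mult_left_mono)
    then have "(1 + a) ^ k * norm (J_prod k s) \<le> C" using C(2)[OF s, of k] by linarith
    then show ?thesis using \<alpha>_nz by (simp add: power_divide pos_le_divide_eq mult.commute)
  qed
  then show thesis using C(1) by (rule that[rotated])
qed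

text \<open>
  If \<open>\<Prod>j<k. phi_real (\<sigma> / (1 + a) ^ j)\<close> tends to \<open>0\<close>, the product of the factors \<^term>\<open>J\<close> already beats the
  trivial bound on \<^term>\<open>rho\<close>; otherwise the discounted waiting times converge, so that the ruin
  probability vanishes at infinity.
\<close>

lemma series_remainder_tendsto_0:
  assumes s: "s \<in> regular"
  shows "(\<lambda>k. J_prod k s * rho (s / \<alpha> ^ k)) \<longlonglongrightarrow> 0"
proof -
  define \<sigma> where "\<sigma> = Re s"
  have \<sigma>: "0 < \<sigma>" using s by (simp add: regular_def \<sigma>_def)
  define Q where "Q k = (\<Prod>j<k. phi_real (\<sigma> / (1 + a) ^ j))" for k
  have \<sigma>j: "0 \<le> \<sigma> / (1 + a) ^ j" for j using \<sigma> \<alpha>_nz by simp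
  have Qpos: "0 < Q k" for k unfolding Q_def using \<sigma>j phi_real_pos by (intro prod_pos) auto
  have Q1: "Q k \<le> 1" for k unfolding Q_def using \<sigma>j phi_real_pos phi_real_le_1 by (intro prod_le_1) (auto intro: less_imp_le)
  have Qdec: "decseq Q"
  proof (rule decseq_SucI)
    show "Q (Suc k) \<le> Q k" for k
      using Qpos[of k] phi_real_le_1[OF \<sigma>j[of k]] by (simp add: Q_def mult_left_le)
  qed
  obtain q where q: "Q \<longlonglongrightarrow> q" "\<And>k. q \<le> Q k"
    using decseq_convergent[OF Qdec, of 0] Qpos by (metis less_imp_le)
  have q0: "0 \<le> q" by (rule LIMSEQ_le_const[OF q(1)]) (use less_imp_le[OF Qpos] in blast)
  have "{s} \<subseteq> regular" using s by simp
  then obtain C where C0: "0 \<le> C" "\<And>s' k. s' \<in> {s} \<Longrightarrow>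
      (1 + a) ^ k * norm (J_prod k s') \<le> C * (\<Prod>j<k. phi_real (Re s' / (1 + a) ^ j))"
    by (rule J_prod_bound[OF compact_sing]) (erule that, blast)
  have C: "0 \<le> C" "(1 + a) ^ k * norm (J_prod k s) \<le> C * Q k" for k
    unfolding Q_def \<sigma>_def by (rule C0(1), rule C0(2)) simp
  have Re: "0 < Re (s / \<alpha> ^ k)" for k using regular_div[OF s, of k] by (simp add: regular_def)
  have bound: "norm (J_prod k s * rho (s / \<alpha> ^ k)) \<le> C * (Q k * (norm (rho (s / \<alpha> ^ k)) / (1 + a) ^ k))" for k
  proof -
    have "norm (J_prod k s * rho (s / \<alpha> ^ k)) = ((1 + a) ^ k * norm (J_prod k s)) * (norm (rho (s / \<alpha> ^ k)) / (1 + a) ^ k)"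
      using \<alpha>_nz by (simp add: norm_mult)
    also have "\<dots> \<le> (C * Q k) * (norm (rho (s / \<alpha> ^ k)) / (1 + a) ^ k)"
      using C(2) \<alpha>_nz by (intro mult_right_mono) auto
    finally show ?thesis by (simp only: mult.assoc)
  qed
  have "(\<lambda>k. Q k * (norm (rho (s / \<alpha> ^ k)) / (1 + a) ^ k)) \<longlonglongrightarrow> 0"
  proof (cases "q = 0")
    case True
    \<comment> \<open>The trivial bound on \<open>rho\<close> uses up the geometric decay exactly;
      all further decay comes from \<open>Q\<close>.\<close>
    have "norm (rho (s / \<alpha> ^ k)) / (1 + a) ^ k \<le> 1 / \<sigma>" for k
    proof -
      have "norm (rho (s / \<alpha> ^ k)) \<le> 1 * 0 + 1 / Re (s / \<alpha> ^ k)"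
        using ruin_prob'_abs by (intro norm_laplace_bounded_le Re) auto
      then show ?thesis unfolding Re_div_\<alpha> \<sigma>_def[symmetric] using \<alpha>_nz by (simp add: pos_divide_le_eq)
    qed
    then have le: "norm (Q k * (norm (rho (s / \<alpha> ^ k)) / (1 + a) ^ k)) \<le> Q k * (1 / \<sigma>)" for k
      unfolding norm_mult using Qpos[of k] \<alpha>_nz by (intro mult_mono) auto
    have lim: "(\<lambda>k. Q k * (1 / \<sigma>)) \<longlonglongrightarrow> 0" using tendsto_mult_right[OF q(1), of "1 / \<sigma>"] True by simp
    show ?thesis by (rule Lim_null_comparison[OF always_eventually[OF allI[OF le]] lim])
  next
    case False
    then have qpos: "0 < q" using q0 by simp
    have vanish: "\<exists>X\<ge>0. \<forall>x\<ge>X. ruin_prob' x \<le> \<delta>" if \<delta>: "0 < \<delta>" for \<delta>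
    proof -
      have "(\<lambda>m. 1 - q / Q m) \<longlonglongrightarrow> 1 - q / q" using q(1) qpos by (intro tendsto_intros) auto
      then have "eventually (\<lambda>m. 1 - q / Q m < \<delta> / 2) sequentially"
        using qpos \<delta> by (intro order_tendstoD(2)[where y = "1 - q / q"]) auto
      then obtain m where m: "1 - q / Q m < \<delta> / 2" by (auto simp: eventually_sequentially)
      define r where "r = \<sigma> / (1 + a) ^ m"
      have r: "0 < r" using \<sigma> \<alpha>_nz by (simp add: r_def)
      \<comment> \<open>The product of the factors from index m on is at least q / Q m, which is
        close to 1 for large m. Starting the discounting at r = sigma / (1 + a)^m thus makes the
        tail bound small.\<close>
      have prods: "q / Q m \<le> (\<Prod>j<K. phi_real (r / (1 + a) ^ j))" for K
      proof -
        have "Q (m + K) = Q m * (\<Prod>j<K. phi_real (r / (1 + a) ^ j))"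
          unfolding Q_def r_def by (induction K) (simp_all add: power_add)
        then show ?thesis using q(2)[of "m + K"] Qpos[of m] by (simp add: pos_divide_le_eq mult.commute)
      qed
      \<comment> \<open>From ln 2 / r on, 1 - exp(-r x) is at least 1/2, so dividing by it costs
        only a factor 2.\<close>
      have "ruin_prob' x \<le> \<delta>" if x: "ln 2 / r \<le> x" for x
      proof -
        have xpos: "0 < x" using x r by (intro less_le_trans[OF _ x]) auto
        have "ln 2 \<le> r * x" using x r by (simp add: pos_divide_le_eq mult.commute)
        then have "exp (- r * x) \<le> exp (- ln 2)" by simp
        then have e: "1 / 2 \<le> 1 - exp (- r * x)" by (simp add: exp_minus)
        have "ruin_prob' x * (1 / 2) \<le> ruin_prob' x * (1 - exp (- r * x))"
          using e ruin_prob'_bounds(1) by (rule mult_left_mono)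
        also have "\<dots> \<le> 1 - q / Q m" using xpos r prods by (rule ruin_prob'_tail)
        finally show ?thesis using m by linarith
      qed
      then show ?thesis using r by (intro exI[of _ "ln 2 / r"]) auto
    qed
    have lim: "(\<lambda>k. norm (rho (s / \<alpha> ^ k)) / (1 + a) ^ k) \<longlonglongrightarrow> 0"
    proof (rule LIMSEQ_I)
      fix e :: real assume e: "0 < e"
      define \<delta> where "\<delta> = e * \<sigma> / 2"
      have "0 < \<delta>" using e \<sigma> by (simp add: \<delta>_def)
      then obtain X where X: "0 \<le> X" "\<And>x. X \<le> x \<Longrightarrow> ruin_prob' x \<le> \<delta>" using vanish by blast
      have "(\<lambda>k. X / (1 + a) ^ k) \<longlonglongrightarrow> 0"
      proof -
        have "(\<lambda>k. X * (1 / (1 + a)) ^ k) \<longlonglongrightarrow> X * 0"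
          using proportion_pos by (intro tendsto_intros LIMSEQ_realpow_zero) auto
        then show ?thesis by (simp add: power_divide)
      qed
      then have "eventually (\<lambda>k. X / (1 + a) ^ k < e / 2) sequentially"
        using e by (intro order_tendstoD(2)[where y = 0]) auto
      then obtain N where N: "\<And>k. N \<le> k \<Longrightarrow> X / (1 + a) ^ k < e / 2" by (auto simp: eventually_sequentially)
      have "norm (norm (rho (s / \<alpha> ^ k)) / (1 + a) ^ k - 0) < e" if "N \<le> k" for k
      proof -
        have "norm (rho (s / \<alpha> ^ k)) \<le> 1 * X + \<delta> / Re (s / \<alpha> ^ k)"
          using ruin_prob'_abs X ruin_prob'_bounds by (intro norm_laplace_bounded_le Re) auto
        also have "\<delta> / Re (s / \<alpha> ^ k) = e / 2 * (1 + a) ^ k"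
          unfolding Re_div_\<alpha> \<sigma>_def[symmetric] using \<sigma> \<alpha>_nz by (simp add: \<delta>_def)
        finally have "norm (rho (s / \<alpha> ^ k)) / (1 + a) ^ k \<le> X / (1 + a) ^ k + e / 2"
          using \<alpha>_nz by (simp add: pos_divide_le_eq algebra_simps)
        then have "norm (rho (s / \<alpha> ^ k)) / (1 + a) ^ k < e" using N[OF that] by linarith
        moreover have "0 \<le> norm (rho (s / \<alpha> ^ k)) / (1 + a) ^ k" using \<alpha>_nz by simp
        ultimately show ?thesis unfolding real_norm_def diff_0_right by linarith
      qed
      then show "\<exists>N. \<forall>k\<ge>N. norm (norm (rho (s / \<alpha> ^ k)) / (1 + a) ^ k - 0) < e" by blast
    qed
    have le: "norm (Q k * (norm (rho (s / \<alpha> ^ k)) / (1 + a) ^ k)) \<le> 1 * (norm (rho (s / \<alpha> ^ k)) / (1 + a) ^ k)" for k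
      unfolding norm_mult using Qpos[of k] Q1[of k] \<alpha>_nz by (intro mult_mono) auto
    show ?thesis by (rule Lim_null_comparison[OF always_eventually[OF allI[OF le[unfolded mult_1]]] lim])
  qed
  from tendsto_mult_left[OF this, of C] have "(\<lambda>k. C * (Q k * (norm (rho (s / \<alpha> ^ k)) / (1 + a) ^ k))) \<longlonglongrightarrow> 0" by simp
  then show ?thesis
    by (rule Lim_null_comparison[OF always_eventually[OF allI[OF bound]]])
qed

abbreviation "series \<equiv> series_term n \<mu> a \<theta> phi hs"

lemma series_eq: "series y z s k = J_prod k s * H_fun n \<mu> a \<theta> phi hs y z (s / \<alpha> ^ k)"
  by (simp add: series_term_def)

lemma series_sums_rho:
  assumes s: "s \<in> regular"
  shows "series p_coef q_coef s sums rho s"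
proof -
  have eq: "rho s = (\<Sum>k<K. series p_coef q_coef s k) + J_prod K s * rho (s / \<alpha> ^ K)" for K
    unfolding series_eq
  proof (rule iterate_functional_equation)
    fix k
    show "rho (s / \<alpha> ^ k) = J (s / \<alpha> ^ k) * rho (s / \<alpha> ^ Suc k) + H_fun n \<mu> a \<theta> phi hs p_coef q_coef (s / \<alpha> ^ k)"
      using regular_functional_equation[OF regular_div[OF s, of k]] by (simp add: mult.commute)
  qed
  have "(\<Sum>k<K. series p_coef q_coef s k) = rho s - J_prod K s * rho (s / \<alpha> ^ K)" for K
    unfolding eq_diff_eq by (rule eq[symmetric])
  moreover have "(\<lambda>K. rho s - J_prod K s * rho (s / \<alpha> ^ K)) \<longlonglongrightarrow> rho s - 0"
    by (intro tendsto_intros series_remainder_tendsto_0 s)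
  ultimately show ?thesis by (simp add: sums_def)
qed

lemma rho_holomorphic: "rho holomorphic_on {s. 0 < Re s}"
  using ruin_prob'_abs by (intro laplace_holomorphic laplace_integrable_bounded) auto

lemma eventually_regular: "0 < Re s \<Longrightarrow> eventually (\<lambda>w. w \<in> regular) (at s)"
proof -
  assume s: "0 < Re s"
  obtain d where d: "0 < d" "\<forall>w \<in> singular_points \<mu> a. w \<noteq> s \<longrightarrow> d \<le> dist s w"
    using singular_points_isolated by blast
  have "eventually (\<lambda>w. w \<in> ball s d \<inter> {w. 0 < Re w}) (nhds s)"
    using s d by (intro eventually_nhds_in_open open_Int open_halfspace_Re_gt) auto
  then have "eventually (\<lambda>w. w \<in> ball s d \<inter> {w. 0 < Re w}) (at s)" by (simp add: eventually_nhds_conv_at)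
  moreover have "eventually (\<lambda>w. w \<noteq> s) (at s)" by (rule eventually_neq_at_within)
  ultimately show ?thesis by eventually_elim (use d in \<open>auto simp: regular_def not_le[symmetric]\<close>)
qed

text \<open>The singular points are isolated, the sum equals \<open>rho\<close> off them, and
  \<open>rho\<close> is continuous on the half-plane. Removability is inherited from
  \<open>rho\<close>, and no cancellation of poles has to be verified.\<close>

lemma series_tendsto_rho:
  assumes s: "0 < Re s"
  shows "(\<lambda>w. \<Sum>k. series p_coef q_coef w k) \<midarrow>s\<rightarrow> rho s"
proof -
  have "isCont rho s"
    using holomorphic_on_imp_continuous_on[OF rho_holomorphic] s continuous_on_eq_continuous_at[OF open_halfspace_Re_gt]
    by blast
  then have "rho \<midarrow>s\<rightarrow> rho s" by (simp add: isCont_def)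
  moreover have "eventually (\<lambda>w. rho w = (\<Sum>k. series p_coef q_coef w k)) (at s)"
    using eventually_regular[OF s] by eventually_elim (simp add: sums_unique[OF series_sums_rho])
  ultimately show ?thesis by (rule Lim_transform_eventually)
qed

end

section \<open>Neumann series and circle coefficients\<close>

text \<open>
  For a function that is holomorphic near \<open>c\<close> this is the \<open>l\<close>-th derivative at \<open>c\<close>, but it is linear in
  \<open>F\<close> without any assumption on the behaviour of \<open>F\<close> at \<open>c\<close>.
\<close>

definition circ_coef :: "complex \<Rightarrow> real \<Rightarrow> nat \<Rightarrow> (complex \<Rightarrow> complex) \<Rightarrow> complex" where
  "circ_coef c r l F =
     fact l / (2 * of_real pi * \<i>) * contour_integral (circlepath c r) (\<lambda>u. F u / (u - c) ^ Suc l)"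

lemma circ_coef_eq_deriv:
  assumes "F holomorphic_on S" "open S" "cball c r \<subseteq> S" "0 < r"
  shows "circ_coef c r l F = (deriv ^^ l) F c"
proof -
  have "continuous_on (cball c r) F" "F holomorphic_on ball c r"
    using holomorphic_on_subset[OF assms(1) assms(3)] holomorphic_on_subset[OF assms(1) order.trans[OF ball_subset_cball assms(3)]]
    by (auto intro: holomorphic_on_imp_continuous_on)
  then have "((\<lambda>u. F u / (u - c) ^ Suc l) has_contour_integral complex_of_real (2 * pi) * \<i> / fact l * (deriv ^^ l) F c)
      (circlepath c r)"
    using assms(4) by (intro Cauchy_has_contour_integral_higher_derivative_circlepath) auto
  then show ?thesis by (simp add: circ_coef_def contour_integral_unique)
qed

lemma circ_coef_integrable:
  assumes "continuous_on (sphere c r) F" "0 < r"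
  shows "(\<lambda>u. F u / (u - c) ^ Suc l) contour_integrable_on circlepath c r"
proof (rule contour_integrable_continuous_circlepath)
  show "continuous_on (path_image (circlepath c r)) (\<lambda>u. F u / (u - c) ^ Suc l)"
    using assms by (auto intro!: continuous_intros simp: dist_norm)
qed

lemma circ_coef_cong:
  assumes "\<And>s. s \<in> sphere c r \<Longrightarrow> F s = G s" "0 < r"
  shows "circ_coef c r l F = circ_coef c r l G"
proof -
  have "contour_integral (circlepath c r) (\<lambda>u. F u / (u - c) ^ Suc l) =
      contour_integral (circlepath c r) (\<lambda>u. G u / (u - c) ^ Suc l)"
    by (rule contour_integral_eq) (use assms in auto)
  then show ?thesis by (simp only: circ_coef_def)
qed

lemma circ_coef_add:
  assumes "continuous_on (sphere c r) F" "continuous_on (sphere c r) G" "0 < r"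
  shows "circ_coef c r l (\<lambda>s. F s + x * G s) = circ_coef c r l F + x * circ_coef c r l G"
proof -
  have "contour_integral (circlepath c r) (\<lambda>u. (F u + x * G u) / (u - c) ^ Suc l) =
      contour_integral (circlepath c r) (\<lambda>u. F u / (u - c) ^ Suc l + x * (G u / (u - c) ^ Suc l))"
    by (simp only: add_divide_distrib times_divide_eq_right)
  also have "\<dots> = contour_integral (circlepath c r) (\<lambda>u. F u / (u - c) ^ Suc l)
      + x * contour_integral (circlepath c r) (\<lambda>u. G u / (u - c) ^ Suc l)"
    using contour_integral_add[OF circ_coef_integrable[OF assms(1,3)] contour_integrable_lmul[OF circ_coef_integrable[OF assms(2,3)]]]
      contour_integral_lmul[OF circ_coef_integrable[OF assms(2,3)]] by (simp only:)
  finally show ?thesis by (simp add: circ_coef_def algebra_simps del: power_Suc)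
qed

lemma circ_coef_sum:
  assumes "finite I" "\<And>i. i \<in> I \<Longrightarrow> continuous_on (sphere c r) (F i)" "0 < r"
  shows "circ_coef c r l (\<lambda>s. \<Sum>i\<in>I. x i * F i s) = (\<Sum>i\<in>I. x i * circ_coef c r l (F i))"
  using assms(1,2)
proof (induction I rule: finite_induct)
  case empty
  then show ?case by (simp add: circ_coef_def)
next
  case (insert i I)
  have "circ_coef c r l (\<lambda>s. \<Sum>i\<in>insert i I. x i * F i s) = circ_coef c r l (\<lambda>s. (\<Sum>i\<in>I. x i * F i s) + x i * F i s)"
    using insert.hyps by (simp add: add.commute)
  also have "\<dots> = circ_coef c r l (\<lambda>s. \<Sum>i\<in>I. x i * F i s) + x i * circ_coef c r l (F i)"
    using insert.prems assms(3) by (intro circ_coef_add) (auto intro!: continuous_intros)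
  finally show ?case using insert by (simp add: add.commute)
qed

lemma circ_coef_bound:
  assumes "continuous_on (sphere c r) F" "\<And>s. s \<in> sphere c r \<Longrightarrow> norm (F s) \<le> L" "0 < r"
  shows "norm (circ_coef c r l F) \<le> fact l / r ^ l * L"
proof -
  have L: "0 \<le> L"
  proof -
    have "c + of_real r \<in> sphere c r" using assms(3) by (simp add: dist_norm)
    from assms(2)[OF this] show ?thesis using order.trans[OF norm_ge_zero] by blast
  qed
  have "norm (contour_integral (circlepath c r) (\<lambda>u. F u / (u - c) ^ Suc l)) \<le> (L / r ^ Suc l) * (2 * pi * r)"
  proof (rule has_contour_integral_bound_circlepath)
    show "((\<lambda>u. F u / (u - c) ^ Suc l) has_contour_integral
        contour_integral (circlepath c r) (\<lambda>u. F u / (u - c) ^ Suc l)) (circlepath c r)"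
      using circ_coef_integrable[OF assms(1,3)] by (rule has_contour_integral_integral)
    show "norm (F x / (x - c) ^ Suc l) \<le> L / r ^ Suc l" if "norm (x - c) = r" for x
      unfolding norm_divide norm_power that
      using assms(2)[of x] that assms(3) by (intro divide_right_mono) (auto simp: dist_norm norm_minus_commute)
  qed (use L assms(3) in auto)
  from mult_left_mono[OF this, of "fact l / (2 * pi)"]
  have "norm (circ_coef c r l F) \<le> fact l / (2 * pi) * ((L / r ^ Suc l) * (2 * pi * r))"
    by (simp add: circ_coef_def norm_mult norm_divide del: power_Suc)
  also have "\<dots> = fact l / r ^ l * L" using assms(3) by (simp add: field_simps)
  finally show ?thesis .
qed

lemma circ_coef_suminf:
  assumes "\<And>k. continuous_on (sphere c r) (F k)" "\<And>k s. s \<in> sphere c r \<Longrightarrow> norm (F k s) \<le> M k" "summable M" "0 < r"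
  shows "circ_coef c r l (\<lambda>s. \<Sum>k. F k s) = (\<Sum>k. circ_coef c r l (F k))"
proof -
  define f where "f k u = F k u / (u - c) ^ Suc l" for k u
  have ul: "uniform_limit (sphere c r) (\<lambda>N u. \<Sum>k<N. f k u) (\<lambda>u. \<Sum>k. f k u) sequentially"
  proof (rule Weierstrass_m_test)
    show "norm (f k u) \<le> M k / r ^ Suc l" if "u \<in> sphere c r" for k u
    proof -
      have nu: "norm (u - c) = r" using that by (simp add: dist_norm norm_minus_commute)
      show ?thesis unfolding f_def norm_divide norm_power nu using assms(2)[OF that, of k] assms(4)
        by (intro divide_right_mono) auto
    qed
    show "summable (\<lambda>k. M k / r ^ Suc l)" using assms(3) by (rule summable_divide)
  qed
  have fi: "f k contour_integrable_on circlepath c r" for k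
    unfolding f_def[abs_def] using assms by (intro circ_coef_integrable)
  have "(\<lambda>N. contour_integral (circlepath c r) (\<lambda>u. \<Sum>k<N. f k u)) \<longlonglongrightarrow>
      contour_integral (circlepath c r) (\<lambda>u. \<Sum>k. f k u)"
    using assms(4) fi
    by (intro contour_integral_uniform_limit_circlepath(2)[OF _ ul]) (auto intro!: contour_integrable_sum always_eventually)
  then have "(\<lambda>k. contour_integral (circlepath c r) (f k)) sums contour_integral (circlepath c r) (\<lambda>u. \<Sum>k. f k u)"
    using fi by (simp add: sums_def contour_integral_sum)
  moreover have "contour_integral (circlepath c r) (\<lambda>u. \<Sum>k. f k u) =
      contour_integral (circlepath c r) (\<lambda>u. (\<Sum>k. F k u) / (u - c) ^ Suc l)"
  proof (rule contour_integral_eq)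
    fix u assume "u \<in> path_image (circlepath c r)"
    then have u: "u \<in> sphere c r" using assms(4) by simp
    have "summable (\<lambda>k. F k u)" by (rule summable_comparison_test'[OF assms(3), of 0]) (rule assms(2)[OF u])
    then show "(\<Sum>k. f k u) = (\<Sum>k. F k u) / (u - c) ^ Suc l" unfolding f_def by (rule suminf_divide)
  qed
  ultimately have "(\<lambda>k. fact l / (2 * of_real pi * \<i>) * contour_integral (circlepath c r) (f k)) sums
      (fact l / (2 * of_real pi * \<i>) * contour_integral (circlepath c r) (\<lambda>u. (\<Sum>k. F k u) / (u - c) ^ Suc l))"
    by (intro sums_mult) simp
  then have "(\<lambda>k. circ_coef c r l (F k)) sums circ_coef c r l (\<lambda>s. \<Sum>k. F k s)"
    unfolding circ_coef_def f_def[abs_def] .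
  then show ?thesis by (rule sums_unique)
qed

lemma suminf_holomorphic:
  assumes "open S" "\<And>k. F k holomorphic_on S"
    and bound: "\<And>K. compact K \<Longrightarrow> K \<subseteq> S \<Longrightarrow> \<exists>M. summable M \<and> (\<forall>k. \<forall>s\<in>K. norm (F k s) \<le> M k)"
  shows "(\<lambda>s. \<Sum>k. F k s) holomorphic_on S"
proof (rule holomorphic_uniform_sequence[OF assms(1)])
  show "(\<lambda>s. \<Sum>k<N. F k s) holomorphic_on S" for N using assms(2) by (intro holomorphic_intros)
  fix s assume "s \<in> S"
  then obtain d where d: "0 < d" "cball s d \<subseteq> S" using assms(1) by (meson open_contains_cball)
  obtain M where M: "summable M" "\<And>k w. w \<in> cball s d \<Longrightarrow> norm (F k w) \<le> M k"
    using bound[OF compact_cball d(2)] by blast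
  have "uniform_limit (cball s d) (\<lambda>N s. \<Sum>k<N. F k s) (\<lambda>s. \<Sum>k. F k s) sequentially"
    by (rule Weierstrass_m_test[OF M(2,1)])
  then show "\<exists>d>0. cball s d \<subseteq> S \<and> uniform_limit (cball s d) (\<lambda>N s. \<Sum>k<N. F k s) (\<lambda>s. \<Sum>k. F k s) sequentially"
    using d by blast
qed

context dual_risk_model
begin

section \<open>The contraction on L1 and the Neumann operator\<close>

text \<open>By Tonelli it suffices to fix (B, C): the substitution y = (1 + a) (x - B) + C has
  Jacobian 1 / (1 + a) and maps x >= B into y >= C, hence into the half-line, as C is
  positive.\<close>

lemma renewal_op_L1:
  assumes [measurable]: "g \<in> borel_measurable borel" and K: "\<And>x. \<bar>g x\<bar> \<le> K" and int: "set_integrable lborel {0..} g"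
  shows "set_integrable lborel {0..} (renewal_op g)"
    and "(LINT x:{0..}|lborel. \<bar>renewal_op g x\<bar>) \<le> (LINT x:{0..}|lborel. \<bar>g x\<bar>) / (1 + a)"
proof -
  interpret P: pair_sigma_finite law lborel ..
  define F where "F p x = (indicator {0..} x * indicator {fst p..} x) * \<bar>g ((1 + a) * (x - fst p) + snd p)\<bar>" for p x
  have Fm [measurable]: "(\<lambda>(p, x). ennreal (F p x)) \<in> borel_measurable (law \<Otimes>\<^sub>M lborel)"
  proof -
    have "(\<lambda>(p, x). F p x) = (\<lambda>q. (indicator {0..} (snd q) * indicator {q. fst (fst q) \<le> snd q} q) *
      \<bar>g ((1 + a) * (snd q - fst (fst q)) + snd (fst q))\<bar>)"
      by (auto simp: F_def indicator_def)
    then have "(\<lambda>(p, x). F p x) \<in> borel_measurable (law \<Otimes>\<^sub>M lborel)" by simp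
    then show ?thesis by (simp add: split_beta')
  qed
  define I where "I = (LINT x:{0..}|lborel. \<bar>g x\<bar>)"
  have ig: "(\<integral>\<^sup>+x. ennreal (indicator {0..} x * \<bar>g x\<bar>) \<partial>lborel) = ennreal I"
    unfolding I_def set_lebesgue_integral_def real_scaleR_def
    using set_integrable_abs[OF int] by (intro nn_integral_eq_integral) (auto simp: set_integrable_def)
  have pt: "ennreal (indicator {0..} x * \<bar>renewal_op g x\<bar>) \<le> (\<integral>\<^sup>+p. ennreal (F p x) \<partial>law)" for x
  proof -
    have "integrable law (\<lambda>p. F p x)"
    proof (rule law.integrable_const_bound[of _ K])
      show "AE p in law. norm (F p x) \<le> K" using K order.trans[OF abs_ge_zero K] by (auto simp: F_def indicator_def)
      show "(\<lambda>p. F p x) \<in> borel_measurable law"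
      proof -
        have "(\<lambda>p. F p x) = (\<lambda>p. (indicator {0..} x * indicator {p. fst p \<le> x} p) * \<bar>g ((1 + a) * (x - fst p) + snd p)\<bar>)"
          by (auto simp: F_def indicator_def)
        then show ?thesis by simp
      qed
    qed
    then have "(\<integral>\<^sup>+p. ennreal (F p x) \<partial>law) = ennreal (LINT p|law. F p x)"
      by (intro nn_integral_eq_integral) (auto simp: F_def)
    moreover have "indicator {0..} x * \<bar>renewal_op g x\<bar> \<le> (LINT p|law. F p x)"
    proof (cases "0 \<le> x")
      case True
      have "\<bar>renewal_op g x\<bar> \<le> (LINT p|law. \<bar>if x < fst p then 0 else g ((1 + a) * (x - fst p) + snd p)\<bar>)"
        unfolding renewal_op_def by (rule integral_abs_bound)
      also have "\<dots> = (LINT p|law. F p x)"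
        using True by (intro Bochner_Integration.integral_cong) (auto simp: F_def indicator_def)
      finally show ?thesis using True by simp
    qed (simp add: F_def integral_nonneg)
    ultimately show ?thesis by (simp add: ennreal_leI)
  qed
  have inner: "AE p in law. (\<integral>\<^sup>+x. ennreal (F p x) \<partial>lborel) \<le> ennreal (I / (1 + a))"
    using AE_law_pos
  proof eventually_elim
    case (elim p)
    have [measurable]: "(\<lambda>x. ennreal (F p x)) \<in> borel_measurable borel"
      using measurable_Pair2[OF Fm, of p] by simp
    have "(\<integral>\<^sup>+x. ennreal (F p x) \<partial>lborel) = ennreal \<bar>1 / (1 + a)\<bar> * (\<integral>\<^sup>+y. ennreal (F p ((fst p - snd p / (1 + a)) + 1 / (1 + a) * y)) \<partial>lborel)"
      by (rule nn_integral_real_affine) (use proportion_pos in auto)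
    also have "\<dots> \<le> ennreal \<bar>1 / (1 + a)\<bar> * (\<integral>\<^sup>+y. ennreal (indicator {0..} y * \<bar>g y\<bar>) \<partial>lborel)"
    proof (intro mult_left_mono nn_integral_mono ennreal_leI)
      fix y
      have e: "(1 + a) * ((fst p - snd p / (1 + a)) + 1 / (1 + a) * y - fst p) + snd p = y"
      proof -
        have "(fst p - snd p / (1 + a)) + 1 / (1 + a) * y - fst p = (y - snd p) / (1 + a)" by (simp add: diff_divide_distrib)
        then show ?thesis using proportion_pos by simp
      qed
      have "indicator {fst p..} ((fst p - snd p / (1 + a)) + 1 / (1 + a) * y) \<le> (indicator {0..} y :: real)"
      proof (cases "0 \<le> y")
        case False
        then have "1 / (1 + a) * y < 0" using proportion_pos by (intro mult_pos_neg) auto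
        moreover have "0 < snd p / (1 + a)" using elim proportion_pos by simp
        ultimately show ?thesis by (simp add: indicator_def)
      qed (auto simp: indicator_def)
      then show "F p ((fst p - snd p / (1 + a)) + 1 / (1 + a) * y) \<le> indicator {0..} y * \<bar>g y\<bar>"
        unfolding F_def e by (intro mult_right_mono) (auto simp: indicator_def split: if_splits)
    qed auto
    also have "\<dots> = ennreal (I / (1 + a))"
      unfolding ig using proportion_pos by (simp add: ennreal_mult'[symmetric])
    finally show ?case .
  qed
  have "(\<integral>\<^sup>+x. ennreal (indicator {0..} x * \<bar>renewal_op g x\<bar>) \<partial>lborel) \<le> (\<integral>\<^sup>+x. \<integral>\<^sup>+p. ennreal (F p x) \<partial>law \<partial>lborel)"
    by (intro nn_integral_mono pt)
  also have "\<dots> = (\<integral>\<^sup>+p. \<integral>\<^sup>+x. ennreal (F p x) \<partial>lborel \<partial>law)"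
    using P.Fubini[OF Fm] by simp
  also have "\<dots> \<le> (\<integral>\<^sup>+p. ennreal (I / (1 + a)) \<partial>law)" by (intro nn_integral_mono_AE inner)
  also have "\<dots> = ennreal (I / (1 + a))" using law.emeasure_space_1 by simp
  finally have le: "(\<integral>\<^sup>+x. ennreal (indicator {0..} x * \<bar>renewal_op g x\<bar>) \<partial>lborel) \<le> ennreal (I / (1 + a))" .
  have I0: "0 \<le> I" unfolding I_def set_lebesgue_integral_def by (intro Bochner_Integration.integral_nonneg) auto
  have i2: "integrable lborel (\<lambda>x. indicator {0..} x * \<bar>renewal_op g x\<bar>)"
  proof (rule integrableI_nonneg)
    show "(\<integral>\<^sup>+x. ennreal (indicator {0..} x * \<bar>renewal_op g x\<bar>) \<partial>lborel) < \<infinity>"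
      using le_less_trans[OF le ennreal_less_top] by simp
  qed auto
  then show "set_integrable lborel {0..} (renewal_op g)"
    unfolding set_integrable_def
    by (rule Bochner_Integration.integrable_bound) (auto simp: abs_mult)
  have "ennreal (LINT x|lborel. indicator {0..} x * \<bar>renewal_op g x\<bar>) \<le> ennreal (I / (1 + a))"
    using le i2 by (subst nn_integral_eq_integral[symmetric]) auto
  then show "(LINT x:{0..}|lborel. \<bar>renewal_op g x\<bar>) \<le> (LINT x:{0..}|lborel. \<bar>g x\<bar>) / (1 + a)"
    using I0 proportion_pos by (subst (asm) ennreal_le_iff) (auto simp: set_lebesgue_integral_def I_def)
qed

lemma phi_holomorphic: "phi holomorphic_on {s. 0 < Re s}"
proof -
  have "laplace_integrable f\<^sub>B"
  proof (intro laplace_integrable_integrable)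
    have "integrable lborel f\<^sub>B"
      using distributed_integrable[OF interarrival[of 0], of "\<lambda>_. 1"] density_nonneg by simp
    then show "set_integrable lborel {0..} f\<^sub>B"
      unfolding set_integrable_def by (intro integrable_mult_indicator) auto
  qed auto
  then have "laplace f\<^sub>B holomorphic_on {s. 0 < Re s}" by (rule laplace_holomorphic)
  moreover have "laplace f\<^sub>B s = phi s" for s
  proof -
    have "phi s = (LINT x|density lborel (\<lambda>t. ennreal (f\<^sub>B t)). exp_B s x)"
      unfolding integral_exp_B_law[symmetric] distr_B ..
    also have "\<dots> = (LINT x|lborel. f\<^sub>B x *\<^sub>R exp_B s x)"
      using density_nonneg by (subst integral_density) auto
    also have "\<dots> = laplace f\<^sub>B s"
      unfolding laplace_def set_lebesgue_integral_def
      by (intro Bochner_Integration.integral_cong) (auto simp: exp_B_def indicator_def scaleR_conv_of_real)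
    finally show ?thesis by simp
  qed
  ultimately show ?thesis by (metis ext)
qed

lemma hs_holomorphic: "hs holomorphic_on {s. 0 < Re s}"
proof (rule laplace_holomorphic, rule laplace_integrable_integrable)
  have i: "integrable lborel f\<^sub>B"
    using distributed_integrable[OF interarrival[of 0], of "\<lambda>_. 1"] density_nonneg by simp
  show "set_integrable lborel {0..} h"
    unfolding set_integrable_def
  proof (rule Bochner_Integration.integrable_bound[OF i])
    have "\<bar>1 - 2 * cdf lawB x\<bar> \<le> 1" for x
      using cdf_abs_le_1[of x] by (auto simp: cdf_def abs_le_iff)
    then have "norm (indicator {0..} x *\<^sub>R h x) \<le> norm (f\<^sub>B x)" for x
      using mult_left_mono[of "\<bar>1 - 2 * cdf lawB x\<bar>" 1 "\<bar>f\<^sub>B x\<bar>"] by (auto simp: indicator_def abs_mult)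
    then show "AE x in lborel. norm (indicator {0..} x *\<^sub>R h x) \<le> norm (f\<^sub>B x)" by simp
  qed measurable
qed measurable

lemma J_holomorphic: "J holomorphic_on regular"
  and H_hom_holomorphic: "H_hom y z holomorphic_on regular"
proof -
  have sub: "regular \<subseteq> {s. 0 < Re s}" by (auto simp: regular_def)
  note [holomorphic_intros] = holomorphic_on_subset[OF phi_holomorphic sub] holomorphic_on_subset[OF hs_holomorphic sub]
    holomorphic_on_subset[OF rational_holomorphic(1) regular_no_pole] holomorphic_on_subset[OF rational_holomorphic(2) regular_no_pole]
    holomorphic_on_subset[OF rational_holomorphic(3) regular_no_pole] holomorphic_on_subset[OF rational_holomorphic(4) regular_no_pole]
  show "J holomorphic_on regular" unfolding J_split[abs_def] by (intro holomorphic_intros)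
  show "H_hom y z holomorphic_on regular" unfolding H_hom_split[abs_def] by (intro holomorphic_intros)
qed

text \<open>The right-hand sides for which the geometric decay of the products is sufficient.
  \<open>H_hom\<close> and transforms of integrable functions belong here; (1 - phi s) / s and
  \<open>rho\<close> may be unbounded near 0, so the series is compared with \<open>rho\<close>
  instead of being summed by this criterion.\<close>

definition scaling_bounded :: "(complex \<Rightarrow> complex) \<Rightarrow> bool" where
  "scaling_bounded F \<longleftrightarrow> F holomorphic_on regular \<and>
     (\<forall>K. compact K \<longrightarrow> K \<subseteq> regular \<longrightarrow> (\<exists>L. \<forall>s\<in>K. \<forall>k. norm (F (s / \<alpha> ^ k)) \<le> L))"

text \<open>Solves G(s) = F(s) + J(s) G(s / alpha) by iteration; see
  \<open>neumann_step\<close>.\<close>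

definition neumann :: "(complex \<Rightarrow> complex) \<Rightarrow> complex \<Rightarrow> complex" where
  "neumann F s = (\<Sum>k. J_prod k s * F (s / \<alpha> ^ k))"

lemma scaling_bounded_H_hom: "scaling_bounded (H_hom y z)"
  unfolding scaling_bounded_def
proof (intro conjI allI impI H_hom_holomorphic)
  fix K assume K: "compact K" "K \<subseteq> regular"
  obtain L where L: "\<And>s k. s \<in> K \<Longrightarrow> norm (HA y (s / \<alpha> ^ k)) \<le> L"
    using bounded_along_scaling[OF K rational_holomorphic(3)] by blast
  obtain L' where L': "\<And>s k. s \<in> K \<Longrightarrow> norm (HB z (s / \<alpha> ^ k)) \<le> L'"
    using bounded_along_scaling[OF K rational_holomorphic(4)] by blast
  have "norm (H_hom y z (s / \<alpha> ^ k)) \<le> 2 * L + L'" if s: "s \<in> K" for s k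
  proof -
    have "0 \<le> Re (s / \<alpha> ^ k)" using regular_div[of s k] s K(2) by (auto simp: regular_def)
    then show ?thesis unfolding H_hom_split by (rule phi_hs_combination_bound[OF _ L[OF s] L'[OF s]])
  qed
  then show "\<exists>L. \<forall>s\<in>K. \<forall>k. norm (H_hom y z (s / \<alpha> ^ k)) \<le> L" by blast
qed

lemma scaling_bounded_bounded:
  assumes "F holomorphic_on {s. 0 < Re s}" "\<And>s. 0 < Re s \<Longrightarrow> norm (F s) \<le> L"
  shows "scaling_bounded F"
  unfolding scaling_bounded_def
proof (intro conjI allI impI)
  show "F holomorphic_on regular" using assms(1) by (rule holomorphic_on_subset) (auto simp: regular_def)
  fix K assume K: "K \<subseteq> regular"
  have "norm (F (s / \<alpha> ^ k)) \<le> L" if "s \<in> K" for s k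
  proof (rule assms(2))
    show "0 < Re (s / \<alpha> ^ k)" using regular_div[OF subsetD[OF K that], of k] by (simp add: regular_def)
  qed
  then show "\<exists>L. \<forall>s\<in>K. \<forall>k. norm (F (s / \<alpha> ^ k)) \<le> L" by (intro exI[of _ L] ballI allI)
qed

lemma neumann_term_bound:
  assumes "scaling_bounded F" and K: "compact K" "K \<subseteq> regular"
  shows "\<exists>L\<ge>0. \<forall>k. \<forall>s\<in>K. norm (J_prod k s * F (s / \<alpha> ^ k)) \<le> L * (1 / (1 + a)) ^ k"
proof -
  have "\<exists>L. \<forall>s\<in>K. \<forall>k. norm (F (s / \<alpha> ^ k)) \<le> L"
    using assms(1) K by (simp add: scaling_bounded_def)
  then obtain L0 where "\<forall>s\<in>K. \<forall>k. norm (F (s / \<alpha> ^ k)) \<le> L0" ..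
  then have L0: "\<And>s k. s \<in> K \<Longrightarrow> norm (F (s / \<alpha> ^ k)) \<le> L0" by simp
  obtain L where L: "0 \<le> L" "\<And>s k. s \<in> K \<Longrightarrow> norm (J_prod k s) \<le> L * (1 / (1 + a)) ^ k"
    by (rule J_prod_bound_geometric[OF K]) (erule that, blast)
  have "norm (J_prod k s * F (s / \<alpha> ^ k)) \<le> (L * max L0 0) * (1 / (1 + a)) ^ k" if "s \<in> K" for k s
  proof -
    have "norm (J_prod k s) * norm (F (s / \<alpha> ^ k)) \<le> (L * (1 / (1 + a)) ^ k) * max L0 0"
      using L(2)[OF that, of k] L0[OF that, of k] L(1) proportion_pos by (intro mult_mono) auto
    then show ?thesis by (simp add: norm_mult mult_ac)
  qed
  then show ?thesis using L(1) by (intro exI[of _ "L * max L0 0"]) auto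
qed

lemma summable_inverse_power: "summable (\<lambda>k. L * (1 / (1 + a)) ^ k)"
  using proportion_pos by (intro summable_mult summable_geometric) auto

lemma neumann_summable:
  assumes "scaling_bounded F" "s \<in> regular"
  shows "summable (\<lambda>k. J_prod k s * F (s / \<alpha> ^ k))"
proof -
  have "{s} \<subseteq> regular" using assms(2) by simp
  then obtain L where L: "\<forall>k. \<forall>s\<in>{s}. norm (J_prod k s * F (s / \<alpha> ^ k)) \<le> L * (1 / (1 + a)) ^ k"
    using neumann_term_bound[OF assms(1) compact_sing] by blast
  show ?thesis
    by (rule summable_comparison_test'[OF summable_inverse_power[of L], of 0]) (use L in simp)
qed

lemma J_prod_holomorphic: "J_prod k holomorphic_on regular"
proof -
  have "(\<lambda>s. J (s / \<alpha> ^ j)) holomorphic_on regular" for j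
  proof -
    have "J \<circ> (\<lambda>s. s / \<alpha> ^ j) holomorphic_on regular"
      using \<alpha>_nz regular_div
      by (intro holomorphic_on_compose holomorphic_intros holomorphic_on_subset[OF J_holomorphic]) auto
    then show ?thesis by (simp add: o_def)
  qed
  then show ?thesis by (intro holomorphic_intros)
qed

lemma neumann_holomorphic:
  assumes "scaling_bounded F"
  shows "neumann F holomorphic_on regular"
  unfolding neumann_def[abs_def]
proof (rule suminf_holomorphic[OF open_regular])
  show "(\<lambda>s. J_prod k s * F (s / \<alpha> ^ k)) holomorphic_on regular" for k
  proof -
    have "F holomorphic_on regular" using assms by (simp add: scaling_bounded_def)
    then have "F \<circ> (\<lambda>s. s / \<alpha> ^ k) holomorphic_on regular"
      using \<alpha>_nz regular_div by (intro holomorphic_on_compose holomorphic_intros) (auto intro: holomorphic_on_subset)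
    then have "(\<lambda>s. F (s / \<alpha> ^ k)) holomorphic_on regular" by (simp add: o_def)
    then show ?thesis by (rule holomorphic_on_mult[OF J_prod_holomorphic])
  qed
  fix K assume "compact K" "K \<subseteq> regular"
  then obtain L where "\<forall>k. \<forall>s\<in>K. norm (J_prod k s * F (s / \<alpha> ^ k)) \<le> L * (1 / (1 + a)) ^ k"
    using neumann_term_bound[OF assms] by blast
  then show "\<exists>M. summable M \<and> (\<forall>k. \<forall>s\<in>K. norm (J_prod k s * F (s / \<alpha> ^ k)) \<le> M k)"
    using summable_inverse_power[of L] by blast
qed

lemma neumann_step:
  assumes "scaling_bounded F" "s \<in> regular"
  shows "neumann F s = F s + J s * neumann F (s / \<alpha>)"
proof -
  have sm: "summable (\<lambda>k. J_prod k (s / \<alpha>) * F (s / \<alpha> / \<alpha> ^ k))"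
    using regular_div[OF assms(2), of 1] by (intro neumann_summable assms(1)) simp
  have "J_prod (Suc k) s * F (s / \<alpha> ^ Suc k) = J s * (J_prod k (s / \<alpha>) * F (s / \<alpha> / \<alpha> ^ k))" for k
    by (subst prod.lessThan_Suc_shift) (simp add: mult.assoc divide_divide_eq_left)
  then have "(\<Sum>k. J_prod (Suc k) s * F (s / \<alpha> ^ Suc k)) = J s * neumann F (s / \<alpha>)"
    unfolding neumann_def using suminf_mult[OF sm, of "J s"] by (simp only:)
  moreover have "neumann F s = (\<Sum>k. J_prod (Suc k) s * F (s / \<alpha> ^ Suc k)) + J_prod 0 s * F (s / \<alpha> ^ 0)"
    unfolding neumann_def using suminf_split_head[OF neumann_summable[OF assms]] by simp
  ultimately show ?thesis by simp
qed

end

section \<open>Limits at the removable singularities\<close>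

text \<open>The quotient is the power series of \<open>f\<close> with its first m coefficients
  dropped and the rest shifted, hence holomorphic at \<open>c\<close> too.\<close>

lemma taylor_remainder_limit:
  fixes f :: "complex \<Rightarrow> complex"
  assumes "f holomorphic_on ball c r" "0 < r"
  shows "\<exists>L. (\<lambda>w. (f w - (\<Sum>l<m. (deriv ^^ l) f c / fact l * (w - c) ^ l)) / (w - c) ^ m) \<midarrow>c\<rightarrow> L"
proof -
  define b where "b l = (deriv ^^ l) f c / fact l" for l
  define R where "R w = (f w - (\<Sum>l<m. b l * (w - c) ^ l)) / (w - c) ^ m" for w
  define g where "g w = (if w = c then b m else R w)" for w
  have "(\<lambda>l. b (l + m) * (w - c) ^ l) sums g w" if w: "w \<in> ball c r" for w
  proof (cases "w = c")
    case True
    then show ?thesis using powser_sums_zero[of "\<lambda>l. b (l + m)"] by (simp add: g_def)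
  next
    case False
    have "(\<lambda>l. b l * (w - c) ^ l) sums f w"
      unfolding b_def by (rule holomorphic_power_series[OF assms(1) w])
    then have "(\<lambda>l. b (l + m) * (w - c) ^ (l + m)) sums (f w - (\<Sum>l<m. b l * (w - c) ^ l))"
      by (rule sums_split_initial_segment)
    then have "(\<lambda>l. b (l + m) * (w - c) ^ (l + m) / (w - c) ^ m) sums R w"
      unfolding R_def by (rule sums_divide)
    then show ?thesis using False by (simp add: g_def power_add)
  qed
  then have "g holomorphic_on ball c r" by (rule power_series_holomorphic)
  then have "isCont g c"
    using assms(2) holomorphic_on_imp_continuous_on continuous_on_eq_continuous_at[OF open_ball] centre_in_ball by blast
  then have "g \<midarrow>c\<rightarrow> g c" by (simp add: isCont_def)
  moreover have "eventually (\<lambda>w. g w = R w) (at c)"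
    using eventually_neq_at_within[of c] by eventually_elim (simp add: g_def)
  ultimately have "R \<midarrow>c\<rightarrow> g c" by (rule Lim_transform_eventually)
  then show ?thesis unfolding R_def[abs_def] b_def by blast
qed

context dual_risk_model
begin

lemma HA_cong: "(\<And>l. l \<le> n - 1 \<Longrightarrow> y l = y' l) \<Longrightarrow> HA y s = HA y' s"
  unfolding HA_def by (intro arg_cong2[where f = times] refl sum.cong) auto

lemma HB_cong: "(\<And>l. l \<le> 2 * n - 2 \<Longrightarrow> z l = z' l) \<Longrightarrow> HB z s = HB z' s"
  unfolding HB_def by (intro arg_cong2[where f = times] refl sum.cong) auto

lemma H_hom_cong:
  "(\<And>l. l \<le> n - 1 \<Longrightarrow> y l = y' l) \<Longrightarrow> (\<And>l. l \<le> 2 * n - 2 \<Longrightarrow> z l = z' l) \<Longrightarrow> H_hom y z s = H_hom y' z' s"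
  using HA_cong[of y y' s] HB_cong[of z z' s] by (simp add: H_hom_split)

lemma HA_linear: "HA (\<lambda>l. y l + x * y' l) s = HA y s + x * HA y' s"
  unfolding HA_def
  by (simp only: distrib_left distrib_right add_divide_distrib sum.distrib sum_distrib_left mult_ac times_divide_eq_right times_divide_eq_left)

lemma HB_linear: "HB (\<lambda>l. z l + x * z' l) s = HB z s + x * HB z' s"
  unfolding HB_def
  by (simp only: distrib_left distrib_right add_divide_distrib sum.distrib sum_distrib_left mult_ac times_divide_eq_right times_divide_eq_left)

lemma H_hom_linear:
  "H_hom (\<lambda>l. y l + x * y' l) (\<lambda>l. z l + x * z' l) s = H_hom y z s + x * H_hom y' z' s"
  unfolding H_hom_split HA_linear HB_linear by (simp add: algebra_simps)

lemma H_hom_zero: "H_hom (\<lambda>_. 0) (\<lambda>_. 0) s = 0"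
  by (simp add: H_hom_split HA_def HB_def)

lemma H_fun_eq: "H_fun n \<mu> a \<theta> phi hs y z s = (1 - phi s) / s + H_hom y z s"
  by (simp add: H_hom_def)

section \<open>The series for arbitrary coefficients\<close>

definition sigma :: "(nat \<Rightarrow> complex) \<Rightarrow> (nat \<Rightarrow> complex) \<Rightarrow> complex \<Rightarrow> complex" where
  "sigma y z s = (\<Sum>k. series y z s k)"

text \<open>\<open>H_fun\<close> is affine in the unknowns, so changing the coefficients adds
  \<open>neumann\<close> of a linear term to the series for \<open>rho\<close>. Convergence for
  every candidate follows from the case already settled.\<close>

lemma sigma_eq:
  assumes "s \<in> regular"
  shows "sigma y z s = rho s + neumann (H_hom (\<lambda>l. y l - p_coef l) (\<lambda>l. z l - q_coef l)) s"
proof -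
  let ?H = "H_hom (\<lambda>l. y l - p_coef l) (\<lambda>l. z l - q_coef l)"
  have H_hom: "H_hom y z w = H_hom p_coef q_coef w + ?H w" for w
    using H_hom_linear[of p_coef 1 "\<lambda>l. y l - p_coef l" q_coef "\<lambda>l. z l - q_coef l" w] by simp
  have H: "H_fun n \<mu> a \<theta> phi hs y z w = H_fun n \<mu> a \<theta> phi hs p_coef q_coef w + ?H w" for w
    unfolding H_fun_eq H_hom by (rule add.assoc[symmetric])
  have eq: "series y z s = (\<lambda>k. series p_coef q_coef s k + J_prod k s * ?H (s / \<alpha> ^ k))"
    by (rule ext) (simp only: series_eq H distrib_left)
  have "(\<lambda>k. series p_coef q_coef s k + J_prod k s * ?H (s / \<alpha> ^ k)) sums (rho s + neumann ?H s)"
    unfolding neumann_def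
    by (intro sums_add series_sums_rho assms summable_sums neumann_summable scaling_bounded_H_hom)
  then show ?thesis unfolding sigma_def eq by (rule sums_unique[symmetric])
qed

lemma regular_pos: "regular \<subseteq> {s. 0 < Re s}"
  by (auto simp: regular_def)

lemma sigma_holomorphic: "sigma y z holomorphic_on regular"
proof -
  have "(\<lambda>s. rho s + neumann (H_hom (\<lambda>l. y l - p_coef l) (\<lambda>l. z l - q_coef l)) s) holomorphic_on regular"
    by (intro holomorphic_intros holomorphic_on_subset[OF rho_holomorphic regular_pos] neumann_holomorphic scaling_bounded_H_hom)
  then show ?thesis by (rule holomorphic_transform) (simp add: sigma_eq)
qed

lemma sigma_functional_equation:
  assumes s: "s \<in> regular"
  shows "sigma y z s = J s * sigma y z (s / \<alpha>) + H_fun n \<mu> a \<theta> phi hs y z s"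
proof -
  let ?H = "H_hom (\<lambda>l. y l - p_coef l) (\<lambda>l. z l - q_coef l)"
  have s': "s / \<alpha> \<in> regular" using regular_div[OF s, of 1] by simp
  have H_hom: "H_hom y z s = H_hom p_coef q_coef s + ?H s"
    using H_hom_linear[of p_coef 1 "\<lambda>l. y l - p_coef l" q_coef "\<lambda>l. z l - q_coef l" s] by simp
  have H: "H_fun n \<mu> a \<theta> phi hs y z s = H_fun n \<mu> a \<theta> phi hs p_coef q_coef s + ?H s"
    unfolding H_fun_eq H_hom by (rule add.assoc[symmetric])
  show ?thesis
    unfolding sigma_eq[OF s] sigma_eq[OF s'] H regular_functional_equation[OF s] neumann_step[OF scaling_bounded_H_hom s]
    by (simp add: algebra_simps)
qed

text \<open>Circles of radius r around mu and 2 mu stay in the half-plane and have no singular point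
  in or on them except perhaps the centre. The bounds by mu and mu a also keep the circle around mu,
  and every circle divided by 1 + a, well inside the disc of radius 2 mu or v respectively, which
  the separation of jets exploits.\<close>

definition good_radius :: "real \<Rightarrow> bool" where
  "good_radius r \<longleftrightarrow> 0 < r \<and> 2 * r \<le> \<mu> \<and> 2 * r \<le> \<mu> * a \<and>
     (\<forall>v\<in>{\<mu>, 2 * \<mu>}. ball (of_real v) (2 * r) - {of_real v} \<subseteq> regular)"

lemma good_radius_exists: "\<exists>r. good_radius r"
proof -
  obtain d1 where d1: "0 < d1" "\<forall>w \<in> singular_points \<mu> a. w \<noteq> of_real \<mu> \<longrightarrow> d1 \<le> dist (of_real \<mu>) w"
    using singular_points_isolated by blast
  obtain d2 where d2: "0 < d2" "\<forall>w \<in> singular_points \<mu> a. w \<noteq> of_real (2 * \<mu>) \<longrightarrow> d2 \<le> dist (of_real (2 * \<mu>)) w"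
    using singular_points_isolated by blast
  define r where "r = Min {d1, d2, \<mu>, \<mu> * a} / 2"
  have r: "0 < r" "2 * r \<le> \<mu>" "2 * r \<le> \<mu> * a" "2 * r \<le> d1" "2 * r \<le> d2"
    using d1(1) d2(1) rate_pos proportion_pos by (auto simp: r_def)
  have "ball (complex_of_real v) (2 * r) - {of_real v} \<subseteq> regular" if v: "v \<in> {\<mu>, 2 * \<mu>}" for v
  proof
    fix w assume w: "w \<in> ball (complex_of_real v) (2 * r) - {of_real v}"
    have "\<bar>Re (of_real v - w)\<bar> < 2 * r"
      using w abs_Re_le_cmod[of "of_real v - w"] by (simp add: dist_norm)
    then have "0 < Re w" using r(2) v rate_pos by auto
    moreover have "w \<notin> singular_points \<mu> a"
      using w d1(2) d2(2) r(4,5) v by force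
    ultimately show "w \<in> regular" by (simp add: regular_def)
  qed
  then show ?thesis using r unfolding good_radius_def by blast
qed

lemma mu_regular: "of_real \<mu> \<in> regular"
proof -
  have "of_real \<mu> \<notin> singular_points \<mu> a"
  proof
    assume "of_real \<mu> \<in> singular_points \<mu> a"
    then obtain v j where vj: "v \<in> {\<mu>, 2 * \<mu>}" "complex_of_real \<mu> = of_real (v * (1 + a) ^ (j + 1))" by (rule singular_pointsE)
    have "\<mu> * 1 < v * (1 + a) ^ (j + 1)"
      using vj(1) rate_pos one_less_power[of "1 + a" "j + 1"] proportion_pos by (intro mult_le_less_imp_less) auto
    then show False using vj(2) unfolding of_real_eq_iff by simp
  qed
  then show ?thesis using rate_pos by (simp add: regular_def)
qed

lemma sphere_regular:
  assumes "good_radius r" "v \<in> {\<mu>, 2 * \<mu>}"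
  shows "sphere (of_real v) r \<subseteq> regular"
proof -
  have "sphere (of_real v) r \<subseteq> ball (of_real v) (2 * r) - {of_real v}"
    using assms(1) by (auto simp: good_radius_def)
  then show ?thesis using assms by (auto simp: good_radius_def)
qed

text \<open>The contour coefficient sees only the circle, where removing the singularity at the
  centre changes nothing. The existence of the limit makes it equal to the derivative.\<close>

lemma deriv_remove_sings_sigma:
  assumes r: "good_radius r" and v: "v \<in> {\<mu>, 2 * \<mu>}" and lim: "sigma y z \<midarrow>of_real v\<rightarrow> L"
  shows "(deriv ^^ l) (remove_sings (sigma y z)) (of_real v) = circ_coef (of_real v) r l (sigma y z)"
proof -
  let ?c = "complex_of_real v"
  let ?U = "ball ?c (2 * r)"
  have r0: "0 < r" and U: "?U - {?c} \<subseteq> regular" using r v by (auto simp: good_radius_def)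
  define g where "g s = (if s = ?c then L else sigma y z s)" for s
  have g: "g holomorphic_on ?U"
    unfolding g_def[abs_def]
    by (rule removable_singularity[OF holomorphic_on_subset[OF sigma_holomorphic U] open_ball lim])
  have eq: "remove_sings (sigma y z) s = g s" if s: "s \<in> ?U" for s
  proof (cases "s = ?c")
    case True
    then show ?thesis using lim by (auto simp: g_def intro: remove_sings_eqI)
  next
    case False
    then have "s \<in> regular" using U s by auto
    then have "sigma y z analytic_on {s}"
      using sigma_holomorphic open_regular by (meson analytic_at)
    then show ?thesis using False by (simp add: g_def)
  qed
  have "eventually (\<lambda>s. s \<in> ?U) (nhds ?c)" using r0 by (intro eventually_nhds_in_open) auto
  then have "eventually (\<lambda>s. remove_sings (sigma y z) s = g s) (nhds ?c)" by eventually_elim (rule eq)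
  then have "(deriv ^^ l) (remove_sings (sigma y z)) ?c = (deriv ^^ l) g ?c" by (intro higher_deriv_cong_ev) auto
  also have "\<dots> = circ_coef ?c r l g"
    using r0 by (intro circ_coef_eq_deriv[OF g, symmetric]) auto
  also have "\<dots> = circ_coef ?c r l (sigma y z)"
    using r0 by (intro circ_coef_cong) (auto simp: g_def)
  finally show ?thesis .
qed

lemma tendsto_scaled:
  assumes "f \<midarrow>s0 / \<alpha>\<rightarrow> L"
  shows "(\<lambda>s. f (s / \<alpha>)) \<midarrow>s0\<rightarrow> L"
proof (rule filterlim_compose[OF assms])
  show "filterlim (\<lambda>s. s / \<alpha>) (at (s0 / \<alpha>)) (at s0)"
  proof (rule filterlim_atI)
    show "((\<lambda>s. s / \<alpha>) \<longlongrightarrow> s0 / \<alpha>) (at s0)" using \<alpha>_nz(1) by (intro tendsto_intros)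
    show "eventually (\<lambda>s. s / \<alpha> \<noteq> s0 / \<alpha>) (at s0)"
      using eventually_neq_at_within[of s0] by eventually_elim (use \<alpha>_nz(1) in simp)
  qed
qed

lemma isCont_phi: "0 < Re s \<Longrightarrow> isCont phi s" and isCont_hs: "0 < Re s \<Longrightarrow> isCont hs s"
  using holomorphic_on_imp_continuous_on[OF phi_holomorphic] holomorphic_on_imp_continuous_on[OF hs_holomorphic]
  by (simp_all add: continuous_on_eq_continuous_at[OF open_halfspace_Re_gt])

lemma isCont_J:
  assumes "0 < Re s" "s \<in> no_pole"
  shows "isCont J s" "isCont (H_fun n \<mu> a \<theta> phi hs y z) s"
proof -
  have op: "open no_pole" by (simp add: open_Compl)
  have c: "isCont JA s" "isCont JB s" "isCont (HA y) s" "isCont (HB z) s"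
    using rational_holomorphic[THEN holomorphic_on_imp_continuous_on] assms(2)
    by (simp_all only: continuous_on_eq_continuous_at[OF op])
  show "isCont J s" unfolding J_split[abs_def] using assms(1) c isCont_phi isCont_hs by (intro continuous_intros) auto
  have "H_fun n \<mu> a \<theta> phi hs y z = (\<lambda>s. (1 - phi s) / s + ((phi s - \<theta> * hs s) * HA y s + hs s * HB z s))"
    by (rule ext) (simp add: H_hom_split[symmetric] H_hom_def)
  moreover have "isCont (\<lambda>s. (1 - phi s) / s + ((phi s - \<theta> * hs s) * HA y s + hs s * HB z s)) s"
    using assms(1) c isCont_phi isCont_hs by (intro continuous_intros) auto
  ultimately show "isCont (H_fun n \<mu> a \<theta> phi hs y z) s" by (simp only:)
qed

text \<open>Unlike \<open>isCont_J\<close> this covers mu alpha, where only \<open>JA\<close> and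
  \<open>HA\<close> have a pole.\<close>

lemma isCont_B:
  assumes "s \<noteq> 2 * of_real \<mu> * \<alpha>"
  shows "isCont JB s" "isCont (HB z) s"
  unfolding JB_def[abs_def] HB_def[abs_def] using assms \<alpha>_nz(1) by (auto intro!: continuous_intros)

lemma eventually_sigma_equation:
  "0 < Re s0 \<Longrightarrow> eventually (\<lambda>s. J s * sigma y z (s / \<alpha>) + H_fun n \<mu> a \<theta> phi hs y z s = sigma y z s) (at s0)"
  using eventually_regular[of s0] by (auto elim!: eventually_mono simp: sigma_functional_equation)

text \<open>The equations at \<open>\<mu>\<close> say that the Taylor polynomial in \<^term>\<open>HA\<close> cancels the pole of \<^term>\<open>JA\<close>.\<close>

lemma sigma_limit_first_pole:
  assumes y: "\<And>l. l \<le> n - 1 \<Longrightarrow> y l = (deriv ^^ l) (sigma y z) (of_real \<mu>)"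
  shows "\<exists>L. sigma y z \<midarrow>of_real \<mu> * \<alpha>\<rightarrow> L"
proof -
  let ?c = "complex_of_real \<mu>" and ?s = "complex_of_real \<mu> * \<alpha>"
  obtain d where d: "0 < d" "ball ?c d \<subseteq> regular" using open_regular mu_regular by (meson openE)
  define T where "T w = (sigma y z w - (\<Sum>l<n. (deriv ^^ l) (sigma y z) ?c / fact l * (w - ?c) ^ l)) / (w - ?c) ^ n" for w
  obtain L where L: "T \<midarrow>?c\<rightarrow> L"
    using taylor_remainder_limit[OF holomorphic_on_subset[OF sigma_holomorphic d(2)] d(1)] unfolding T_def[abs_def] by blast
  have sc: "?s / \<alpha> = ?c" using \<alpha>_nz(1) by simp
  have Re: "0 < Re ?s" using rate_pos proportion_pos by simp
  have "isCont (sigma y z) ?c"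
    using holomorphic_on_imp_continuous_on[OF sigma_holomorphic] mu_regular
    by (simp add: continuous_on_eq_continuous_at[OF open_regular])
  then have t1: "(\<lambda>s. sigma y z (s / \<alpha>)) \<midarrow>?s\<rightarrow> sigma y z ?c" by (intro tendsto_scaled) (simp only: sc isCont_def)
  have t2: "(\<lambda>s. T (s / \<alpha>)) \<midarrow>?s\<rightarrow> L" by (intro tendsto_scaled) (simp only: sc L)
  have "?s \<noteq> 2 * of_real \<mu> * \<alpha>" using rate_pos \<alpha>_nz(1) by simp
  then have t3: "JB \<midarrow>?s\<rightarrow> JB ?s" "HB z \<midarrow>?s\<rightarrow> HB z ?s" using isCont_B by (simp_all add: isCont_def)
  have t4: "phi \<midarrow>?s\<rightarrow> phi ?s" "hs \<midarrow>?s\<rightarrow> hs ?s" using isCont_phi[OF Re] isCont_hs[OF Re] by (simp_all only: isCont_def)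
  have s0: "?s \<noteq> 0" using rate_pos \<alpha>_nz(1) by simp
  \<comment> \<open>The right-hand side of the functional equation with \<open>JA\<close> and
    \<open>HA\<close> merged into the Taylor quotient \<open>T\<close>, which has a limit; every
    other ingredient is continuous at this point.\<close>
  define V where "V s = (1 - phi s) / s + ((phi s - \<theta> * hs s) * ((- of_real \<mu>) ^ n / \<alpha> * T (s / \<alpha>))
      + hs s * (JB s * sigma y z (s / \<alpha>) + HB z s))" for s
  have "V \<midarrow>?s\<rightarrow> (1 - phi ?s) / ?s + ((phi ?s - \<theta> * hs ?s) * ((- of_real \<mu>) ^ n / \<alpha> * L)
      + hs ?s * (JB ?s * sigma y z ?c + HB z ?s))"
    unfolding V_def[abs_def] using s0 by (intro tendsto_intros t1 t2 t3 t4)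
  moreover have "eventually (\<lambda>s. V s = sigma y z s) (at ?s)"
    using eventually_sigma_equation[OF Re, of y z] eventually_neq_at_within[of ?s]
  proof eventually_elim
    case (elim s)
    have m1: "Suc (n - 1) = n" using stages by simp
    have sm: "s \<noteq> of_real \<mu> * \<alpha>" using elim(2) .
    have sum: "(\<Sum>l\<le>n - 1. (- (of_real \<mu> - s / \<alpha>)) ^ l / fact l * y l) =
        (\<Sum>l<n. (deriv ^^ l) (sigma y z) ?c / fact l * (s / \<alpha> - ?c) ^ l)"
      using stages y by (intro sum.cong) auto
    have "JA s * sigma y z (s / \<alpha>) + HA y s = (of_real \<mu> ^ n * ((sigma y z (s / \<alpha>) - (\<Sum>l\<le>n - 1. (- (of_real \<mu> - s / \<alpha>)) ^ l / fact l * y l)) / (of_real \<mu> - s / \<alpha>) ^ n)) / \<alpha>"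
      using erlang_transform_poles[OF \<alpha>_nz(1) sm, of "of_real \<mu>" "n - 1" "sigma y z (s / \<alpha>)" y]
      unfolding m1 by (simp only: JA_def HA_def add_divide_distrib times_divide_eq_left times_divide_eq_right)
    also have "(of_real \<mu> - s / \<alpha>) ^ n = (-1) ^ n * (s / \<alpha> - ?c) ^ n"
      by (subst power_mult_distrib[symmetric]) simp
    also have "(of_real \<mu> ^ n * ((sigma y z (s / \<alpha>) - (\<Sum>l\<le>n - 1. (- (of_real \<mu> - s / \<alpha>)) ^ l / fact l * y l)) / ((-1) ^ n * (s / \<alpha> - ?c) ^ n))) / \<alpha>
       = (- of_real \<mu>) ^ n / \<alpha> * T (s / \<alpha>)"
      unfolding sum T_def
      by (subst power_minus[of "of_real \<mu>"]) (cases "even n"; simp add: mult_ac)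
    finally have A: "JA s * sigma y z (s / \<alpha>) + HA y s = (- of_real \<mu>) ^ n / \<alpha> * T (s / \<alpha>)" .
    have "H_fun n \<mu> a \<theta> phi hs y z s = (1 - phi s) / s + H_hom y z s" by (simp add: H_hom_def)
    then have "sigma y z s = J s * sigma y z (s / \<alpha>) + ((1 - phi s) / s + H_hom y z s)" using elim(1) by simp
    also have "\<dots> = (1 - phi s) / s + ((phi s - \<theta> * hs s) * (JA s * sigma y z (s / \<alpha>) + HA y s)
      + hs s * (JB s * sigma y z (s / \<alpha>) + HB z s))"
      unfolding J_split H_hom_split by (simp add: algebra_simps)
    finally show ?case unfolding V_def A by simp
  qed
  ultimately show ?thesis using Lim_transform_eventually by blast
qed

text \<open>The functional equation carries the limit at mu alpha to the higher powers. Up to 2 mu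
  no further pole interferes, since the next one is at 2 mu (1 + a).\<close>

lemma sigma_limit:
  assumes y: "\<And>l. l \<le> n - 1 \<Longrightarrow> y l = (deriv ^^ l) (sigma y z) (of_real \<mu>)"
  shows "\<mu> * (1 + a) ^ i \<le> 2 * \<mu> \<Longrightarrow> \<exists>L. sigma y z \<midarrow>of_real \<mu> * \<alpha> ^ i\<rightarrow> L"
proof (induction i)
  case 0
  have "isCont (sigma y z) (of_real \<mu>)"
    using holomorphic_on_imp_continuous_on[OF sigma_holomorphic] mu_regular
    by (simp add: continuous_on_eq_continuous_at[OF open_regular])
  then show ?case by (auto simp: isCont_def)
next
  case (Suc i)
  show ?case
  proof (cases "i = 0")
    case True
    then show ?thesis using sigma_limit_first_pole[OF y] by simp
  next
    case False
    let ?s = "complex_of_real \<mu> * \<alpha> ^ Suc i"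
    have s: "?s = of_real (\<mu> * (1 + a) ^ Suc i)" by simp
    have "\<mu> * (1 + a) ^ i \<le> \<mu> * (1 + a) ^ Suc i"
      using rate_pos proportion_pos by (intro mult_left_mono power_increasing) auto
    then obtain L where "sigma y z \<midarrow>of_real \<mu> * \<alpha> ^ i\<rightarrow> L" using Suc by auto
    moreover have "?s / \<alpha> = of_real \<mu> * \<alpha> ^ i" using \<alpha>_nz(1) by simp
    ultimately have t1: "(\<lambda>s. sigma y z (s / \<alpha>)) \<midarrow>?s\<rightarrow> L" by (intro tendsto_scaled) (simp only:)
    have Re: "0 < Re ?s" unfolding s using rate_pos proportion_pos by (simp only: Re_complex_of_real) simp
    have lt: "\<mu> * (1 + a) < \<mu> * (1 + a) ^ Suc i"
      using False rate_pos proportion_pos one_less_power[of "1 + a" i] by simp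
    have "2 * \<mu> < 2 * \<mu> * (1 + a)" using rate_pos proportion_pos by simp
    then have "\<mu> * (1 + a) ^ Suc i \<noteq> 2 * \<mu> * (1 + a)" "\<mu> * (1 + a) ^ Suc i \<noteq> \<mu> * (1 + a)"
      using Suc.prems lt by linarith+
    then have np: "?s \<in> no_pole"
      unfolding s by (simp only: Compl_iff insert_iff of_real_eq_iff empty_iff de_Morgan_disj simp_thms)
    have "(\<lambda>s. J s * sigma y z (s / \<alpha>) + H_fun n \<mu> a \<theta> phi hs y z s) \<midarrow>?s\<rightarrow> J ?s * L + H_fun n \<mu> a \<theta> phi hs y z ?s"
      using isCont_J[OF Re np] by (intro tendsto_intros t1) (simp_all only: isCont_def)
    then show ?thesis using Lim_transform_eventually[OF _ eventually_sigma_equation[OF Re]] by blast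
  qed
qed

text \<open>Among the singular points only some mu (1 + a)^j can equal 2 mu, as the second family
  starts beyond 2 mu; there \<open>sigma_limit\<close> applies.\<close>

lemma sigma_limit_double:
  assumes y: "\<And>l. l \<le> n - 1 \<Longrightarrow> y l = (deriv ^^ l) (sigma y z) (of_real \<mu>)"
  shows "\<exists>L. sigma y z \<midarrow>of_real (2 * \<mu>)\<rightarrow> L"
proof (cases "of_real (2 * \<mu>) \<in> regular")
  case True
  then have "isCont (sigma y z) (of_real (2 * \<mu>))"
    using holomorphic_on_imp_continuous_on[OF sigma_holomorphic]
    by (simp only: continuous_on_eq_continuous_at[OF open_regular])
  then show ?thesis by (auto simp: isCont_def)
next
  case False
  then have "of_real (2 * \<mu>) \<in> singular_points \<mu> a" using rate_pos by (simp add: regular_def)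
  then obtain v j where vj: "v \<in> {\<mu>, 2 * \<mu>}" "complex_of_real (2 * \<mu>) = of_real (v * (1 + a) ^ (j + 1))" by (rule singular_pointsE)
  then have eq: "2 * \<mu> = v * (1 + a) ^ (j + 1)" by (simp only: of_real_eq_iff)
  have "1 < (1 + a) ^ (j + 1)" using proportion_pos by (intro one_less_power) auto
  then have "v \<noteq> 2 * \<mu>" using eq rate_pos by auto
  then have v: "v = \<mu>" using vj(1) by simp
  have "of_real (2 * \<mu>) = of_real \<mu> * \<alpha> ^ (j + 1)" unfolding eq v by simp
  then show ?thesis using sigma_limit[OF y, of "j + 1"] eq v by (simp only:)
qed

section \<open>The system as linear equations for contour coefficients\<close>

text \<open>With \<open>point\<close> and \<open>coef\<close> this merges both families of unknowns
  into one vector: indices below n are orders at mu, index n + l is order l at 2 mu. The larger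
  point comes last and orders increase within each block, which the search for the last nonzero
  entry relies on.\<close>

definition combine :: "(nat \<Rightarrow> complex) \<Rightarrow> (nat \<Rightarrow> complex) \<Rightarrow> nat \<Rightarrow> complex" where
  "combine y z i = (if i < n then y i else z (i - n))"

definition point :: "nat \<Rightarrow> real" where
  "point i = (if i < n then \<mu> else 2 * \<mu>)"

definition coef :: "real \<Rightarrow> nat \<Rightarrow> (complex \<Rightarrow> complex) \<Rightarrow> complex" where
  "coef r i F = circ_coef (of_real (point i)) r (if i < n then i else i - n) F"

lemma point_mem: "point i \<in> {\<mu>, 2 * \<mu>}"
  by (simp add: point_def)

text \<open>The order matters: mu is regular, so the equations there hold for true derivatives of
  \<open>sigma\<close>; these give the limit at 2 mu, and only then do the equations at 2 mu turn
  into contour coefficients.\<close>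

lemma solves_system_imp_coef:
  assumes r: "good_radius r" and sys: "solves_system n \<mu> a \<theta> phi hs y z" and i: "i < 3 * n - 1"
  shows "combine y z i = coef r i (sigma y z)"
proof -
  have sys': "\<forall>l\<le>n - 1. y l = (deriv ^^ l) (remove_sings (sigma y z)) (of_real \<mu>)"
    "\<forall>l\<le>2 * n - 2. z l = (deriv ^^ l) (remove_sings (sigma y z)) (of_real (2 * \<mu>))"
    using sys unfolding solves_system_def Let_def sigma_def[abs_def] by blast+
  have r0: "0 < r" using r by (simp add: good_radius_def)
  have cont: "isCont (sigma y z) (of_real \<mu>)"
    using holomorphic_on_imp_continuous_on[OF sigma_holomorphic] mu_regular
    by (simp add: continuous_on_eq_continuous_at[OF open_regular])
  then have l1: "sigma y z \<midarrow>of_real \<mu>\<rightarrow> sigma y z (of_real \<mu>)" by (simp add: isCont_def)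
  have y: "y l = circ_coef (of_real \<mu>) r l (sigma y z)" if "l \<le> n - 1" for l
    using sys'(1) that deriv_remove_sings_sigma[OF r _ l1] by simp
  have "cball (of_real \<mu>) r \<subseteq> regular"
  proof -
    have "ball (complex_of_real \<mu>) (2 * r) - {of_real \<mu>} \<subseteq> regular" using r by (simp add: good_radius_def)
    moreover have "cball (complex_of_real \<mu>) r \<subseteq> ball (of_real \<mu>) (2 * r)" using r0 by auto
    ultimately show ?thesis using mu_regular by blast
  qed
  then have "y l = (deriv ^^ l) (sigma y z) (of_real \<mu>)" if "l \<le> n - 1" for l
    using y[OF that] circ_coef_eq_deriv[OF sigma_holomorphic open_regular _ r0] by simp
  then obtain L where L: "sigma y z \<midarrow>of_real (2 * \<mu>)\<rightarrow> L" using sigma_limit_double by blast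
  have z: "z l = circ_coef (of_real (2 * \<mu>)) r l (sigma y z)" if "l \<le> 2 * n - 2" for l
    using sys'(2) that deriv_remove_sings_sigma[OF r _ L] by simp
  show ?thesis
  proof (cases "i < n")
    case True
    then show ?thesis using y[of i] by (simp add: combine_def coef_def point_def)
  next
    case False
    then have "i - n \<le> 2 * n - 2" using i by linarith
    then show ?thesis using False z[of "i - n"] by (simp add: combine_def coef_def point_def)
  qed
qed

end

section \<open>The homogeneous linear system\<close>

text \<open>Cancelling powers leaves Cauchy's formula for (u - c)^(l - l') G at c, which is 0 unless
  l' = l.\<close>

lemma circ_coef_power_factor:
  assumes G: "G holomorphic_on S" "open S" "cball c r \<subseteq> S" "0 < r" and l: "l' \<le> l"
  shows "circ_coef c r l' (\<lambda>s. (s - c) ^ l * G s) = (if l' = l then fact l * G c else 0)"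
proof -
  have c0: "circ_coef c r 0 (\<lambda>s. (s - c) ^ (l - l') * G s) = (c - c) ^ (l - l') * G c"
    using assms by (subst circ_coef_eq_deriv[of _ S]) (auto intro!: holomorphic_intros)
  have "contour_integral (circlepath c r) (\<lambda>u. (u - c) ^ l * G u / (u - c) ^ Suc l') =
      contour_integral (circlepath c r) (\<lambda>u. (u - c) ^ (l - l') * G u / (u - c) ^ Suc 0)"
  proof (rule contour_integral_eq)
    fix u assume "u \<in> path_image (circlepath c r)"
    then have "u - c \<noteq> 0" using assms(4) by auto
    then show "(u - c) ^ l * G u / (u - c) ^ Suc l' = (u - c) ^ (l - l') * G u / (u - c) ^ Suc 0"
      using l by (simp add: power_diff)
  qed
  then have "circ_coef c r l' (\<lambda>s. (s - c) ^ l * G s) = fact l' * circ_coef c r 0 (\<lambda>s. (s - c) ^ (l - l') * G s)"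
    unfolding circ_coef_def by simp
  then show ?thesis unfolding c0 using l by auto
qed

context dual_risk_model
begin

definition vecH :: "(nat \<Rightarrow> complex) \<Rightarrow> complex \<Rightarrow> complex" where
  "vecH d = H_hom d (\<lambda>l. d (n + l))"

abbreviation "N \<equiv> 3 * n - 1"

abbreviation "unit_vec \<equiv> \<lambda>j i. if i = j then 1 else (0 :: complex)"

lemma scaling_bounded_vecH: "scaling_bounded (vecH d)"
  unfolding vecH_def by (rule scaling_bounded_H_hom)

lemma vecH_cong: "(\<And>i. i < N \<Longrightarrow> d i = d' i) \<Longrightarrow> vecH d s = vecH d' s"
  unfolding vecH_def using stages by (intro H_hom_cong) auto

lemma vecH_sum: "vecH d s = (\<Sum>j<N. d j * vecH (unit_vec j) s)"
proof -
  have fin: "vecH (\<lambda>i. \<Sum>j\<in>I. d j * unit_vec j i) s = (\<Sum>j\<in>I. d j * vecH (unit_vec j) s)" if "finite I" for I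
    using that
  proof (induction I rule: finite_induct)
    case empty
    then show ?case by (simp add: vecH_def H_hom_zero)
  next
    case (insert j I)
    have "vecH (\<lambda>i. \<Sum>j\<in>insert j I. d j * unit_vec j i) s =
        vecH (\<lambda>i. (\<Sum>j\<in>I. d j * unit_vec j i) + d j * unit_vec j i) s"
      by (rule arg_cong[where f = "\<lambda>d. vecH d s"], rule ext) (use insert.hyps in \<open>simp add: add.commute\<close>)
    also have "\<dots> = vecH (\<lambda>i. \<Sum>j\<in>I. d j * unit_vec j i) s + d j * vecH (unit_vec j) s"
      unfolding vecH_def by (rule H_hom_linear)
    finally show ?case unfolding insert.IH using insert.hyps by (simp add: add.commute)
  qed
  have "vecH d s = vecH (\<lambda>i. \<Sum>j<N. d j * unit_vec j i) s"
  proof (rule vecH_cong)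
    fix i assume "i < N"
    then have "(\<Sum>j<N. d j * unit_vec j i) = (\<Sum>j<N. if j = i then d j else 0)" by (intro sum.cong) auto
    also have "\<dots> = d i" using \<open>i < N\<close> by simp
    finally show "d i = (\<Sum>j<N. d j * unit_vec j i)" by simp
  qed
  also have "\<dots> = (\<Sum>j<N. d j * vecH (unit_vec j) s)" by (rule fin) simp
  finally show ?thesis .
qed

lemma neumann_sum:
  assumes "finite I" "\<And>i. i \<in> I \<Longrightarrow> scaling_bounded (F i)" "s \<in> regular"
  shows "neumann (\<lambda>s. \<Sum>i\<in>I. x i * F i s) s = (\<Sum>i\<in>I. x i * neumann (F i) s)"
proof -
  have "(\<lambda>k. J_prod k s * (\<Sum>i\<in>I. x i * F i (s / \<alpha> ^ k))) sums (\<Sum>i\<in>I. x i * neumann (F i) s)"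
  proof -
    have "(\<lambda>k. x i * (J_prod k s * F i (s / \<alpha> ^ k))) sums (x i * neumann (F i) s)" if "i \<in> I" for i
      unfolding neumann_def by (intro sums_mult summable_sums neumann_summable assms that)
    then have "(\<lambda>k. \<Sum>i\<in>I. x i * (J_prod k s * F i (s / \<alpha> ^ k))) sums (\<Sum>i\<in>I. x i * neumann (F i) s)"
      by (rule sums_sum)
    then show ?thesis by (simp only: sum_distrib_left mult.left_commute)
  qed
  then show ?thesis unfolding neumann_def by (rule sums_unique[symmetric])
qed

lemma coef_cong:
  assumes "good_radius r" "\<And>s. s \<in> regular \<Longrightarrow> F s = G s"
  shows "coef r i F = coef r i G"
  unfolding coef_def
proof (rule circ_coef_cong)
  show "0 < r" using assms(1) by (simp add: good_radius_def)
qed (rule assms(2)[OF subsetD[OF sphere_regular[OF assms(1) point_mem]]])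

lemma coef_sum:
  assumes r: "good_radius r" and "finite I" "\<And>i. i \<in> I \<Longrightarrow> F i holomorphic_on regular"
  shows "coef r m (\<lambda>s. \<Sum>i\<in>I. x i * F i s) = (\<Sum>i\<in>I. x i * coef r m (F i))"
  unfolding coef_def using assms(2)
proof (rule circ_coef_sum)
  show "continuous_on (sphere (of_real (point m)) r) (F i)" if "i \<in> I" for i
    using holomorphic_on_imp_continuous_on[OF assms(3)[OF that]] sphere_regular[OF r point_mem]
    by (rule continuous_on_subset)
  show "0 < r" using r by (simp add: good_radius_def)
qed

lemma coef_add:
  assumes r: "good_radius r" and "F holomorphic_on regular" "G holomorphic_on regular"
  shows "coef r m (\<lambda>s. F s + x * G s) = coef r m F + x * coef r m G"
  unfolding coef_def
proof (rule circ_coef_add)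
  show "continuous_on (sphere (of_real (point m)) r) F" "continuous_on (sphere (of_real (point m)) r) G"
    using assms(2,3) sphere_regular[OF r point_mem]
    by (auto intro: continuous_on_subset[OF holomorphic_on_imp_continuous_on])
  show "0 < r" using r by (simp add: good_radius_def)
qed

text \<open>Identifies the matrix of the homogeneous system: entry (i, j) is the i-th coefficient of
  \<open>neumann (vecH (unit_vec j))\<close>.\<close>

lemma coef_neumann_vecH:
  assumes "good_radius r"
  shows "coef r i (neumann (vecH d)) = (\<Sum>j<N. d j * coef r i (neumann (vecH (unit_vec j))))"
proof -
  have "vecH d = (\<lambda>s. \<Sum>j<N. d j * vecH (unit_vec j) s)" by (rule ext) (rule vecH_sum)
  then have "coef r i (neumann (vecH d)) = coef r i (neumann (\<lambda>s. \<Sum>j<N. d j * vecH (unit_vec j) s))" by (simp only:)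
  also have "\<dots> = coef r i (\<lambda>s. \<Sum>j<N. d j * neumann (vecH (unit_vec j)) s)"
    by (rule coef_cong[OF assms]) (intro neumann_sum scaling_bounded_vecH finite_lessThan)
  also have "\<dots> = (\<Sum>j<N. d j * coef r i (neumann (vecH (unit_vec j))))"
    by (rule coef_sum[OF assms]) (intro neumann_holomorphic scaling_bounded_vecH finite_lessThan)+
  finally show ?thesis .
qed

lemma cball_pos:
  assumes "good_radius r" "v \<in> {\<mu>, 2 * \<mu>}"
  shows "cball (of_real v) r \<subseteq> {s. 0 < Re s}"
proof
  fix w assume "w \<in> cball (complex_of_real v) r"
  then have "\<bar>Re (of_real v - w)\<bar> \<le> r" using abs_Re_le_cmod[of "of_real v - w"] by (simp add: dist_norm)
  then show "w \<in> {s. 0 < Re s}" using assms rate_pos by (auto simp: good_radius_def)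
qed

lemma coef_eq_deriv:
  assumes "good_radius r" "F holomorphic_on {s. 0 < Re s}"
  shows "coef r i F = (deriv ^^ (if i < n then i else i - n)) F (of_real (point i))"
  unfolding coef_def using assms
  by (intro circ_coef_eq_deriv[OF assms(2)] cball_pos point_mem open_halfspace_Re_gt) (auto simp: good_radius_def)

lemma H_hom_data:
  assumes r: "good_radius r" and g: "laplace_integrable g"
  shows "H_hom (data g \<mu>) (data g (2 * \<mu>)) s = vecH (\<lambda>i. coef r i (laplace g)) s"
  unfolding vecH_def
  by (intro H_hom_cong) (use stages in \<open>auto simp: coef_eq_deriv[OF r laplace_holomorphic[OF g]] data_def point_def\<close>)

text \<open>
  Since \<^term>\<open>renewal_op\<close> contracts the norm of \<open>L\<^sup>1\<close>, its Neumann series solves the renewal equation with an arbitrary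
  integrable forcing term \<open>f\<close>. Hence the right-hand side of the linear system obtained from \<open>f\<close> lies in
  the range of the system, and every left null vector annihilates it.
\<close>

lemma left_null_vector_laplace:
  assumes r: "good_radius r"
    and f: "f \<in> borel_measurable borel" "\<And>x. \<bar>f x\<bar> \<le> K" "set_integrable lborel {0..} f"
    and null: "\<And>j. j < N \<Longrightarrow> (\<Sum>i<N. w i * coef r i (neumann (vecH (unit_vec j)))) = w j"
  shows "(\<Sum>i<N. w i * coef r i (neumann (laplace f))) = 0"
proof -
  define q where "q = 1 / (1 + a)"
  have q: "0 < q" "q < 1" using proportion_pos by (auto simp: q_def)
  \<comment> \<open>The iterates of \<open>renewal_op\<close> on \<open>f\<close>. They are summed
    only after transforming, as \<open>\<Gamma>\<close>, so no function solving the renewal equation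
    has to be constructed.\<close>
  define g where "g k = (renewal_op ^^ k) f" for k
  define I where "I = (LINT x:{0..}|lborel. \<bar>f x\<bar>)"
  have gk: "g k \<in> borel_measurable borel \<and> (\<forall>x. \<bar>g k x\<bar> \<le> K) \<and> set_integrable lborel {0..} (g k) \<and>
      (LINT x:{0..}|lborel. \<bar>g k x\<bar>) \<le> I * q ^ k" for k
  proof (induction k)
    case 0
    then show ?case using f by (simp add: g_def I_def)
  next
    case (Suc k)
    then have IH: "g k \<in> borel_measurable borel" "\<And>x. \<bar>g k x\<bar> \<le> K" "set_integrable lborel {0..} (g k)"
      "(LINT x:{0..}|lborel. \<bar>g k x\<bar>) \<le> I * q ^ k" by auto
    have S: "g (Suc k) = renewal_op (g k)" by (simp add: g_def)
    have "(LINT x:{0..}|lborel. \<bar>g (Suc k) x\<bar>) \<le> (LINT x:{0..}|lborel. \<bar>g k x\<bar>) * q"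
      unfolding S q_def using renewal_op_L1(2)[OF IH(1-3)] by simp
    also have "\<dots> \<le> (I * q ^ k) * q" using IH(4) q by (intro mult_right_mono) auto
    finally show ?case
      unfolding S using renewal_op_L1(1)[OF IH(1-3)] renewal_op_bound[OF IH(1,2)] measurable_renewal_op[OF IH(1)]
      by (simp add: mult_ac)
  qed
  define L where "L k = laplace (g k)" for k
  have lap: "laplace_integrable (g k)" for k
    using gk[of k] by (intro laplace_integrable_bounded[of "g k" K]) auto
  have L_hol: "L k holomorphic_on {s. 0 < Re s}" for k unfolding L_def using lap by (rule laplace_holomorphic)
  have L_bound: "norm (L k s) \<le> I * q ^ k" if "0 < Re s" for k s
    unfolding L_def using norm_laplace_le[of "g k" s] gk[of k] that by (auto intro: order.trans)
  have sumq: "summable (\<lambda>k. I * q ^ k)" using q by (intro summable_mult summable_geometric) auto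
  define \<Gamma> where "\<Gamma> s = (\<Sum>k. L k s)" for s
  have L_sum: "summable (\<lambda>k. L k s)" if "0 < Re s" for s
    by (rule summable_comparison_test'[OF sumq, of 0]) (rule L_bound[OF that])
  have \<Gamma>_hol: "\<Gamma> holomorphic_on {s. 0 < Re s}"
    unfolding \<Gamma>_def[abs_def]
  proof (rule suminf_holomorphic[OF open_halfspace_Re_gt L_hol])
    fix T :: "complex set" assume "T \<subseteq> {s. 0 < Re s}"
    then have "\<forall>k. \<forall>s\<in>T. norm (L k s) \<le> I * q ^ k" using L_bound by blast
    then show "\<exists>M. summable M \<and> (\<forall>k. \<forall>s\<in>T. norm (L k s) \<le> M k)" using sumq by blast
  qed
  have \<Gamma>_bound: "norm (\<Gamma> s) \<le> I * (1 / (1 - q))" if "0 < Re s" for s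
  proof -
    have "norm (\<Gamma> s) \<le> (\<Sum>k. I * q ^ k)"
      unfolding \<Gamma>_def by (rule norm_suminf_le[OF L_bound[OF that] sumq])
    also have "\<dots> = I * (1 / (1 - q))" using q by (subst suminf_mult) (auto simp: suminf_geometric summable_geometric)
    finally show ?thesis .
  qed
  have r0: "0 < r" using r by (simp add: good_radius_def)
  define dat where "dat k i = coef r i (L k)" for k i
  define D where "D i = coef r i \<Gamma>" for i
  have dat_sums: "(\<lambda>k. dat k i) sums D i" for i
  proof -
    let ?l = "if i < n then i else i - n"
    have sp: "sphere (complex_of_real (point i)) r \<subseteq> {s. 0 < Re s}"
      using cball_pos[OF r point_mem, of i] sphere_cball by blast
    have c: "continuous_on (sphere (complex_of_real (point i)) r) (L k)" for k
      using holomorphic_on_imp_continuous_on[OF L_hol] sp by (rule continuous_on_subset)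
    have b: "norm (L k s) \<le> I * q ^ k" if "s \<in> sphere (complex_of_real (point i)) r" for k s
      using L_bound sp that by blast
    have "norm (dat k i) \<le> fact ?l / r ^ ?l * (I * q ^ k)" for k
      unfolding dat_def coef_def by (rule circ_coef_bound[OF c b r0])
    then have "summable (\<lambda>k. dat k i)"
      by (rule summable_comparison_test'[OF summable_mult[OF sumq, of "fact ?l / r ^ ?l"], of 0])
    moreover have D: "D i = (\<Sum>k. dat k i)"
      unfolding D_def dat_def coef_def \<Gamma>_def[abs_def] by (rule circ_coef_suminf[OF c b sumq r0])
    ultimately show ?thesis unfolding D by (intro summable_sums)
  qed
  have step: "L (Suc k) s = J s * L k (s / \<alpha>) + vecH (dat k) s" if s: "s \<in> regular" for k s
  proof -
    have "s \<in> no_pole" "0 < Re s" using regular_no_pole s by (auto simp: regular_def)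
    then have "laplace (renewal_op (g k)) s = J s * laplace (g k) (s / \<alpha>) + H_hom (data (g k) \<mu>) (data (g k) (2 * \<mu>)) s"
      using gk[of k] laplace_renewal_op[of "g k" K s] by auto
    then show ?thesis unfolding H_hom_data[OF r lap] dat_def L_def by (simp add: g_def)
  qed
  have \<Gamma>_eq: "\<Gamma> s = J s * \<Gamma> (s / \<alpha>) + (vecH D s + L 0 s)" if s: "s \<in> regular" for s
  proof -
    have pos: "0 < Re s" "0 < Re (s / \<alpha>)" using s regular_div[OF s, of 1] by (auto simp: regular_def)
    have "(\<lambda>k. \<Sum>j<N. dat k j * vecH (unit_vec j) s) sums (\<Sum>j<N. D j * vecH (unit_vec j) s)"
      by (intro sums_sum sums_mult2 dat_sums)
    then have v: "(\<lambda>k. vecH (dat k) s) sums vecH D s" by (simp only: vecH_sum[symmetric])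
    have "(\<lambda>k. L k (s / \<alpha>)) sums \<Gamma> (s / \<alpha>)" unfolding \<Gamma>_def by (rule summable_sums[OF L_sum[OF pos(2)]])
    then have "(\<lambda>k. J s * L k (s / \<alpha>) + vecH (dat k) s) sums (J s * \<Gamma> (s / \<alpha>) + vecH D s)"
      by (intro sums_add sums_mult v)
    then have "(\<lambda>k. L (Suc k) s) sums (J s * \<Gamma> (s / \<alpha>) + vecH D s)" by (simp only: step[OF s])
    moreover have "(\<Sum>k. L (Suc k) s) = \<Gamma> s - L 0 s"
      unfolding \<Gamma>_def by (rule suminf_split_head[OF L_sum[OF pos(1)]])
    ultimately have "\<Gamma> s - L 0 s = J s * \<Gamma> (s / \<alpha>) + vecH D s" by (simp only: sums_unique[symmetric])
    then show ?thesis by (simp add: algebra_simps)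
  qed
  have sb0: "scaling_bounded (L 0)" by (rule scaling_bounded_bounded[OF L_hol L_bound])
  have \<Gamma>_neumann: "\<Gamma> s = neumann (vecH D) s + neumann (L 0) s" if s: "s \<in> regular" for s
  proof -
    have iter: "\<Gamma> s = (\<Sum>k<M. J_prod k s * (vecH D (s / \<alpha> ^ k) + L 0 (s / \<alpha> ^ k))) + J_prod M s * \<Gamma> (s / \<alpha> ^ M)" for M
    proof (rule iterate_functional_equation[of \<Gamma> s \<alpha> J "\<lambda>s. vecH D s + L 0 s"])
      show "\<Gamma> (s / \<alpha> ^ k) = J (s / \<alpha> ^ k) * \<Gamma> (s / \<alpha> ^ Suc k) + (vecH D (s / \<alpha> ^ k) + L 0 (s / \<alpha> ^ k))" for k
        using \<Gamma>_eq[OF regular_div[OF s, of k]] by (simp only: divide_divide_eq_left power_Suc2)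
    qed
    \<comment> \<open>Unlike \<open>rho\<close>, \<open>\<Gamma>\<close> is bounded on the
      half-plane, so the remainder is the general term of a convergent series.\<close>
    have "scaling_bounded \<Gamma>" by (rule scaling_bounded_bounded[OF \<Gamma>_hol \<Gamma>_bound])
    then have "(\<lambda>M. J_prod M s * \<Gamma> (s / \<alpha> ^ M)) \<longlonglongrightarrow> 0"
      by (rule summable_LIMSEQ_zero[OF neumann_summable[OF _ s]])
    moreover have "(\<lambda>M. \<Sum>k<M. J_prod k s * (vecH D (s / \<alpha> ^ k) + L 0 (s / \<alpha> ^ k))) \<longlonglongrightarrow> neumann (vecH D) s + neumann (L 0) s"
    proof -
      have "(\<lambda>k. J_prod k s * vecH D (s / \<alpha> ^ k) + J_prod k s * L 0 (s / \<alpha> ^ k)) sums (neumann (vecH D) s + neumann (L 0) s)"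
        unfolding neumann_def by (intro sums_add summable_sums neumann_summable scaling_bounded_vecH sb0 s)
      then show ?thesis by (simp only: sums_def distrib_left)
    qed
    ultimately have "(\<lambda>M. (\<Sum>k<M. J_prod k s * (vecH D (s / \<alpha> ^ k) + L 0 (s / \<alpha> ^ k))) + J_prod M s * \<Gamma> (s / \<alpha> ^ M))
        \<longlonglongrightarrow> (neumann (vecH D) s + neumann (L 0) s) + 0"
      by (intro tendsto_add)
    then have "(\<lambda>M. \<Gamma> s) \<longlonglongrightarrow> (neumann (vecH D) s + neumann (L 0) s) + 0" unfolding iter[symmetric] .
    then show ?thesis by (simp only: LIMSEQ_const_iff add_0_right)
  qed
  \<comment> \<open>In matrix form D = A D + b, where b holds the coefficients of
    \<open>neumann (laplace f)\<close>.\<close>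
  have D_eq: "D i = (\<Sum>j<N. D j * coef r i (neumann (vecH (unit_vec j)))) + coef r i (neumann (L 0))" for i
  proof -
    have "D i = coef r i (\<lambda>s. neumann (vecH D) s + 1 * neumann (L 0) s)"
      unfolding D_def by (rule coef_cong[OF r]) (simp add: \<Gamma>_neumann[unfolded D_def])
    also have "\<dots> = coef r i (neumann (vecH D)) + 1 * coef r i (neumann (L 0))"
      by (rule coef_add[OF r neumann_holomorphic[OF scaling_bounded_vecH] neumann_holomorphic[OF sb0]])
    finally have "D i = coef r i (neumann (vecH D)) + coef r i (neumann (L 0))" unfolding mult_1 .
    then show ?thesis by (rule trans[OF _ arg_cong2[where f = "(+)", OF coef_neumann_vecH[OF r] refl]])
  qed
  have wD: "w i * D i = w i * (\<Sum>j<N. D j * coef r i (neumann (vecH (unit_vec j)))) + w i * coef r i (neumann (L 0))" for i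
    by (subst D_eq) (rule distrib_left)
  have "(\<Sum>i<N. w i * D i) = (\<Sum>i<N. w i * (\<Sum>j<N. D j * coef r i (neumann (vecH (unit_vec j)))))
      + (\<Sum>i<N. w i * coef r i (neumann (L 0)))"
    unfolding sum.distrib[symmetric] by (rule sum.cong[OF refl wD])
  also have "(\<Sum>i<N. w i * (\<Sum>j<N. D j * coef r i (neumann (vecH (unit_vec j))))) =
      (\<Sum>j<N. D j * (\<Sum>i<N. w i * coef r i (neumann (vecH (unit_vec j)))))"
    unfolding sum_distrib_left by (subst sum.swap) (simp only: mult.left_commute)
  \<comment> \<open>Here w A = w is used; the pairing of w with D then cancels on both sides and
    leaves w b = 0.\<close>
  also have "\<dots> = (\<Sum>j<N. D j * w j)" by (intro sum.cong refl arg_cong2[where f = times] null) simp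
  finally have "(\<Sum>i<N. w i * coef r i (neumann (L 0))) = 0" by (simp add: mult.commute)
  then show ?thesis by (simp add: L_def g_def)
qed

end

section \<open>Testing the null vector on polynomials in 1 / (s + v)\<close>

lemma power_exp_le:
  fixes v x :: real
  assumes "0 < v" "0 \<le> x"
  shows "x ^ l * exp (- v * x) \<le> fact l / v ^ l"
proof -
  have "(v * x) ^ l / fact l \<le> exp (v * x)"
    using sum_le_suminf[OF sums_summable[OF exp_converges[of "v * x"]], of "{l}"]
      sums_unique[OF exp_converges[of "v * x"]] assms by (simp add: field_simps)
  then show ?thesis
    using assms by (simp add: exp_minus field_simps power_mult_distrib)
qed

context dual_risk_model
begin

lemma neumann_cong:
  assumes "\<And>s. s \<in> regular \<Longrightarrow> F s = G s" "s \<in> regular"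
  shows "neumann F s = neumann G s"
  unfolding neumann_def using assms(1)[OF regular_div[OF assms(2)]] by (simp only:)

definition null_functional :: "(nat \<Rightarrow> complex) \<Rightarrow> real \<Rightarrow> (complex \<Rightarrow> complex) \<Rightarrow> complex" where
  "null_functional w r F = (\<Sum>i<N. w i * coef r i (neumann F))"

lemma null_functional_cong:
  assumes "good_radius r" "\<And>s. s \<in> regular \<Longrightarrow> F s = G s"
  shows "null_functional w r F = null_functional w r G"
  unfolding null_functional_def
  by (intro sum.cong refl arg_cong2[where f = times] coef_cong[OF assms(1)] neumann_cong[OF assms(2)])

lemma null_functional_sum:
  assumes r: "good_radius r" and I: "finite I" and F: "\<And>k. k \<in> I \<Longrightarrow> scaling_bounded (F k)"
  shows "null_functional w r (\<lambda>s. \<Sum>k\<in>I. x k * F k s) = (\<Sum>k\<in>I. x k * null_functional w r (F k))"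
proof -
  have "coef r i (neumann (\<lambda>s. \<Sum>k\<in>I. x k * F k s)) = (\<Sum>k\<in>I. x k * coef r i (neumann (F k)))" for i
  proof -
    have "coef r i (neumann (\<lambda>s. \<Sum>k\<in>I. x k * F k s)) = coef r i (\<lambda>s. \<Sum>k\<in>I. x k * neumann (F k) s)"
      by (rule coef_cong[OF r]) (rule neumann_sum[OF I F])
    also have "\<dots> = (\<Sum>k\<in>I. x k * coef r i (neumann (F k)))"
      by (rule coef_sum[OF r I neumann_holomorphic[OF F]])
    finally show ?thesis .
  qed
  then have "null_functional w r (\<lambda>s. \<Sum>k\<in>I. x k * F k s) = (\<Sum>i<N. \<Sum>k\<in>I. w i * (x k * coef r i (neumann (F k))))"
    by (simp only: null_functional_def sum_distrib_left)
  also have "\<dots> = (\<Sum>k\<in>I. \<Sum>i<N. x k * (w i * coef r i (neumann (F k))))"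
    by (subst sum.swap) (simp only: mult.left_commute)
  finally show ?thesis by (simp only: null_functional_def sum_distrib_left)
qed

text \<open>These are complex combinations of transforms of x^k exp(-v x).
  \<open>left_null_vector_laplace\<close> treats each real function, and linearity admits the
  complex coefficients.\<close>

lemma null_functional_polynomial:
  fixes p :: "complex poly"
  assumes r: "good_radius r" and v: "0 < v"
    and null: "\<And>j. j < N \<Longrightarrow> (\<Sum>i<N. w i * coef r i (neumann (vecH (unit_vec j)))) = w j"
  shows "null_functional w r (\<lambda>s. 1 / (s + of_real v) * poly p (1 / (s + of_real v))) = 0"
proof -
  define g where "g k x = indicator {0..} x * (x ^ k * exp (- v * x))" for k and x :: real
  have gm: "g k \<in> borel_measurable borel" for k unfolding g_def[abs_def] by measurable
  have gb: "\<bar>g k x\<bar> \<le> fact k / v ^ k" for k x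
    using power_exp_le[OF v, of x k] v by (auto simp: g_def indicator_def)
  have gi: "set_integrable lborel {0..} (g k)" for k
  proof -
    have "(\<lambda>x. indicator {0..} x *\<^sub>R g k x) = (\<lambda>x. indicator {0..} x * (x ^ k * exp (- v * x)))"
      by (auto simp: g_def indicator_def)
    then show ?thesis using has_bochner_integral_power_exp[OF v, of k]
      by (simp add: set_integrable_def has_bochner_integral_iff)
  qed
  have lap: "laplace (g k) s = fact k * (1 / (s + of_real v)) ^ Suc k" if "0 < Re s" for k s
  proof -
    have "laplace (g k) s = laplace (\<lambda>x. x ^ k * exp (- v * x)) s"
      unfolding laplace_def by (intro set_lebesgue_integral_cong) (auto simp: g_def)
    then show ?thesis using laplace_power_exp[of v s k] v that by (simp add: power_one_over del: power_Suc)
  qed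
  have sb: "scaling_bounded (laplace (g k))" for k
    by (rule scaling_bounded_bounded[OF laplace_holomorphic[OF laplace_integrable_integrable[OF gm gi]]
          norm_laplace_le[OF gi less_imp_le]])
  have "null_functional w r (\<lambda>s. 1 / (s + of_real v) * poly p (1 / (s + of_real v))) =
      null_functional w r (\<lambda>s. \<Sum>k\<in>{..degree p}. (coeff p k / fact k) * laplace (g k) s)"
  proof (rule null_functional_cong[OF r])
    fix s assume "s \<in> regular"
    then have s: "0 < Re s" by (simp add: regular_def)
    have "1 / (s + of_real v) * poly p (1 / (s + of_real v)) =
      (\<Sum>k\<le>degree p. coeff p k * (1 / (s + of_real v)) ^ Suc k)"
      unfolding poly_altdef sum_distrib_left by (intro sum.cong) simp_all
    also have "\<dots> = (\<Sum>k\<le>degree p. (coeff p k / fact k) * laplace (g k) s)"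
      unfolding lap[OF s] by (intro sum.cong) (simp_all del: power_Suc)
    finally show "1 / (s + of_real v) * poly p (1 / (s + of_real v)) =
      (\<Sum>k\<in>{..degree p}. (coeff p k / fact k) * laplace (g k) s)" .
  qed
  also have "\<dots> = (\<Sum>k\<in>{..degree p}. (coeff p k / fact k) * null_functional w r (laplace (g k)))"
    by (rule null_functional_sum[OF r finite_atMost sb])
  also have "\<dots> = 0"
  proof (rule sum.neutral, rule ballI)
    fix k
    have "null_functional w r (laplace (g k)) = 0"
      unfolding null_functional_def by (rule left_null_vector_laplace[OF r gm gb gi null])
    then show "(coeff p k / fact k) * null_functional w r (laplace (g k)) = 0" by simp
  qed
  finally show ?thesis .
qed

text \<open>Beyond the term k = 0 only values at points divided by at least alpha enter, and the
  constant \<open>E\<close> does not depend on \<open>F\<close>. A sequence of functions that decays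
  at these points is thus reproduced by \<open>neumann\<close> on \<open>T\<close> up to a decaying
  error.\<close>

lemma neumann_rest_bound:
  assumes T: "compact T" "T \<subseteq> regular"
  shows "\<exists>E\<ge>0. \<forall>F L. scaling_bounded F \<longrightarrow> (\<forall>s\<in>T. \<forall>k. norm (F (s / \<alpha> ^ Suc k)) \<le> L) \<longrightarrow>
     (\<forall>s\<in>T. norm (neumann F s - F s) \<le> E * L)"
proof -
  obtain E where E: "0 \<le> E" "\<And>s k. s \<in> T \<Longrightarrow> norm (J_prod k s) \<le> E * (1 / (1 + a)) ^ k"
    by (rule J_prod_bound_geometric[OF T]) (erule that, blast)
  define E' where "E' = E * (\<Sum>k. (1 / (1 + a)) ^ Suc k)"
  have q: "0 < 1 / (1 + a)" "1 / (1 + a) < 1" using proportion_pos by auto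
  have sq: "summable (\<lambda>k. (1 / (1 + a)) ^ Suc k)" using q by (subst summable_Suc_iff) (simp add: summable_geometric)
  have "norm (neumann F s - F s) \<le> E' * L"
    if F: "scaling_bounded F" and L: "\<forall>s\<in>T. \<forall>k. norm (F (s / \<alpha> ^ Suc k)) \<le> L" and s: "s \<in> T" for F L s
  proof -
    have sr: "s \<in> regular" using s T by blast
    have sm: "summable (\<lambda>k. J_prod k s * F (s / \<alpha> ^ k))" by (rule neumann_summable[OF F sr])
    have "neumann F s - F s = (\<Sum>k. J_prod (Suc k) s * F (s / \<alpha> ^ Suc k))"
      unfolding neumann_def using suminf_split_head[OF sm] by simp
    also have "norm \<dots> \<le> (\<Sum>k. (E * L) * (1 / (1 + a)) ^ Suc k)"
    proof (rule norm_suminf_le)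
      fix k
      have L0: "norm (F (s / \<alpha> ^ Suc k)) \<le> L" using L s by blast
      have "norm (J_prod (Suc k) s) * norm (F (s / \<alpha> ^ Suc k)) \<le> (E * (1 / (1 + a)) ^ Suc k) * L"
        using E q by (intro mult_mono L0 E(2)[OF s]) (auto simp del: power_Suc)
      then show "norm (J_prod (Suc k) s * F (s / \<alpha> ^ Suc k)) \<le> (E * L) * (1 / (1 + a)) ^ Suc k"
        unfolding norm_mult by (simp only: mult_ac)
      show "summable (\<lambda>k. (E * L) * (1 / (1 + a)) ^ Suc k)" by (rule summable_mult[OF sq])
    qed
    also have "\<dots> = E' * L" unfolding E'_def by (subst suminf_mult[OF sq]) simp
    finally show ?thesis .
  qed
  moreover have "0 \<le> E'" unfolding E'_def using E(1) q by (intro mult_nonneg_nonneg suminf_nonneg sq) auto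
  ultimately show ?thesis by blast
qed

text \<open>
  With \<open>u = 1 / (s + \<Lambda>)\<close>, the functions \<open>u (const s u)\<^sup>m ((s - \<lambda>) u)\<^sup>l\<close> are polynomials in \<open>u\<close> without constant term.
  As \<open>m\<close> grows they concentrate on the jet of order \<open>l\<close> at the largest point \<open>\<lambda>\<close> that carries a nonzero entry
  of the null vector.
\<close>

lemma left_null_vector_zero:
  assumes r: "good_radius r"
    and null: "\<And>j. j < N \<Longrightarrow> (\<Sum>i<N. w i * coef r i (neumann (vecH (unit_vec j)))) = w j"
    and "i < N"
  shows "w i = 0"
proof (rule ccontr)
  assume "w i \<noteq> 0"
  define I where "I = {i. i < N \<and> w i \<noteq> 0}"
  have I: "finite I" "I \<noteq> {}" using assms(3) \<open>w i \<noteq> 0\<close> by (auto simp: I_def)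
  \<comment> \<open>By the ordering of the indices this is the largest point with a nonzero entry
    and, there, the highest such order.\<close>
  define i0 where "i0 = Max I"
  have i0: "i0 < N" "w i0 \<noteq> 0" using Max_in[OF I] by (auto simp: i0_def I_def)
  have above: "w i = 0" if "i < N" "i0 < i" for i
  proof (rule ccontr)
    assume "w i \<noteq> 0"
    then have "i \<in> I" using that(1) by (simp add: I_def)
    then show False using Max_ge[OF I(1)] that(2) by (simp add: i0_def leD)
  qed
  define v where "v = point i0"
  define ord where "ord i = (if i < n then i else i - n)" for i
  define l where "l = ord i0"
  have v: "v \<in> {\<mu>, 2 * \<mu>}" "0 < v" using rate_pos by (auto simp: v_def point_def)
  have r0: "0 < r" "2 * r \<le> \<mu>" "2 * r \<le> \<mu> * a" using r by (auto simp: good_radius_def)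
  \<comment> \<open>Both entries bound moduli relative to v: 3/4 for the circle around mu when v = 2
    mu, as r <= mu / 2; the other for circles around points up to v after division by 1 + a, as r <=
    v a / 2.\<close>
  define \<eta> where "\<eta> = max (3 / 4) ((1 + a / 2) / (1 + a))"
  have \<eta>: "0 < \<eta>" "\<eta> < 1" "3 / 4 \<le> \<eta>" "(1 + a / 2) / (1 + a) \<le> \<eta>" using proportion_pos by (auto simp: \<eta>_def)
  \<comment> \<open>Chosen so that eta v / Lambda = (1 - eta) / 2. Then on the disc of radius eta v
    the base of the m-th power is at most eta + (1 - eta) / 2 = q < 1.\<close>
  define \<Lambda> where "\<Lambda> = v * (2 * \<eta>) / (1 - \<eta>)"
  have \<Lambda>: "0 < \<Lambda>" using v \<eta> by (simp add: \<Lambda>_def)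
  define q where "q = (1 + \<eta>) / 2"
  have q: "0 < q" "q < 1" using \<eta> by (auto simp: q_def)
  have q_eq: "(v + \<Lambda>) / v * (\<eta> * v / \<Lambda>) = q"
  proof -
    have "(v + \<Lambda>) / v * (\<eta> * v / \<Lambda>) = \<eta> * (v / \<Lambda>) + \<eta>" using v \<Lambda> by (simp add: field_simps)
    also have "v / \<Lambda> = (1 - \<eta>) / (2 * \<eta>)" using v by (simp add: \<Lambda>_def)
    also have "\<eta> * ((1 - \<eta>) / (2 * \<eta>)) + \<eta> = q" using \<eta> by (simp add: q_def field_simps)
    finally show ?thesis .
  qed
  \<comment> \<open>Normalises the base: \<open>b * (s * u s)\<close> is 1 at s = v.\<close>
  define b where "b = complex_of_real ((v + \<Lambda>) / v)"
  define u where "u s = 1 / (s + complex_of_real \<Lambda>)" for s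
  define F where "F m s = u s * (b * (s * u s)) ^ m * ((s - of_real v) * u s) ^ l" for m s
  define G where "G m s = u s * (b * (s * u s)) ^ m * u s ^ l" for m s
  have FG: "F m s = (s - of_real v) ^ l * G m s" for m s by (simp add: F_def G_def power_mult_distrib)
  have nz: "s + complex_of_real \<Lambda> \<noteq> 0" if "0 < Re s" for s using that \<Lambda> by (auto simp: complex_eq_iff)
  have nu: "norm (u s) \<le> 1 / \<Lambda>" if "0 < Re s" for s
  proof -
    have "\<Lambda> \<le> Re (s + of_real \<Lambda>)" using that by simp
    also have "\<dots> \<le> norm (s + of_real \<Lambda>)" by (rule complex_Re_le_cmod)
    finally show ?thesis using \<Lambda> by (simp add: u_def norm_divide frac_le)
  qed
  have nsu: "norm (s * u s) \<le> 1" if s: "0 < Re s" for s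
  proof -
    have "(Re s)\<^sup>2 \<le> (Re s + \<Lambda>)\<^sup>2" using s \<Lambda> by (intro power_mono) auto
    then have "norm s \<le> norm (s + of_real \<Lambda>)"
      unfolding cmod_def by (intro real_sqrt_le_mono) simp
    then show ?thesis using nz[OF s] by (simp add: u_def norm_divide)
  qed
  have nvu: "norm ((s - of_real v) * u s) \<le> 1 + v / \<Lambda>" if s: "0 < Re s" for s
  proof -
    have "norm ((s - of_real v) * u s) = norm (s * u s - of_real v * u s)" by (simp add: algebra_simps)
    also have "\<dots> \<le> norm (s * u s) + norm (of_real v * u s)" by (rule norm_triangle_ineq4)
    also have "norm (of_real v * u s) \<le> v * (1 / \<Lambda>)"
      unfolding norm_mult norm_of_real using nu[OF s] v by (intro mult_mono) auto
    finally show ?thesis using nsu[OF s] by simp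
  qed
  define E0 where "E0 = 1 / \<Lambda> * (1 + v / \<Lambda>) ^ l"
  have E0: "0 \<le> E0" using \<Lambda> v by (simp add: E0_def)
  have F_bound: "norm (F m s) \<le> E0 * t ^ m" if s: "0 < Re s" "norm (b * (s * u s)) \<le> t" for m s t
  proof -
    have "norm (F m s) \<le> (1 / \<Lambda> * t ^ m) * (1 + v / \<Lambda>) ^ l"
      unfolding F_def norm_mult[of "_ * _"] norm_mult[of "u s" "_ ^ m"] norm_power
      using \<Lambda> v order.trans[OF norm_ge_zero s(2)]
      by (intro mult_mono power_mono nu s(1) nvu s(2)) auto
    then show ?thesis by (simp add: E0_def mult_ac)
  qed
  have nb: "norm b = (v + \<Lambda>) / v" unfolding b_def norm_of_real using v \<Lambda> by simp
  have F_small: "norm (F m s) \<le> E0 * q ^ m" if s: "0 < Re s" "norm s \<le> \<eta> * v" for m s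
  proof (rule F_bound[OF s(1)])
    have "norm (s * u s) \<le> \<eta> * v * (1 / \<Lambda>)"
      unfolding norm_mult using s nu[OF s(1)] \<eta> v by (intro mult_mono) auto
    then have "norm b * norm (s * u s) \<le> (v + \<Lambda>) / v * (\<eta> * v / \<Lambda>)"
      unfolding nb using v \<Lambda> by (intro mult_left_mono) auto
    then show "norm (b * (s * u s)) \<le> q" unfolding q_eq norm_mult[of b] .
  qed
  have hol: "u holomorphic_on {s. 0 < Re s}"
    unfolding u_def[abs_def] using nz by (intro holomorphic_intros) auto
  have F_hol: "F m holomorphic_on {s. 0 < Re s}" and G_hol: "G m holomorphic_on {s. 0 < Re s}" for m
    unfolding F_def[abs_def] G_def[abs_def] by (intro holomorphic_intros hol)+
  have sb: "scaling_bounded (F m)" for m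
  proof (rule scaling_bounded_bounded[OF F_hol])
    fix s assume s: "0 < Re s"
    have "norm (b * (s * u s)) \<le> (v + \<Lambda>) / v"
      unfolding norm_mult[of b] nb using nsu[OF s] v \<Lambda> by (intro mult_left_le) auto
    then show "norm (F m s) \<le> E0 * ((v + \<Lambda>) / v) ^ m" by (rule F_bound[OF s])
  qed
  have F_null: "null_functional w r (F m) = 0" for m
  proof -
    \<comment> \<open>Uses s u = 1 - Lambda u and (s - v) u = 1 - (v + Lambda) u.\<close>
    let ?p = "smult (b ^ m) ([:1, - of_real \<Lambda>:] ^ m * [:1, - of_real (v + \<Lambda>):] ^ l)"
    have "null_functional w r (F m) = null_functional w r (\<lambda>s. 1 / (s + of_real \<Lambda>) * poly ?p (1 / (s + of_real \<Lambda>)))"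
    proof (rule null_functional_cong[OF r])
      fix s assume "s \<in> regular"
      then have "s + of_real \<Lambda> \<noteq> 0" by (intro nz) (simp add: regular_def)
      then have "(s + of_real \<Lambda>) * u s = 1" by (simp add: u_def)
      then have e: "s * u s = 1 - of_real \<Lambda> * u s" "(s - of_real v) * u s = 1 - of_real (v + \<Lambda>) * u s"
        by (simp_all add: algebra_simps eq_diff_eq)
      have lin: "poly [:1, - c:] x = 1 - c * x" for c x :: complex by (simp add: algebra_simps)
      show "F m s = 1 / (s + of_real \<Lambda>) * poly ?p (1 / (s + of_real \<Lambda>))"
        unfolding F_def e u_def[symmetric]
        by (simp only: poly_smult poly_mult poly_power lin power_mult_distrib mult_ac)
    qed
    also have "\<dots> = 0" by (rule null_functional_polynomial[OF r \<Lambda> null])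
    finally show ?thesis .
  qed
  define main where "main = (fact l * u (of_real v) ^ Suc l :: complex)"
  have Gv: "G m (of_real v) = u (of_real v) ^ Suc l" for m
  proof -
    have "u (of_real v) = of_real (1 / (v + \<Lambda>))" by (simp add: u_def)
    then have "b * (of_real v * u (of_real v)) = of_real ((v + \<Lambda>) / v * (v * (1 / (v + \<Lambda>))))"
      by (simp only: b_def of_real_mult[symmetric])
    also have "(v + \<Lambda>) / v * (v * (1 / (v + \<Lambda>))) = 1"
    proof -
      have "v + \<Lambda> \<noteq> 0" "v \<noteq> 0" using v(2) \<Lambda> by linarith+
      then show ?thesis by simp
    qed
    finally show ?thesis by (simp add: G_def)
  qed
  \<comment> \<open>Up to an error of order q^m, the functional applied to \<open>F m\<close> reads
    off the single entry \<open>w i0\<close> times a nonzero constant; being 0 for all m, it forces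
    \<open>w i0 = 0\<close>.\<close>
  have approx: "\<exists>E. \<forall>m. norm (w i * coef r i (neumann (F m)) - (if i = i0 then w i0 * main else 0)) \<le> E * q ^ m"
    if i: "i < N" for i
  proof (cases "i0 < i")
    case True
    then show ?thesis using above[OF i True] by (intro exI[of _ 0]) simp
  next
    case False
    let ?T = "sphere (complex_of_real (point i)) r"
    have T: "compact ?T" "?T \<subseteq> regular" using sphere_regular[OF r point_mem] by auto
    have pv: "point i \<le> v" using False rate_pos by (auto simp: point_def v_def)
    obtain E1 where E1: "0 \<le> E1" "\<And>F L. scaling_bounded F \<Longrightarrow> (\<forall>s\<in>?T. \<forall>k. norm (F (s / \<alpha> ^ Suc k)) \<le> L) \<Longrightarrow>
     (\<forall>s\<in>?T. norm (neumann F s - F s) \<le> E1 * L)" using neumann_rest_bound[OF T] by blast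
    have ns: "norm s \<le> point i + r" if "s \<in> ?T" for s
    proof -
      have "norm (s - of_real (point i)) = r" using that by (simp add: dist_norm norm_minus_commute)
      moreover have "norm (complex_of_real (point i)) = point i" unfolding norm_of_real using rate_pos by (simp add: point_def)
      ultimately show ?thesis using norm_triangle_ineq[of "s - of_real (point i)" "of_real (point i)"] by simp
    qed
    have pos: "0 < Re (s / \<alpha> ^ k)" if "s \<in> ?T" for s k
      using regular_div[of s k] T(2) that by (auto simp: regular_def)
    have small: "norm (F m (s / \<alpha> ^ Suc k)) \<le> E0 * q ^ m" if s: "s \<in> ?T" for m s k
    proof (rule F_small[OF pos[OF s]])
      have "norm s \<le> v + v * a / 2"
      proof -
        have "\<mu> * a \<le> v * a" using v(1) rate_pos proportion_pos by (intro mult_right_mono) auto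
        then have "2 * r \<le> v * a" using r0(3) by linarith
        then show ?thesis using ns[OF s] pv by linarith
      qed
      also have "\<dots> = v * (1 + a / 2)" by (simp add: algebra_simps)
      also have "\<dots> \<le> v * (\<eta> * (1 + a))"
        using \<eta>(4) \<alpha>_nz v by (intro mult_left_mono) (auto simp: pos_divide_le_eq)
      also have "\<dots> \<le> v * (\<eta> * (1 + a) ^ Suc k)"
        using \<eta>(1) v proportion_pos power_increasing[of 1 "Suc k" "1 + a"] by (intro mult_left_mono) auto
      finally show "norm (s / \<alpha> ^ Suc k) \<le> \<eta> * v"
        unfolding Re_div_\<alpha> using \<alpha>_nz(4) by (simp add: pos_divide_le_eq mult_ac del: power_Suc)
    qed
    have diff: "norm (neumann (F m) s - F m s) \<le> E1 * (E0 * q ^ m)" if "s \<in> ?T" for m s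
      using E1(2)[OF sb[of m], of "E0 * q ^ m"] small that by blast
    have c: "neumann (F m) holomorphic_on regular" "F m holomorphic_on regular" for m
      by (rule neumann_holomorphic[OF sb]) (rule holomorphic_on_subset[OF F_hol regular_pos])
    have cT: "continuous_on ?T (\<lambda>s. neumann (F m) s - F m s)" "continuous_on ?T (F m)" for m
      using c[THEN holomorphic_on_imp_continuous_on] T(2)
      by (auto intro!: continuous_intros intro: continuous_on_subset)
    define E2 where "E2 = fact (ord i) / r ^ ord i"
    have E2: "0 \<le> E2" using r0 by (simp add: E2_def)
    have rest: "norm (coef r i (neumann (F m)) - coef r i (F m)) \<le> E2 * (E1 * (E0 * q ^ m))" for m
    proof -
      have "coef r i (\<lambda>s. neumann (F m) s + (-1) * F m s) = coef r i (neumann (F m)) + (-1) * coef r i (F m)"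
        by (rule coef_add[OF r c])
      moreover have "norm (coef r i (\<lambda>s. neumann (F m) s - F m s)) \<le> E2 * (E1 * (E0 * q ^ m))"
        unfolding coef_def E2_def ord_def by (rule circ_coef_bound[OF cT(1) diff r0(1)])
      ultimately show ?thesis by simp
    qed
    \<comment> \<open>At v the zero of order l removes the lower orders exactly. On the circle
      around mu, when v = 2 mu, \<open>F m\<close> is itself of order q^m.\<close>
    have lead: "norm (coef r i (F m) - (if i = i0 then main else 0)) \<le> E2 * (E0 * q ^ m)" for m
    proof (cases "point i = v")
      case True
      have oi: "ord i \<le> l" "ord i = l \<longleftrightarrow> i = i0"
        using True False rate_pos by (auto simp: ord_def l_def v_def point_def split: if_splits)
      have "coef r i (F m) = circ_coef (of_real v) r (ord i) (\<lambda>s. (s - of_real v) ^ l * G m s)"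
        unfolding coef_def FG[abs_def] True ord_def ..
      also have "\<dots> = (if ord i = l then fact l * G m (of_real v) else 0)"
        by (rule circ_coef_power_factor[OF G_hol open_halfspace_Re_gt cball_pos[OF r v(1)] r0(1) oi(1)])
      finally have "coef r i (F m) = (if i = i0 then main else 0)"
        unfolding oi(2) Gv main_def .
      then show ?thesis using E0 E2 q by simp
    next
      case False
      then have p: "point i = \<mu>" "v = 2 * \<mu>" using pv v(1) rate_pos by (auto simp: point_def split: if_splits)
      have "norm (F m s) \<le> E0 * q ^ m" if s: "s \<in> ?T" for s
      proof (rule F_small)
        show "0 < Re s" using pos[OF s, of 0] by simp
        have "norm s \<le> \<mu> + \<mu> / 2" using ns[OF s] r0(2) p by linarith
        also have "\<dots> = 3 / 4 * v" by (simp add: p)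
        also have "\<dots> \<le> \<eta> * v" using \<eta>(3) v by (intro mult_right_mono) auto
        finally show "norm s \<le> \<eta> * v" .
      qed
      then have "norm (coef r i (F m)) \<le> E2 * (E0 * q ^ m)"
        unfolding coef_def E2_def ord_def by (rule circ_coef_bound[OF cT(2) _ r0(1)])
      moreover have "i \<noteq> i0" using False by (auto simp: v_def)
      ultimately show ?thesis by simp
    qed
    have "norm (w i * coef r i (neumann (F m)) - (if i = i0 then w i0 * main else 0)) \<le> (norm (w i) * (E2 * E1 * E0 + E2 * E0)) * q ^ m" for m
    proof -
      have "norm (coef r i (neumann (F m)) - (if i = i0 then main else 0)) \<le> E2 * (E1 * (E0 * q ^ m)) + E2 * (E0 * q ^ m)"
        using norm_triangle_ineq[of "coef r i (neumann (F m)) - coef r i (F m)" "coef r i (F m) - (if i = i0 then main else 0)"]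
          rest[of m] lead[of m] by simp
      then have "norm (w i) * norm (coef r i (neumann (F m)) - (if i = i0 then main else 0)) \<le> norm (w i) * (E2 * (E1 * (E0 * q ^ m)) + E2 * (E0 * q ^ m))"
        by (intro mult_left_mono) auto
      moreover have "w i * coef r i (neumann (F m)) - (if i = i0 then w i0 * main else 0) = w i * (coef r i (neumann (F m)) - (if i = i0 then main else 0))"
        by (simp add: algebra_simps)
      ultimately show ?thesis by (simp only: norm_mult) (simp only: algebra_simps)
    qed
    then show ?thesis by blast
  qed
  then obtain E where E: "\<And>i m. i < N \<Longrightarrow> norm (w i * coef r i (neumann (F m)) - (if i = i0 then w i0 * main else 0)) \<le> E i * q ^ m"
    by metis
  have "norm (w i0 * main) \<le> (\<Sum>i<N. E i) * q ^ m" for m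
  proof -
    have "(\<Sum>i<N. w i * coef r i (neumann (F m)) - (if i = i0 then w i0 * main else 0)) = null_functional w r (F m) - w i0 * main"
      unfolding sum_subtractf null_functional_def using i0(1) by simp
    also have "\<dots> = - (w i0 * main)" unfolding F_null by simp
    finally have "norm (w i0 * main) = norm (\<Sum>i<N. w i * coef r i (neumann (F m)) - (if i = i0 then w i0 * main else 0))" by simp
    also have "\<dots> \<le> (\<Sum>i<N. E i * q ^ m)" by (intro sum_norm_le E) simp
    finally show ?thesis by (simp only: sum_distrib_right)
  qed
  moreover have "(\<lambda>m. (\<Sum>i<N. E i) * q ^ m) \<longlonglongrightarrow> (\<Sum>i<N. E i) * 0"
    using q by (intro tendsto_intros LIMSEQ_realpow_zero) auto
  ultimately have "norm (w i0 * main) \<le> (\<Sum>i<N. E i) * 0" by (intro LIMSEQ_le_const) blast+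
  then have "main = 0" using i0(2) by simp
  moreover have "u (of_real v) \<noteq> 0" using nz[of "of_real v"] v by (simp add: u_def)
  ultimately show False by (simp add: main_def)
qed

section \<open>Uniqueness and existence for the system\<close>

text \<open>With \<open>A\<close> the identity minus the system matrix, A d = 0. If d i is nonzero,
  omit column i: the N - 1 equations left for a row vector w have a nonzero solution, and pairing w
  A with d yields the omitted equation too. So w is a left null vector of \<open>A\<close>,
  contradicting \<open>left_null_vector_zero\<close>.\<close>

lemma homogeneous_system_trivial:
  assumes r: "good_radius r" and d: "\<And>i. i < N \<Longrightarrow> d i = coef r i (neumann (vecH d))" and "i < N"
  shows "d i = 0"
proof (rule ccontr)
  assume di: "d i \<noteq> 0"
  define A where "A m j = (if m = j then 1 else 0) - coef r m (neumann (vecH (unit_vec j)))" for m j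
  have Ad: "(\<Sum>j<N. A m j * d j) = 0" if m: "m < N" for m
  proof -
    have "(\<Sum>j<N. A m j * d j) = (\<Sum>j<N. (if m = j then d j else 0) - d j * coef r m (neumann (vecH (unit_vec j))))"
      by (intro sum.cong) (auto simp: A_def algebra_simps)
    also have "\<dots> = d m - coef r m (neumann (vecH d))"
      unfolding sum_subtractf coef_neumann_vecH[OF r, of m d, symmetric] using m by simp
    finally show ?thesis using d[OF m] by simp
  qed
  have "card ({..<N} - {i}) < card {..<N}" using assms(3) by (intro psubset_card_mono) auto
  then obtain w where w: "\<exists>m\<in>{..<N}. w m \<noteq> 0" "\<forall>j\<in>{..<N} - {i}. (\<Sum>m<N. A m j * w m) = 0"
    using underdetermined_system[of "{..<N} - {i}" "{..<N}" "\<lambda>j m. A m j"] by auto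
  have "(\<Sum>j<N. (\<Sum>m<N. A m j * w m) * d j) = (\<Sum>m<N. w m * (\<Sum>j<N. A m j * d j))"
    unfolding sum_distrib_left sum_distrib_right by (subst sum.swap) (simp only: mult_ac)
  also have "\<dots> = 0" using Ad by simp
  finally have "(\<Sum>m<N. A m i * w m) * d i = 0"
    using w(2) assms(3) by (subst (asm) sum.remove[of _ i]) auto
  then have "(\<Sum>m<N. A m j * w m) = 0" if "j < N" for j using w(2) that di by (cases "j = i") auto
  then have "(\<Sum>m<N. w m * coef r m (neumann (vecH (unit_vec j)))) = w j" if "j < N" for j
  proof -
    assume *: "\<And>j. j < N \<Longrightarrow> (\<Sum>m<N. A m j * w m) = 0"
    have "(\<Sum>m<N. A m j * w m) = (\<Sum>m<N. (if m = j then w m else 0) - w m * coef r m (neumann (vecH (unit_vec j))))"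
      by (intro sum.cong) (auto simp: A_def algebra_simps)
    also have "\<dots> = w j - (\<Sum>m<N. w m * coef r m (neumann (vecH (unit_vec j))))"
      unfolding sum_subtractf using that by simp
    finally show ?thesis using *[OF that] by simp
  qed
  then have "w m = 0" if "m < N" for m using left_null_vector_zero[OF r _ that] by blast
  then show False using w(1) by auto
qed

text \<open>In \<open>sigma_eq\<close> the term \<open>rho\<close> contributes exactly the true
  coefficients, so the difference d of the candidate from them solves the homogeneous
  system.\<close>

lemma solves_system_unique:
  assumes sys: "solves_system n \<mu> a \<theta> phi hs y z"
  shows "(\<forall>l\<le>n - 1. y l = p_coef l) \<and> (\<forall>l\<le>2 * n - 2. z l = q_coef l)"
proof -
  obtain r where r: "good_radius r" using good_radius_exists by blast
  define d where "d = combine (\<lambda>l. y l - p_coef l) (\<lambda>l. z l - q_coef l)"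
  have H: "H_hom (\<lambda>l. y l - p_coef l) (\<lambda>l. z l - q_coef l) s = vecH d s" for s
    unfolding vecH_def by (intro H_hom_cong) (use stages in \<open>auto simp: d_def combine_def\<close>)
  then have neu: "neumann (H_hom (\<lambda>l. y l - p_coef l) (\<lambda>l. z l - q_coef l)) = neumann (vecH d)" by presburger
  have "d i = coef r i (neumann (vecH d))" if i: "i < N" for i
  proof -
    have "combine y z i = coef r i (sigma y z)" by (rule solves_system_imp_coef[OF r sys i])
    also have "\<dots> = coef r i (\<lambda>s. rho s + 1 * neumann (vecH d) s)"
      by (rule coef_cong[OF r]) (simp only: sigma_eq neu mult_1)
    also have "\<dots> = coef r i rho + 1 * coef r i (neumann (vecH d))"
      by (rule coef_add[OF r holomorphic_on_subset[OF rho_holomorphic regular_pos] neumann_holomorphic[OF scaling_bounded_vecH]])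
    also have "coef r i rho = combine p_coef q_coef i"
      unfolding coef_eq_deriv[OF r rho_holomorphic] by (simp add: combine_def data_def point_def)
    finally have "combine y z i = combine p_coef q_coef i + coef r i (neumann (vecH d))" unfolding mult_1 .
    moreover have "combine y z i = combine p_coef q_coef i + d i" by (simp add: d_def combine_def)
    ultimately show ?thesis by (simp only: add_left_cancel)
  qed
  then have d0: "d i = 0" if "i < N" for i using homogeneous_system_trivial[OF r _ that] by blast
  show ?thesis
  proof (intro conjI allI impI)
    fix l assume "l \<le> n - 1"
    then have "l < n" "l < N" using stages by linarith+
    then show "y l = p_coef l" using d0[of l] by (simp add: d_def combine_def)
  next
    fix l assume "l \<le> 2 * n - 2"
    then show "z l = q_coef l" using d0[of "n + l"] stages by (simp add: d_def combine_def)
  qed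
qed

lemma singular_points_pos:
  assumes "s \<in> singular_points \<mu> a"
  shows "0 < Re s"
proof -
  obtain v j where vj: "v \<in> {\<mu>, 2 * \<mu>}" "s = of_real (v * (1 + a) ^ (j + 1))"
    by (rule singular_pointsE[OF assms])
  have "0 < v * (1 + a) ^ (j + 1)" using vj(1) rate_pos proportion_pos by (intro mult_pos_pos) auto
  then show ?thesis unfolding vj(2) Re_complex_of_real .
qed

text \<open>With the true coefficients, removing singularities turns the series into
  \<open>rho\<close> on the whole half-plane, so each equation compares a derivative of
  \<open>rho\<close> with itself.\<close>

lemma solves_system_coefs:
  assumes "\<forall>l\<le>n - 1. y l = p_coef l" "\<forall>l\<le>2 * n - 2. z l = q_coef l"
  shows "solves_system n \<mu> a \<theta> phi hs y z"
proof -
  have H: "H_fun n \<mu> a \<theta> phi hs y z s = H_fun n \<mu> a \<theta> phi hs p_coef q_coef s" for s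
    unfolding H_fun_eq by (intro arg_cong2[where f = "(+)"] refl H_hom_cong) (use assms in auto)
  have "series y z w k = series p_coef q_coef w k" for w k unfolding series_eq H ..
  then have ser: "(\<lambda>w. \<Sum>k. series y z w k) = (\<lambda>w. \<Sum>k. series p_coef q_coef w k)" by presburger
  have S: "remove_sings (\<lambda>w. \<Sum>k. series y z w k) s = rho s" if "0 < Re s" for s
    unfolding ser by (rule remove_sings_eqI[OF series_tendsto_rho[OF that]])
  have D: "(deriv ^^ l) (remove_sings (\<lambda>w. \<Sum>k. series y z w k)) (of_real v) = (deriv ^^ l) rho (of_real v)" if "0 < v" for v l
  proof (rule higher_deriv_cong_ev)
    have "eventually (\<lambda>s. s \<in> {s. 0 < Re s}) (nhds (complex_of_real v))"
      using that by (intro eventually_nhds_in_open open_halfspace_Re_gt) simp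
    then show "eventually (\<lambda>s. remove_sings (\<lambda>w. \<Sum>k. series y z w k) s = rho s) (nhds (of_real v))"
      by eventually_elim (simp only: S mem_Collect_eq)
  qed simp
  have "0 < 2 * \<mu>" using rate_pos by simp
  then show ?thesis
    using assms unfolding solves_system_def Let_def D[OF rate_pos] data_def by (simp only: D simp_thms)
qed

end

theorem theorem5:
  fixes M :: "'w measure" and B C :: "nat \<Rightarrow> 'w \<Rightarrow> real" and f\<^sub>B F\<^sub>B h :: "real \<Rightarrow> real"
    and n :: nat and \<mu> \<theta> a :: real
    and \<phi> hs \<rho> :: "complex \<Rightarrow> complex" and p q :: "nat \<Rightarrow> complex"
  assumes model: "dual_risk_model M B C f\<^sub>B n \<mu> \<theta> a"
  defines "F\<^sub>B \<equiv> cdf (distr M borel (B 0))"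
    and "\<phi> \<equiv> laplace_stieltjes M (B 0)"
    and "h \<equiv> (\<lambda>x. f\<^sub>B x * (1 - 2 * F\<^sub>B x))"
    and "hs \<equiv> laplace h"
    and "\<rho> \<equiv> laplace (ruin_prob M B C a)"
    and "p \<equiv> (\<lambda>l. (deriv ^^ l) \<rho> (of_real \<mu>))"
    and "q \<equiv> (\<lambda>l. (deriv ^^ l) \<rho> (of_real (2 * \<mu>)))"
  shows "(\<forall>s. 0 < Re s \<and> s \<notin> singular_points \<mu> a \<longrightarrow>
            series_term n \<mu> a \<theta> \<phi> hs p q s sums \<rho> s)
       \<and> (\<forall>s \<in> singular_points \<mu> a.
            (\<lambda>w. \<Sum>k. series_term n \<mu> a \<theta> \<phi> hs p q w k) \<midarrow>s\<rightarrow> \<rho> s)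
       \<and> (\<forall>y z. solves_system n \<mu> a \<theta> \<phi> hs y z \<longleftrightarrow>
            (\<forall>l \<le> n - 1. y l = p l) \<and> (\<forall>l \<le> 2 * n - 2. z l = q l))"
proof -
  interpret dual_risk_model M B C f\<^sub>B n \<mu> \<theta> a by (rule model)
  have hs: "hs = laplace (\<lambda>x. f\<^sub>B x * (1 - 2 * cdf (distr M borel (B 0)) x))"
    unfolding hs_def h_def F\<^sub>B_def ..
  have \<rho>: "\<rho> = laplace (ruin_prob' )" unfolding \<rho>_def by (rule laplace_ruin_prob)
  have p: "p = data ruin_prob' \<mu>" and q: "q = data ruin_prob' (2 * \<mu>)"
    unfolding p_def q_def \<rho> data_def by simp_all
  show ?thesis
    unfolding p q \<rho> hs \<phi>_def
  proof (intro conjI allI impI ballI)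
    fix s assume "0 < Re s \<and> s \<notin> singular_points \<mu> a"
    then have "s \<in> regular" by (simp add: regular_def)
    then show "series_term n \<mu> a \<theta> (laplace_stieltjes M (B 0)) (laplace (\<lambda>x. f\<^sub>B x * (1 - 2 * cdf (distr M borel (B 0)) x)))
        (data ruin_prob' \<mu>) (data ruin_prob' (2 * \<mu>)) s sums laplace ruin_prob' s"
      by (rule series_sums_rho)
  next
    fix s assume "s \<in> singular_points \<mu> a"
    then show "(\<lambda>w. \<Sum>k. series_term n \<mu> a \<theta> (laplace_stieltjes M (B 0)) (laplace (\<lambda>x. f\<^sub>B x * (1 - 2 * cdf (distr M borel (B 0)) x)))
        (data ruin_prob' \<mu>) (data ruin_prob' (2 * \<mu>)) w k) \<midarrow>s\<rightarrow> laplace ruin_prob' s"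
      by (intro series_tendsto_rho singular_points_pos)
  next
    fix y z
    show "solves_system n \<mu> a \<theta> (laplace_stieltjes M (B 0)) (laplace (\<lambda>x. f\<^sub>B x * (1 - 2 * cdf (distr M borel (B 0)) x))) y z \<longleftrightarrow>
      (\<forall>l\<le>n - 1. y l = data ruin_prob' \<mu> l) \<and> (\<forall>l\<le>2 * n - 2. z l = data ruin_prob' (2 * \<mu>) l)"
      using solves_system_unique[of y z] solves_system_coefs[of y z] by blast
  qed
qed

end
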